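(* Let $n \geq 2$ be an integer, let $\Gamma$ be a Kleinian group acting on $\mathbb{D}^n$, and let $C$ be a non-empty subset of $\mathbb{D}^n$ that is bounded with respect to the hyperbolic metric. Let $\Gamma(C) = \bigcup_{g \in \Gamma} g(C)$. Then $$\overline{\dim}_{\mathrm{B}}\, \Gamma(C) = \max\left\{\overline{\dim}_{\mathrm{B}}\, L(\Gamma),\ \overline{\dim}_{\mathrm{B}}\, C,\ \delta(\Gamma)\right\}.$$
   Context: $\mathbb{D}^n = \{z \in \mathbb{R}^n : |z|<1\}$ is the Poincaré ball with the hyperbolic metric $d$ given by the length element $|ds| = \frac{2|dz|}{1-|z|^2}$. $\mathrm{con}^+(\mathbb{D}^n)$ is the group of orientation preserving isometries of $(\mathbb{D}^n,d)$ (equivalently, orientation preserving conformal automorphisms of $\mathbb{D}^n$). A Kleinian group is a subgroup $\Gamma \leq \mathrm{con}^+(\mathbb{D}^n)$ which is a discrete subset of $\mathrm{con}^+(\mathbb{D}^n)$; no other assumption is made (it may be elementary or geometrically infinite). The limit set of $\Gamma$ is $L(\Gamma) = \overline{\Gamma(0)} \setminus \Gamma(0)$, where $\Gamma(0)=\{g(0): g \in \Gamma\}$ and the closure is the Euclidean closure in $\mathbb{R}^n$. The Poincaré exponent is $\delta(\Gamma) = \inf\{s \geq 0 : P_\Gamma(s)<\infty\}$, where $$P_\Gamma(s) = \sum_{g \in \Gamma} \exp(-s\, d(0,g(0))) = \sum_{g\in\Gamma}\left(\frac{1-|g(0)|}{1+|g(0)|}\right)^s .$$ For a bounded set $E \subseteq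 \mathbb{R}^n$ and a scale $\rho>0$, $N_\rho(E)$ is the smallest number of sets of (Euclidean) diameter $\rho$ (equivalently, at most $\rho$) required to cover $E$, and the upper box dimension is $\overline{\dim}_{\mathrm{B}} E = \limsup_{\rho \to 0} \frac{\log N_\rho(E)}{-\log \rho}$. All dimensions are computed with respect to the Euclidean metric on $\mathbb{R}^n$. If $L(\Gamma)$ is empty (i.e. $\Gamma$ is finite), its upper box dimension is taken to be $0$. *)

theory Defs
  imports "HOL-Analysis.Analysis" "HOL-Algebra.Bij"
begin

abbreviation Disc :: "(real ^ 'n) set" where
  "Disc \<equiv> ball 0 1"

text \<open>
  The hyperbolic distance is the infimum of the hyperbolic lengths of paths. Library paths
  that are piecewise \<open>C\<^sup>1\<close> may have infinite length (the derivative may be unbounded near a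
  break point), in which case \<^const>\<open>integral\<close> would silently return \<open>0\<close>; using
  \<^const>\<open>has_integral\<close> leaves exactly the paths of finite length.
\<close>

definition hyp_dist :: "real ^ 'n \<Rightarrow> real ^ 'n \<Rightarrow> real" where
  "hyp_dist x y = Inf {l. \<exists>\<gamma>. valid_path \<gamma> \<and> path_image \<gamma> \<subseteq> Disc \<and>
     pathstart \<gamma> = x \<and> pathfinish \<gamma> = y \<and>
     ((\<lambda>t. 2 * norm (vector_derivative \<gamma> (at t within {0..1})) / (1 - (norm (\<gamma> t))\<^sup>2))
        has_integral l) {0..1}}"

definition hyp_bounded :: "(real ^ 'n) set \<Rightarrow> bool" where
  "hyp_bounded C \<longleftrightarrow> (\<exists>r. \<forall>x\<in>C. \<forall>y\<in>C. hyp_dist x y \<le> r)"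

text \<open>
  Self-maps of the ball are elements of \<^term>\<open>Bij Disc\<close>, i.e. bijections of the ball that take
  the value \<^const>\<open>undefined\<close> outside it. Hence two such maps are equal iff they agree on the
  ball, and sums over a set of maps do not count a map twice.
\<close>

definition con_plus :: "(real ^ 'n \<Rightarrow> real ^ 'n) set" where
  "con_plus = {f \<in> Bij Disc.
     (\<forall>x\<in>Disc. \<forall>y\<in>Disc. hyp_dist (f x) (f y) = hyp_dist x y) \<and>
     (\<forall>x\<in>Disc. \<exists>f'. (f has_derivative f') (at x) \<and> det (matrix f') > 0)}"

text \<open>
  The topology of \<^term>\<open>con_plus\<close> is the one induced by the compact-open topology
  (locally uniform convergence on the ball).
\<close>

definition compact_open :: "(real ^ 'n \<Rightarrow> real ^ 'n) topology" where
  "compact_open = topology_generated_by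
     {{f. f ` K \<subseteq> U} | K U. compact K \<and> K \<subseteq> Disc \<and> open U}"

definition kleinian :: "(real ^ 'n \<Rightarrow> real ^ 'n) set \<Rightarrow> bool" where
  "kleinian \<Gamma> \<longleftrightarrow> subgroup \<Gamma> (BijGroup Disc) \<and> \<Gamma> \<subseteq> con_plus \<and>
     subtopology compact_open \<Gamma> = discrete_topology \<Gamma>"

definition orbit_set :: "('a \<Rightarrow> 'a) set \<Rightarrow> 'a set \<Rightarrow> 'a set" where
  "orbit_set \<Gamma> C = (\<Union>g\<in>\<Gamma>. g ` C)"

definition limit_set :: "(real ^ 'n \<Rightarrow> real ^ 'n) set \<Rightarrow> (real ^ 'n) set" where
  "limit_set \<Gamma> = closure (orbit_set \<Gamma> {0}) - orbit_set \<Gamma> {0}"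

definition poincare_series :: "(real ^ 'n \<Rightarrow> real ^ 'n) set \<Rightarrow> real \<Rightarrow> ennreal" where
  "poincare_series \<Gamma> s = (\<Sum>\<^sub>\<infinity>g\<in>\<Gamma>. ennreal (exp (- s * hyp_dist 0 (g 0))))"

definition poincare_exponent :: "(real ^ 'n \<Rightarrow> real ^ 'n) set \<Rightarrow> ereal" where
  "poincare_exponent \<Gamma> = Inf {ereal s | s. 0 \<le> s \<and> poincare_series \<Gamma> s < \<infinity>}"

text \<open>
  Boundedness of the covering sets is required explicitly, since \<^const>\<open>diameter\<close> is a real
  number without meaning for unbounded sets.
\<close>

definition covering_number :: "real \<Rightarrow> 'a::metric_space set \<Rightarrow> nat" where
  "covering_number \<rho> E = (LEAST k. \<exists>\<U>. finite \<U> \<and> card \<U> = k \<and> E \<subseteq> \<Union>\<U> \<and>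
     (\<forall>U\<in>\<U>. bounded U \<and> diameter U \<le> \<rho>))"

text \<open>Meaningful for bounded subsets of Euclidean space; the empty set has dimension \<open>0\<close>.\<close>

definition upper_box_dim :: "'a::metric_space set \<Rightarrow> ereal" where
  "upper_box_dim E = (if E = {} then 0
     else Limsup (at_right 0) (\<lambda>\<rho>. ereal (ln (real (covering_number \<rho> E)) / - ln \<rho>)))"

end

theory Submission
  imports Defs
begin

text \<open>
  An isometry of the hyperbolic metric preserves \<open>|x - y|\<^sup>2 / ((1 - |x|\<^sup>2) (1 - |y|\<^sup>2))\<close>, so that
  \<open>g\<close> acts on a hyperbolically bounded set like a Euclidean similarity of ratio comparable to
  \<open>1 - |g 0|\<close>. Separation of the orbit turns coverings of \<open>\<Gamma>(C)\<close> into bounds for the Poincare series.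
  Conversely, at scale \<open>\<rho>\<close> the sets \<open>g C\<close> with \<open>1 - |g 0| \<ge> \<rho>\<close> are covered one by one, at a total cost
  bounded by the Poincare series, and the others lie near the limit set if that has at least two points.
  If the limit set is a single point \<open>p\<close>, then \<open>\<Gamma>\<close> preserves the horospheres at \<open>p\<close> and, after inversion
  in \<open>p\<close>, is a discrete group of Euclidean isometries. By Bieberbach's commutator argument that group has
  an abelian subgroup of finite index whose orbits follow a lattice of translations. Base \<open>l\<close> expansions
  with digits in such a lattice bound its separated subsets at all scales by its asymptotic growth,
  which the Poincare series controls.
\<close>

section \<open>Box dimension\<close>

text \<open>The hard case is a limit set {p}. Its dimension is 0, and orbit points of depth d lie at
  distance \<open>sqrt d\<close> from p, much farther than d, so thickening the limit set does not
  reach them. The Poincare series must pay for these points, although it sees only how many group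
  elements there are, not how they are spaced. In half space coordinates convergence at s gives at
  most \<open>C * X powr (2 * s)\<close> orbit points of norm at most X. For covers at scale \<rho>
  the points of depth about \<rho> / 4^k become a subset of a ball of radius R = 2^(k+1) / sqrt
  \<rho> with separation r = D * 4^k. The plain count R^(2s), summed over the admissible k, only
  yields the power -2s of \<rho>. The bound (R/r)^(2s) decays like 4^(-ks) and yields the power -s.
  Growth at infinity does not imply such a two-scale bound for an arbitrary set; the additive
  structure of the translation vectors does, and this is why the algebraic structure of the group
  has to be determined.\<close>

definition scale_cover :: "real \<Rightarrow> 'a::metric_space set \<Rightarrow> 'a set set \<Rightarrow> bool" where
  "scale_cover \<rho> E \<U> \<longleftrightarrow> finite \<U> \<and> E \<subseteq> \<Union>\<U> \<and> (\<forall>U\<in>\<U>. bounded U \<and> diameter U \<le> \<rho>)"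

lemma scale_coverD:
  assumes "scale_cover \<rho> E \<U>" "U \<in> \<U>" "x \<in> U" "y \<in> U"
  shows "dist x y \<le> \<rho>"
  using assms diameter_bounded_bound[of U x y] by (auto simp: scale_cover_def)

lemma covering_number_eq:
  "covering_number \<rho> E = (LEAST k. \<exists>\<U>. scale_cover \<rho> E \<U> \<and> card \<U> = k)"
  unfolding covering_number_def scale_cover_def by (rule arg_cong[where f=Least]) (auto simp: fun_eq_iff)

lemma covering_number_le_card: "scale_cover \<rho> E \<U> \<Longrightarrow> covering_number \<rho> E \<le> card \<U>"
  unfolding covering_number_eq by (rule Least_le) auto

lemma diameter_le_of_dist:
  fixes S :: "'a::metric_space set"
  assumes "\<And>x y. x \<in> S \<Longrightarrow> y \<in> S \<Longrightarrow> dist x y \<le> d" "0 \<le> d"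
  shows "bounded S" "diameter S \<le> d"
proof -
  show "bounded S"
    unfolding bounded_two_points using assms by blast
  show "diameter S \<le> d"
    unfolding diameter_def using assms by (auto intro!: cSUP_least)
qed

lemma exists_scale_cover:
  fixes E :: "'a::euclidean_space set"
  assumes "bounded E" "0 < \<rho>"
  shows "\<exists>\<U>. scale_cover \<rho> E \<U>"
proof -
  have "compact (closure E)" using assms by simp
  then obtain K where K: "finite K" "closure E \<subseteq> (\<Union>x\<in>K. ball x (\<rho>/2))"
    using seq_compact_imp_totally_bounded[of "closure E"] assms
    by (auto simp: seq_compact_eq_compact dest!: spec[of _ "\<rho>/2"])
  have "diameter (ball x (\<rho>/2)) \<le> \<rho>" for x :: 'a
    using assms by simp
  then have "scale_cover \<rho> E ((\<lambda>x. ball x (\<rho>/2)) ` K)"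
    unfolding scale_cover_def using K closure_subset[of E] by blast
  then show ?thesis by blast
qed

lemma covering_number_witness:
  fixes E :: "'a::euclidean_space set"
  assumes "bounded E" "0 < \<rho>"
  obtains \<U> where "scale_cover \<rho> E \<U>" "card \<U> = covering_number \<rho> E"
proof -
  have "\<exists>k \<U>. scale_cover \<rho> E \<U> \<and> card \<U> = k"
    using exists_scale_cover[OF assms] by simp
  from LeastI_ex[OF this] show ?thesis
    unfolding covering_number_eq[symmetric] using that by (elim exE conjE)
qed

lemma covering_number_pos:
  fixes E :: "'a::euclidean_space set"
  assumes "bounded E" "0 < \<rho>" "E \<noteq> {}"
  shows "1 \<le> covering_number \<rho> E"
proof -
  obtain \<U> where U: "scale_cover \<rho> E \<U>" "card \<U> = covering_number \<rho> E"
    by (rule covering_number_witness[OF assms(1,2)])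
  then have "\<U> \<noteq> {}" "finite \<U>" using assms by (auto simp: scale_cover_def)
  then show ?thesis using U(2) by (metis One_nat_def Suc_leI card_gt_0_iff)
qed

lemma covering_number_antimono:
  fixes E F :: "'a::euclidean_space set"
  assumes "bounded F" "E \<subseteq> F" "0 < \<rho>" "\<rho> \<le> \<sigma>"
  shows "covering_number \<sigma> E \<le> covering_number \<rho> F"
proof -
  obtain \<U> where U: "scale_cover \<rho> F \<U>" "card \<U> = covering_number \<rho> F"
    by (rule covering_number_witness[OF assms(1,3)])
  have "scale_cover \<sigma> E \<U>"
    using U(1) assms(2,4) unfolding scale_cover_def by fastforce
  then show ?thesis using covering_number_le_card U by metis
qed

text \<open>Replacing the members of a finite cover by their closures keeps the diameters and makes
  the union closed.\<close>

lemma covering_number_closure: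
  fixes E :: "'a::euclidean_space set"
  assumes "bounded E" "0 < \<rho>"
  shows "covering_number \<rho> (closure E) \<le> covering_number \<rho> E"
proof -
  obtain \<U> where U: "scale_cover \<rho> E \<U>" "card \<U> = covering_number \<rho> E"
    by (rule covering_number_witness[OF assms])
  then have fin: "finite \<U>" by (simp add: scale_cover_def)
  have "scale_cover \<rho> (closure E) (closure ` \<U>)"
  proof -
    have "closure E \<subseteq> \<Union>(closure ` \<U>)"
    proof (rule closure_minimal)
      show "E \<subseteq> \<Union>(closure ` \<U>)"
        using U(1) unfolding scale_cover_def by (auto dest!: subsetD intro: subsetD[OF closure_subset])
      show "closed (\<Union>(closure ` \<U>))" using fin by (intro closed_Union) auto
    qed
    then show ?thesis using U(1) unfolding scale_cover_def by (auto simp: diameter_closure)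
  qed
  then show ?thesis
    using covering_number_le_card card_image_le[OF fin] U(2) by (metis le_trans)
qed

lemma upper_box_dim_mono_eventually:
  fixes E F :: "'a::euclidean_space set"
  assumes "E \<noteq> {}" "F \<noteq> {}" and bnd: "bounded E"
    and le: "\<And>\<rho>. 0 < \<rho> \<Longrightarrow> \<rho> < 1 \<Longrightarrow> covering_number \<rho> E \<le> covering_number \<rho> F"
  shows "upper_box_dim E \<le> upper_box_dim F"
proof -
  have "eventually (\<lambda>\<rho>::real. 0 < \<rho> \<and> \<rho> < 1) (at_right 0)"
    unfolding eventually_at_right_field by (rule exI[of _ 1]) auto
  then have "Limsup (at_right 0) (\<lambda>\<rho>. ereal (ln (real (covering_number \<rho> E)) / - ln \<rho>))
     \<le> Limsup (at_right 0) (\<lambda>\<rho>. ereal (ln (real (covering_number \<rho> F)) / - ln \<rho>))"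
  proof (intro Limsup_mono, elim eventually_mono)
    fix \<rho> :: real assume r: "0 < \<rho> \<and> \<rho> < 1"
    have "1 \<le> covering_number \<rho> E" using covering_number_pos[OF bnd _ assms(1)] r by simp
    moreover have "covering_number \<rho> E \<le> covering_number \<rho> F" using le r by blast
    ultimately have "ln (real (covering_number \<rho> E)) \<le> ln (real (covering_number \<rho> F))"
      by simp
    moreover have "ln \<rho> < 0" using r by simp
    ultimately show "ereal (ln (real (covering_number \<rho> E)) / - ln \<rho>)
        \<le> ereal (ln (real (covering_number \<rho> F)) / - ln \<rho>)"
      by (simp add: divide_right_mono_neg)
  qed
  then show ?thesis using assms by (simp add: upper_box_dim_def)
qed

lemma upper_box_dim_nonneg:
  fixes E :: "'a::euclidean_space set"
  assumes "bounded E"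
  shows "0 \<le> upper_box_dim E"
proof (cases "E = {}")
  case False
  have "eventually (\<lambda>\<rho>::real. 0 < \<rho> \<and> \<rho> < 1) (at_right 0)"
    unfolding eventually_at_right_field by (rule exI[of _ 1]) auto
  then have "eventually (\<lambda>\<rho>. 0 \<le> ereal (ln (real (covering_number \<rho> E)) / - ln \<rho>)) (at_right 0)"
  proof (elim eventually_mono)
    fix \<rho> :: real assume r: "0 < \<rho> \<and> \<rho> < 1"
    have "1 \<le> covering_number \<rho> E" using covering_number_pos[OF assms _ False] r by simp
    then have "0 \<le> ln (real (covering_number \<rho> E))" by simp
    moreover have "ln \<rho> < 0" using r by simp
    ultimately show "0 \<le> ereal (ln (real (covering_number \<rho> E)) / - ln \<rho>)"
      by (simp add: divide_nonneg_neg)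
  qed
  then have "0 \<le> Liminf (at_right 0) (\<lambda>\<rho>. ereal (ln (real (covering_number \<rho> E)) / - ln \<rho>))"
    by (simp add: Liminf_bounded)
  also have "\<dots> \<le> Limsup (at_right 0) (\<lambda>\<rho>. ereal (ln (real (covering_number \<rho> E)) / - ln \<rho>))"
    by (rule Liminf_le_Limsup) simp
  finally show ?thesis using False by (simp add: upper_box_dim_def)
qed (simp add: upper_box_dim_def)

lemma upper_box_dim_mono:
  fixes E F :: "'a::euclidean_space set"
  assumes "bounded F" "E \<subseteq> F"
  shows "upper_box_dim E \<le> upper_box_dim F"
proof (cases "E = {}")
  case True
  then show ?thesis using upper_box_dim_nonneg[OF assms(1)] by (simp add: upper_box_dim_def)
next
  case False
  then show ?thesis
    using assms bounded_subset
    by (intro upper_box_dim_mono_eventually) (auto intro: covering_number_antimono)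
qed

lemma upper_box_dim_closure:
  fixes E :: "'a::euclidean_space set"
  assumes "bounded E"
  shows "upper_box_dim (closure E) \<le> upper_box_dim E"
proof (cases "E = {}")
  case False
  then show ?thesis
    using assms by (intro upper_box_dim_mono_eventually covering_number_closure) auto
qed simp

text \<open>The factors \<open>K\<close> and \<open>B\<close> contribute only
  \<open>(ln c + s * ln K) / - ln \<rho>\<close>, which tends to 0. Covers may therefore be wasteful
  by bounded factors both in scale and in number.\<close>

lemma upper_box_dim_leI:
  fixes E :: "'a::euclidean_space set"
  assumes bnd: "bounded E" and s: "0 \<le> s" and K: "0 < K" and r0: "0 < r0"
    and cov: "\<And>\<rho>. 0 < \<rho> \<Longrightarrow> \<rho> < r0 \<Longrightarrow>
      \<exists>\<U>. scale_cover (K * \<rho>) E \<U> \<and> real (card \<U>) \<le> B * \<rho> powr (- s)"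
  shows "upper_box_dim E \<le> ereal s"
proof (cases "E = {}")
  case True
  then show ?thesis using s by (simp add: upper_box_dim_def)
next
  case False
  \<comment> \<open>\<open>B\<close> carries no sign condition, and the logarithm below needs a
    positive factor.\<close>
  define c where "c = \<bar>B\<bar> + 1"
  have c: "0 < c" "B \<le> c" by (auto simp: c_def)
  have lim: "((\<lambda>\<rho>. (ln c + s * ln K) / - ln \<rho> + s) \<longlongrightarrow> 0 + s) (at_right 0)"
  proof -
    have "filterlim (\<lambda>\<rho>::real. - ln \<rho>) at_top (at_right 0)"
      using ln_at_0 by (simp add: filterlim_uminus_at_top)
    then have "((\<lambda>\<rho>. (ln c + s * ln K) / - ln \<rho>) \<longlongrightarrow> 0) (at_right 0)"
      using real_tendsto_divide_at_top tendsto_const by blast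
    then show ?thesis by (intro tendsto_add tendsto_const)
  qed
  have "eventually (\<lambda>\<rho>::real. 0 < \<rho> \<and> \<rho> < min 1 (K * r0)) (at_right 0)"
    unfolding eventually_at_right_field using K r0 by (intro exI[of _ "min 1 (K * r0)"]) auto
  then have "eventually (\<lambda>\<rho>. ereal (ln (real (covering_number \<rho> E)) / - ln \<rho>)
      \<le> ereal ((ln c + s * ln K) / - ln \<rho> + s)) (at_right 0)"
  proof (elim eventually_mono)
    fix \<rho> :: real assume r: "0 < \<rho> \<and> \<rho> < min 1 (K * r0)"
    then have "\<rho> / K < r0" "0 < \<rho> / K" using K by (auto simp: field_simps)
    then obtain \<U> where U: "scale_cover \<rho> E \<U>" "real (card \<U>) \<le> B * (\<rho> / K) powr (- s)"
      using cov[of "\<rho> / K"] K by auto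
    have "1 \<le> covering_number \<rho> E" using covering_number_pos[OF bnd _ False] r by simp
    moreover have "real (covering_number \<rho> E) \<le> c * (\<rho> / K) powr (- s)"
      using covering_number_le_card[OF U(1)] U(2) mult_right_mono[OF c(2) powr_ge_zero, of "\<rho> / K" "- s"]
      by linarith
    ultimately have "ln (real (covering_number \<rho> E)) \<le> ln (c * (\<rho> / K) powr (- s))"
      by simp
    also have "\<dots> = ln c + s * ln K - s * ln \<rho>"
      using c K r by (simp add: ln_mult ln_powr ln_div algebra_simps)
    finally have "ln (real (covering_number \<rho> E)) \<le> ln c + s * ln K - s * ln \<rho>" .
    moreover have "ln \<rho> < 0" using r by simp
    ultimately have "ln (real (covering_number \<rho> E)) / - ln \<rho> \<le> (ln c + s * ln K - s * ln \<rho>) / - ln \<rho>"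
      by (intro divide_right_mono) auto
    also have "\<dots> = (ln c + s * ln K) / - ln \<rho> + s"
      using \<open>ln \<rho> < 0\<close> by (simp add: field_simps)
    finally show "ereal (ln (real (covering_number \<rho> E)) / - ln \<rho>)
      \<le> ereal ((ln c + s * ln K) / - ln \<rho> + s)" by simp
  qed
  then have "Limsup (at_right 0) (\<lambda>\<rho>. ereal (ln (real (covering_number \<rho> E)) / - ln \<rho>))
     \<le> Limsup (at_right 0) (\<lambda>\<rho>. ereal ((ln c + s * ln K) / - ln \<rho> + s))"
    by (rule Limsup_mono)
  also have "\<dots> = ereal s"
    using lim by (intro lim_imp_Limsup) auto
  finally show ?thesis using False by (simp add: upper_box_dim_def)
qed

lemma covering_number_bound:
  fixes E :: "'a::euclidean_space set"
  assumes bnd: "bounded E" and s: "0 \<le> s" and dim: "upper_box_dim E < ereal s"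
  obtains B where "0 < B" "\<And>\<rho>. 0 < \<rho> \<Longrightarrow> \<rho> \<le> M \<Longrightarrow> real (covering_number \<rho> E) \<le> B * \<rho> powr (- s)"
proof (cases "E = {}")
  case True
  have "covering_number \<rho> E = 0" for \<rho>
    using covering_number_le_card[of \<rho> E "{}"] True by (simp add: scale_cover_def)
  then show ?thesis using that[of 1] by simp
next
  case False
  then have "Limsup (at_right 0) (\<lambda>\<rho>. ereal (ln (real (covering_number \<rho> E)) / - ln \<rho>)) < ereal s"
    using dim by (simp add: upper_box_dim_def)
  then have "eventually (\<lambda>\<rho>. ereal (ln (real (covering_number \<rho> E)) / - ln \<rho>) < ereal s) (at_right 0)"
    by (rule Limsup_lessD)
  then obtain r where r: "0 < r" "\<And>\<rho>. 0 < \<rho> \<Longrightarrow> \<rho> < r \<Longrightarrow> ln (real (covering_number \<rho> E)) / - ln \<rho> < s"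
    unfolding eventually_at_right_field by auto
  \<comment> \<open>Strictly below \<open>r\<close>, so that the estimate also holds at the endpoint
    \<open>\<rho> = r0\<close>.\<close>
  define r0 where "r0 = min r 1 / 2"
  have r0: "0 < r0" "r0 < r" "r0 < 1" using r by (auto simp: r0_def min_def)
  have small: "real (covering_number \<rho> E) \<le> \<rho> powr (- s)" if "0 < \<rho>" "\<rho> \<le> r0" for \<rho>
  proof -
    have p: "1 \<le> covering_number \<rho> E" using covering_number_pos[OF bnd _ False] that by simp
    have "ln \<rho> < 0" using that r0 by simp
    moreover have "ln (real (covering_number \<rho> E)) / - ln \<rho> < s" using r that r0 by auto
    ultimately have "ln (real (covering_number \<rho> E)) < - s * ln \<rho>" by (simp add: field_simps)
    then have "exp (ln (real (covering_number \<rho> E))) \<le> exp (- s * ln \<rho>)" by simp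
    then show ?thesis using p that by (simp add: powr_def)
  qed
  \<comment> \<open>The second entry serves the scales between \<open>r0\<close> and
    \<open>M\<close>: there the covering number is at most its value at \<open>r0\<close>, while
    \<open>\<rho> powr (- s)\<close> may have dropped to \<open>M powr (- s)\<close>.\<close>
  define B where "B = max 1 (r0 powr (- s) * max M 1 powr s)"
  show ?thesis
  proof (rule that[of B])
    show "0 < B" by (simp add: B_def)
    fix \<rho> :: real assume rho: "0 < \<rho>" "\<rho> \<le> M"
    show "real (covering_number \<rho> E) \<le> B * \<rho> powr (- s)"
    proof (cases "\<rho> \<le> r0")
      case True
      have "\<rho> powr (- s) \<le> B * \<rho> powr (- s)"
        using mult_right_mono[of 1 B "\<rho> powr (- s)"] by (simp add: B_def)
      then show ?thesis using small[OF rho(1) True] by linarith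
    next
      case F: False
      have "real (covering_number \<rho> E) \<le> real (covering_number r0 E)"
        using covering_number_antimono[OF bnd order_refl, of r0 \<rho>] r0 F by simp
      also have "\<dots> \<le> r0 powr (- s)" using small[of r0] r0 by simp
      also have "\<dots> \<le> (r0 powr (- s) * max M 1 powr s) * \<rho> powr (- s)"
      proof -
        have "\<rho> powr s \<le> max M 1 powr s" using rho s by (intro powr_mono2) auto
        then have "1 \<le> max M 1 powr s * \<rho> powr (- s)"
          using rho by (simp add: powr_minus field_simps)
        then have "r0 powr (- s) * 1 \<le> r0 powr (- s) * (max M 1 powr s * \<rho> powr (- s))"
          by (intro mult_left_mono) auto
        then show ?thesis by (simp add: mult.assoc)
      qed
      also have "\<dots> \<le> B * \<rho> powr (- s)"
        unfolding B_def by (intro mult_right_mono) auto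
      finally show ?thesis .
    qed
  qed
qed

section \<open>The hyperbolic metric\<close>

text \<open>Comparable to the Euclidean distance to the unit sphere, but polynomial in the
  coordinates; the metric density is 2 divided by it.\<close>

definition depth :: "'a::real_inner \<Rightarrow> real" where
  "depth x = 1 - (norm x)\<^sup>2"

text \<open>This is \<open>(sinh (d / 2))\<^sup>2\<close> for the hyperbolic distance
  \<open>d\<close>, as \<open>hyp_dist_eq\<close> shows. It is an algebraic substitute for the
  distance.\<close>

definition hyp_quot :: "'a::real_inner \<Rightarrow> 'a \<Rightarrow> real" where
  "hyp_quot x y = (norm (x - y))\<^sup>2 / (depth x * depth y)"

lemma depth_pos [simp]: "norm x < 1 \<Longrightarrow> 0 < depth x"
  by (simp add: depth_def power_less_one_iff abs_square_less_1)

lemma depth_le_1: "depth x \<le> 1"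
  by (simp add: depth_def)

lemma hyp_quot_commute: "hyp_quot x y = hyp_quot y x"
  by (simp add: hyp_quot_def norm_minus_commute mult.commute)

lemma hyp_quot_nonneg: "norm x < 1 \<Longrightarrow> norm y < 1 \<Longrightarrow> 0 \<le> hyp_quot x y"
  by (simp add: hyp_quot_def less_imp_le)

lemma hyp_quot_0: "hyp_quot 0 x = (norm x)\<^sup>2 / depth x"
  by (simp add: hyp_quot_def depth_def)

lemma norm_diff_sq_eq:
  assumes "norm x < 1" "norm y < 1"
  shows "(norm (x - y))\<^sup>2 = hyp_quot x y * depth x * depth y"
  using depth_pos[OF assms(1)] depth_pos[OF assms(2)] by (simp add: hyp_quot_def)

section \<open>Lower bound for the hyperbolic length of a path\<close>

lemma norm_gradient_hyp_quot:
  fixes x y :: "'a::real_inner"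
  shows "(norm (depth y *\<^sub>R (y - x) + (norm (x - y))\<^sup>2 *\<^sub>R y))\<^sup>2
    = (norm (x - y))\<^sup>2 * (depth x * depth y + (norm (x - y))\<^sup>2)"
  unfolding depth_def power2_norm_eq_inner
  by (simp add: inner_simps inner_commute algebra_simps power2_eq_square)

text \<open>With q for the quotient, the derivative of \<open>2 * arsinh (sqrt q)\<close> is
  \<open>D / sqrt (q * (q + 1))\<close>, so the bound says that this function grows no faster than
  hyperbolic length. The vector in \<open>norm_gradient_hyp_quot\<close> is the gradient of q up to
  a scalar factor, and its norm is exactly what makes the bound come out by Cauchy-Schwarz.\<close>

lemma hyp_quot_has_derivative:
  fixes \<gamma> :: "real \<Rightarrow> 'a::real_inner"
  assumes x: "norm x < 1" and g: "norm (\<gamma> t) < 1"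
    and d: "(\<gamma> has_vector_derivative v) (at t)"
  obtains D where "((\<lambda>t. hyp_quot x (\<gamma> t)) has_real_derivative D) (at t)"
    "\<bar>D\<bar> \<le> 2 * norm v / depth (\<gamma> t) * sqrt (hyp_quot x (\<gamma> t) * (hyp_quot x (\<gamma> t) + 1))"
proof -
  define A where "A = (norm (x - \<gamma> t))\<^sup>2"
  define a b where "a = depth x" and "b = depth (\<gamma> t)"
  define w where "w = b *\<^sub>R (\<gamma> t - x) + A *\<^sub>R \<gamma> t"
  have pos: "0 < a" "0 < b" using x g by (auto simp: a_def b_def)
  have d': "(\<gamma> has_derivative (\<lambda>h. h *\<^sub>R v)) (at t)"
    using d by (simp add: has_vector_derivative_def)
  have num: "((\<lambda>t. (norm (x - \<gamma> t))\<^sup>2) has_real_derivative (2 * ((\<gamma> t - x) \<bullet> v))) (at t)"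
    unfolding has_field_derivative_def power2_norm_eq_inner
    by (rule derivative_eq_intros d' refl)+ (auto simp: fun_eq_iff inner_simps inner_commute algebra_simps)
  have den: "((\<lambda>t. depth x * depth (\<gamma> t)) has_real_derivative (a * (- 2 * (\<gamma> t \<bullet> v)))) (at t)"
    unfolding has_field_derivative_def power2_norm_eq_inner depth_def a_def
    by (rule derivative_eq_intros d' refl)+ (auto simp: fun_eq_iff inner_simps inner_commute algebra_simps)
  define D where "D = 2 * (w \<bullet> v) / (a * b\<^sup>2)"
  have "((\<lambda>t. hyp_quot x (\<gamma> t)) has_real_derivative
      ((2 * ((\<gamma> t - x) \<bullet> v)) * (a * b) - A * (a * (- 2 * (\<gamma> t \<bullet> v)))) / ((a * b) * (a * b))) (at t)"
    unfolding hyp_quot_def using DERIV_divide[OF num den] pos by (simp add: a_def b_def A_def)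
  also have "((2 * ((\<gamma> t - x) \<bullet> v)) * (a * b) - A * (a * (- 2 * (\<gamma> t \<bullet> v)))) / ((a * b) * (a * b)) = D"
    unfolding D_def w_def using pos by (simp add: inner_simps field_simps power2_eq_square)
  finally have "((\<lambda>t. hyp_quot x (\<gamma> t)) has_real_derivative D) (at t)" .
  moreover have "\<bar>D\<bar> \<le> 2 * norm v / b * sqrt (A / (a * b) * (A / (a * b) + 1))"
  proof -
    have "(norm w)\<^sup>2 = A * (a * b + A)"
      using norm_gradient_hyp_quot[of "\<gamma> t" x] by (simp add: w_def A_def a_def b_def)
    also have "\<dots> = (a * b)\<^sup>2 * (A / (a * b) * (A / (a * b) + 1))"
      using pos by (simp add: field_simps power2_eq_square)
    finally have "norm w = sqrt ((a * b)\<^sup>2 * (A / (a * b) * (A / (a * b) + 1)))"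
      by (metis norm_ge_zero real_sqrt_unique)
    also have "\<dots> = (a * b) * sqrt (A / (a * b) * (A / (a * b) + 1))"
      using pos by (subst real_sqrt_mult) simp
    finally have w: "norm w = (a * b) * sqrt (A / (a * b) * (A / (a * b) + 1))" .
    have "\<bar>D\<bar> = 2 * \<bar>w \<bullet> v\<bar> / (a * b\<^sup>2)"
      using pos by (simp add: D_def abs_mult)
    also have "\<dots> \<le> 2 * (norm w * norm v) / (a * b\<^sup>2)"
      using pos Cauchy_Schwarz_ineq2[of w v] by (intro divide_right_mono mult_left_mono) auto
    also have "\<dots> = 2 * norm v / b * sqrt (A / (a * b) * (A / (a * b) + 1))"
      unfolding w using pos by (simp add: power2_eq_square)
    finally show ?thesis .
  qed
  ultimately show ?thesis
    using that by (simp add: hyp_quot_def A_def a_def b_def)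
qed

lemma arsinh_le_path_length:
  fixes \<gamma> :: "real \<Rightarrow> 'a::euclidean_space"
  assumes vp: "valid_path \<gamma>" and im: "path_image \<gamma> \<subseteq> ball 0 1"
    and int: "((\<lambda>t. 2 * norm (vector_derivative \<gamma> (at t within {0..1})) / (1 - (norm (\<gamma> t))\<^sup>2))
        has_integral l) {0..1}"
  shows "2 * arsinh (sqrt (hyp_quot (\<gamma> 0) (\<gamma> 1))) \<le> l"
proof -
  obtain S where S: "finite S" "\<gamma> C1_differentiable_on {0..1} - S" and cont: "continuous_on {0..1} \<gamma>"
    using vp by (auto simp: valid_path_def piecewise_C1_differentiable_on_def)
  have n1: "norm (\<gamma> t) < 1" if "t \<in> {0..1}" for t
    using im that unfolding path_image_def by (metis image_subset_iff mem_ball_0)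
  define Q where "Q t = hyp_quot (\<gamma> 0) (\<gamma> t)" for t
  define G where "G t = 2 * norm (vector_derivative \<gamma> (at t within {0..1})) / depth (\<gamma> t)" for t
  have Q0: "0 \<le> Q t" if "t \<in> {0..1}" for t
    unfolding Q_def using n1 that by (intro hyp_quot_nonneg) auto
  have G0: "0 \<le> G t" if "t \<in> {0..1}" for t
    unfolding G_def using n1[OF that] by (simp add: less_imp_le)
  have contQ: "continuous_on {0..1} Q"
    unfolding Q_def hyp_quot_def
  proof (intro continuous_intros cont ballI)
    show "continuous_on {0..1} (\<lambda>t. depth (\<gamma> t))"
      unfolding depth_def by (intro continuous_intros cont)
    show "depth (\<gamma> 0) * depth (\<gamma> t) \<noteq> 0" if "t \<in> {0..1}" for t
      using depth_pos[OF n1[OF that]] depth_pos[OF n1[of 0]] by simp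
  qed
  \<comment> \<open>The shift \<open>e\<close> avoids the point where the path is at its start:
    there \<open>Q\<close> vanishes and \<open>sqrt\<close> is not differentiable. It tends to 0 at
    the end.\<close>
  have main: "2 * arsinh (sqrt (Q 1 + e)) - 2 * arsinh (sqrt e) \<le> l" if e: "0 < e" for e
  proof -
    define u where "u t = 2 * arsinh (sqrt (Q t + e))" for t
    have "\<exists>d. (u has_vector_derivative d) (at t) \<and> d \<le> G t" if t: "t \<in> {0<..<1} - S" for t
    proof -
      have "\<gamma> differentiable at t"
        using S(2) t by (auto simp: C1_differentiable_on_eq)
      then have der: "(\<gamma> has_vector_derivative vector_derivative \<gamma> (at t)) (at t)"
        by (simp add: vector_derivative_works)
      have same: "vector_derivative \<gamma> (at t within {0..1}) = vector_derivative \<gamma> (at t)"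
        using t by (intro vector_derivative_at_within_ivl[OF der]) auto
      obtain D where D: "(Q has_real_derivative D) (at t)"
        "\<bar>D\<bar> \<le> G t * sqrt (Q t * (Q t + 1))"
        unfolding Q_def G_def same
        using hyp_quot_has_derivative[OF n1[of 0] n1[of t] der] t by auto
      have q: "0 \<le> Q t" using Q0 t by auto
      have "(u has_real_derivative 2 * (D / (2 * sqrt (Q t + e)) / sqrt ((sqrt (Q t + e))\<^sup>2 + 1))) (at t)"
      proof -
        have "((\<lambda>t. Q t + e) has_real_derivative D) (at t)"
          using DERIV_add[OF D(1) DERIV_const] by simp
        then have "((\<lambda>t. sqrt (Q t + e)) has_real_derivative inverse (sqrt (Q t + e)) / 2 * D) (at t)"
          using q e by (intro DERIV_chain2[where f=sqrt and g="\<lambda>t. Q t + e", OF DERIV_real_sqrt]) auto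
        from DERIV_cmult[OF DERIV_chain2[where f=arsinh and g="\<lambda>t. sqrt (Q t + e)",
              OF arsinh_real_has_field_derivative this], of 2]
        show ?thesis
          unfolding u_def by (simp add: field_simps)
      qed
      moreover have "2 * (D / (2 * sqrt (Q t + e)) / sqrt ((sqrt (Q t + e))\<^sup>2 + 1)) \<le> G t"
      proof -
        have s: "sqrt (Q t * (Q t + 1)) \<le> sqrt (Q t + e) * sqrt (Q t + e + 1)"
          unfolding real_sqrt_mult[symmetric] using q e
          by (intro real_sqrt_le_mono mult_mono) auto
        have "D \<le> G t * (sqrt (Q t + e) * sqrt (Q t + e + 1))"
          using D(2) mult_left_mono[OF s G0[of t]] t by auto
        then have "D / (sqrt (Q t + e) * sqrt (Q t + e + 1)) \<le> G t"
          using q e by (simp add: divide_le_eq)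
        then show ?thesis using q e by (simp add: field_simps)
      qed
      ultimately show ?thesis
        by (auto simp: has_real_derivative_iff_has_vector_derivative)
    qed
    then obtain d where d: "\<And>t. t \<in> {0<..<1} - S \<Longrightarrow> (u has_vector_derivative d t) (at t) \<and> d t \<le> G t"
      by metis
    \<comment> \<open>The value 0 at the exceptional points, where \<open>u\<close> may have no
      derivative, is harmless because \<open>G\<close> is nonnegative.\<close>
    define d' where "d' t = (if t \<in> {0<..<1} - S then d t else 0)" for t
    have "(d' has_integral (u 1 - u 0)) {0..1}"
    proof (rule fundamental_theorem_of_calculus_interior_strong[OF S(1)])
      show "(u has_vector_derivative d' t) (at t)" if "t \<in> {0<..<1} - S" for t
        using d[OF that] that by (simp add: d'_def)
      show "continuous_on {0..1} u"
        unfolding u_def by (intro continuous_intros contQ)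
    qed simp
    moreover have "(G has_integral l) {0..1}"
      using int unfolding G_def depth_def .
    moreover have "d' t \<le> G t" if "t \<in> {0..1}" for t
      using d G0[OF that] by (simp add: d'_def)
    ultimately have "u 1 - u 0 \<le> l"
      by (rule has_integral_le)
    then show ?thesis by (simp add: u_def Q_def hyp_quot_def)
  qed
  have "((\<lambda>e. 2 * arsinh (sqrt (Q 1 + e)) - 2 * arsinh (sqrt e)) \<longlongrightarrow>
      2 * arsinh (sqrt (Q 1 + 0)) - 2 * arsinh (sqrt 0)) (at_right 0)"
    by (intro tendsto_intros isCont_tendsto_compose[OF isCont_arsinh])
  moreover have "eventually (\<lambda>e. 2 * arsinh (sqrt (Q 1 + e)) - 2 * arsinh (sqrt e) \<le> l) (at_right 0)"
    using main by (simp add: eventually_at_right_less eventually_mono[OF eventually_at_right_less])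
  ultimately have "2 * arsinh (sqrt (Q 1 + 0)) - 2 * arsinh (sqrt 0) \<le> l"
    by (rule tendsto_upperbound) simp
  then show ?thesis by (simp add: Q_def)
qed

section \<open>Geodesics: radial segments and their images under inversions\<close>

lemma artanh_eq_arsinh:
  assumes "0 \<le> r" "r < (1::real)"
  shows "artanh r = arsinh (sqrt (r\<^sup>2 / (1 - r\<^sup>2)))"
proof -
  have p: "0 < 1 - r\<^sup>2" using assms by (simp add: power_less_one_iff abs_square_less_1)
  have f: "1 - r\<^sup>2 = (1 + r) * (1 - r)" by (simp add: algebra_simps power2_eq_square)
  have "(sqrt (r\<^sup>2 / (1 - r\<^sup>2)))\<^sup>2 + 1 = 1 / (1 - r\<^sup>2)"
    using p by (simp add: field_simps)
  then have "arsinh (sqrt (r\<^sup>2 / (1 - r\<^sup>2))) = ln ((1 + r) / sqrt (1 - r\<^sup>2))"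
    using assms p unfolding arsinh_real_def
    by (simp add: real_sqrt_divide add_divide_distrib add.commute)
  also have "\<dots> = ln (1 + r) - ln (1 - r\<^sup>2) / 2"
    using assms p by (simp add: ln_div ln_sqrt)
  also have "\<dots> = artanh r"
  proof -
    have "ln ((1 + r) * (1 - r)) = ln (1 + r) + ln (1 - r)" "ln ((1 + r) / (1 - r)) = ln (1 + r) - ln (1 - r)"
      using assms by (simp_all add: ln_mult ln_div)
    then show ?thesis unfolding f artanh_def by (simp add: field_simps)
  qed
  finally show ?thesis by simp
qed

lemma has_integral_radial_length:
  assumes "0 \<le> r" "r < (1::real)"
  shows "((\<lambda>t. 2 * r / (1 - (t * r)\<^sup>2)) has_integral 2 * arsinh (sqrt (r\<^sup>2 / (1 - r\<^sup>2)))) {0..1}"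
proof -
  have b: "\<bar>t * r\<bar> < 1" if "t \<in> {0..1}" for t
  proof -
    have "t * r \<le> 1 * r" using that assms by (intro mult_right_mono) auto
    then show ?thesis using that assms by simp
  qed
  have "((\<lambda>t. 2 * r / (1 - (t * r)\<^sup>2)) has_integral (2 * artanh (1 * r) - 2 * artanh (0 * r))) {0..1}"
  proof (rule fundamental_theorem_of_calculus)
    fix t :: real assume t: "t \<in> {0..1}"
    have "((\<lambda>t. 2 * artanh (t * r)) has_real_derivative 2 * r / (1 - (t * r)\<^sup>2)) (at t within {0..1})"
    proof -
      have "((\<lambda>t. t * r) has_real_derivative r) (at t within {0..1})"
        by (auto intro!: derivative_eq_intros)
      then have "((\<lambda>t. artanh (t * r)) has_real_derivative 1 / (1 - (t * r)\<^sup>2) * r) (at t within {0..1})"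
        by (rule DERIV_chain2[where f=artanh and g="\<lambda>t. t * r",
              OF artanh_real_has_field_derivative[OF b[OF t]]])
      from DERIV_cmult[OF this, of 2] show ?thesis by simp
    qed
    then show "((\<lambda>t. 2 * artanh (t * r)) has_vector_derivative 2 * r / (1 - (t * r)\<^sup>2)) (at t within {0..1})"
      by (simp add: has_real_derivative_iff_has_vector_derivative)
  qed simp
  then show ?thesis using artanh_eq_arsinh[OF assms] by simp
qed

text \<open>Inversion in the sphere around \<open>c\<close> that is orthogonal to the unit sphere.\<close>

definition inversion :: "'a::real_inner \<Rightarrow> 'a \<Rightarrow> 'a" where
  "inversion c x = c + (((norm c)\<^sup>2 - 1) / (norm (x - c))\<^sup>2) *\<^sub>R (x - c)"

lemma inversion_diff:
  assumes "x \<noteq> c" "y \<noteq> c"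
  shows "(norm (inversion c x - inversion c y))\<^sup>2
    = ((norm c)\<^sup>2 - 1)\<^sup>2 * (norm (x - y))\<^sup>2 / ((norm (x - c))\<^sup>2 * (norm (y - c))\<^sup>2)"
proof -
  define u v where "u = x - c" and "v = y - c"
  define k where "k = (norm c)\<^sup>2 - 1"
  have uv: "u \<bullet> u \<noteq> 0" "v \<bullet> v \<noteq> 0" using assms by (auto simp: u_def v_def)
  have "(norm (inversion c x - inversion c y))\<^sup>2
      = (norm ((k / (u \<bullet> u)) *\<^sub>R u - (k / (v \<bullet> v)) *\<^sub>R v))\<^sup>2"
    by (simp add: inversion_def u_def v_def k_def power2_norm_eq_inner)
  also have "\<dots> = k\<^sup>2 * ((u - v) \<bullet> (u - v)) / ((u \<bullet> u) * (v \<bullet> v))"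
    unfolding power2_norm_eq_inner inner_diff_left inner_diff_right inner_scaleR_left inner_scaleR_right
    using uv by (simp add: field_simps power2_eq_square inner_commute)
  finally show ?thesis by (simp add: u_def v_def k_def power2_norm_eq_inner)
qed

lemma depth_inversion:
  assumes "x \<noteq> c"
  shows "depth (inversion c x) = ((norm c)\<^sup>2 - 1) * depth x / (norm (x - c))\<^sup>2"
proof -
  define u where "u = x - c"
  have u: "u \<bullet> u \<noteq> 0" using assms by (auto simp: u_def)
  have x: "x = u + c" by (simp add: u_def)
  define k where "k = c \<bullet> c - 1"
  have e: "(c + (k / (u \<bullet> u)) *\<^sub>R u) \<bullet> (c + (k / (u \<bullet> u)) *\<^sub>R u)
      = c \<bullet> c + 2 * k * (u \<bullet> c) / (u \<bullet> u) + k\<^sup>2 / (u \<bullet> u)"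
    unfolding inner_add_left inner_add_right inner_scaleR_left inner_scaleR_right
    using u by (simp add: field_simps power2_eq_square inner_commute)
  have "depth (inversion c x) = 1 - (c \<bullet> c + 2 * k * (u \<bullet> c) / (u \<bullet> u) + k\<^sup>2 / (u \<bullet> u))"
    unfolding depth_def inversion_def power2_norm_eq_inner using e by (simp add: u_def k_def)
  also have "\<dots> = k * (1 - (u + c) \<bullet> (u + c)) / (u \<bullet> u)"
    unfolding inner_add_left inner_add_right
    using u by (simp add: field_simps power2_eq_square inner_commute k_def)
  finally show ?thesis by (simp add: depth_def power2_norm_eq_inner k_def u_def)
qed

lemma inversion_inversion:
  assumes "x \<noteq> c" "1 < norm c"
  shows "inversion c (inversion c x) = x"
proof -
  define u where "u = x - c"
  have u: "u \<bullet> u \<noteq> 0" using assms by (auto simp: u_def)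
  define k where "k = c \<bullet> c - 1"
  have k: "k \<noteq> 0" using assms(2) by (simp add: k_def dot_square_norm abs_square_eq_1)
  show ?thesis
    unfolding inversion_def power2_norm_eq_inner u_def[symmetric] k_def[symmetric]
    using u k by (simp add: u_def)
qed

lemma hyp_quot_inversion:
  assumes "1 < norm c" "norm x < 1" "norm y < 1"
  shows "hyp_quot (inversion c x) (inversion c y) = hyp_quot x y"
proof -
  have n: "x \<noteq> c" "y \<noteq> c" using assms by auto
  define k where "k = (norm c)\<^sup>2 - 1"
  have k: "k \<noteq> 0" using assms(1) by (simp add: k_def abs_square_eq_1)
  have "norm (x - c) \<noteq> 0" "norm (y - c) \<noteq> 0" using n by auto
  then show ?thesis
    unfolding hyp_quot_def inversion_diff[OF n] depth_inversion[OF n(1)] depth_inversion[OF n(2)]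
      k_def[symmetric]
    using k depth_pos[OF assms(2)] depth_pos[OF assms(3)] by (simp add: power2_eq_square)
qed

lemma norm_inversion_less_1:
  assumes "1 < norm c" "norm x < 1"
  shows "norm (inversion c x) < 1"
proof -
  have "x \<noteq> c" using assms by auto
  moreover have "0 < (norm c)\<^sup>2 - 1" using assms(1) by (simp add: one_less_power)
  ultimately have "0 < depth (inversion c x)" using assms by (simp add: depth_inversion)
  then show ?thesis by (simp add: depth_def abs_square_less_1)
qed

lemma inversion_has_vector_derivative:
  fixes v c :: "'a::real_inner"
  assumes "t *\<^sub>R v \<noteq> c"
  defines "p \<equiv> t *\<^sub>R v - c"
  shows "((\<lambda>t. inversion c (t *\<^sub>R v)) has_vector_derivative
    (((norm c)\<^sup>2 - 1) / (p \<bullet> p)) *\<^sub>R (v - (2 * (p \<bullet> v) / (p \<bullet> p)) *\<^sub>R p)) (at t)"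
proof -
  define k where "k = (norm c)\<^sup>2 - 1"
  have p: "p \<bullet> p \<noteq> 0" using assms by simp
  have 1: "((\<lambda>t. t *\<^sub>R v - c) has_vector_derivative v) (at t)"
    by (auto intro!: derivative_eq_intros)
  have "((\<lambda>t. (t *\<^sub>R v - c) \<bullet> (t *\<^sub>R v - c)) has_real_derivative 2 * (p \<bullet> v)) (at t)"
    unfolding has_field_derivative_def p_def
    by (rule derivative_eq_intros refl)+ (auto simp: fun_eq_iff inner_simps inner_commute algebra_simps)
  then have 2: "((\<lambda>t. k / ((t *\<^sub>R v - c) \<bullet> (t *\<^sub>R v - c))) has_real_derivative
      - (k * (2 * (p \<bullet> v))) / ((p \<bullet> p) * (p \<bullet> p))) (at t)"
    using DERIV_divide[OF DERIV_const[of k], of "\<lambda>t. (t *\<^sub>R v - c) \<bullet> (t *\<^sub>R v - c)" _ t] p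
    by (simp add: p_def)
  have "((\<lambda>t. c + (k / ((t *\<^sub>R v - c) \<bullet> (t *\<^sub>R v - c))) *\<^sub>R (t *\<^sub>R v - c)) has_vector_derivative
      0 + ((k / (p \<bullet> p)) *\<^sub>R v + (- (k * (2 * (p \<bullet> v))) / ((p \<bullet> p) * (p \<bullet> p))) *\<^sub>R p)) (at t)"
    unfolding p_def
    by (rule has_vector_derivative_add has_vector_derivative_const has_vector_derivative_scaleR
        2[unfolded p_def] 1)+
  moreover have "0 + ((k / (p \<bullet> p)) *\<^sub>R v + (- (k * (2 * (p \<bullet> v))) / ((p \<bullet> p) * (p \<bullet> p))) *\<^sub>R p)
      = (k / (p \<bullet> p)) *\<^sub>R (v - (2 * (p \<bullet> v) / (p \<bullet> p)) *\<^sub>R p)"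
    by (simp add: algebra_simps)
  ultimately show ?thesis
    by (simp add: inversion_def k_def power2_norm_eq_inner)
qed

text \<open>A radial segment can be integrated explicitly. For general \<open>x\<close> an inversion
  that exchanges \<open>x\<close> and 0 carries the radial segment from 0 to the image of
  \<open>y\<close> onto a path from \<open>x\<close> to \<open>y\<close>; the inversion preserves
  both the length integrand and \<open>hyp_quot\<close>.\<close>

lemma exists_path_of_length:
  fixes x y :: "'a::euclidean_space"
  assumes x: "norm x < 1" and y: "norm y < 1"
  shows "\<exists>\<gamma>. valid_path \<gamma> \<and> path_image \<gamma> \<subseteq> ball 0 1 \<and> pathstart \<gamma> = x \<and> pathfinish \<gamma> = y \<and>
     ((\<lambda>t. 2 * norm (vector_derivative \<gamma> (at t within {0..1})) / (1 - (norm (\<gamma> t))\<^sup>2))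
        has_integral 2 * arsinh (sqrt (hyp_quot x y))) {0..1}"
proof -
  have len: "((\<lambda>t. 2 * norm v / (1 - (t * norm v)\<^sup>2)) has_integral 2 * arsinh (sqrt (hyp_quot 0 v))) {0..1}"
    if "norm v < 1" for v :: 'a
    using has_integral_radial_length[OF norm_ge_zero that] by (simp add: hyp_quot_0 depth_def)
  have seg: "norm (t *\<^sub>R v) < 1" if "norm v < 1" "t \<in> {0..1}" for t :: real and v :: 'a
    using that mult_left_le_one_le[of "norm v" "\<bar>t\<bar>"] by simp
  show ?thesis
  proof (cases "x = 0")
    case True
    have der: "((\<lambda>t. t *\<^sub>R y) has_vector_derivative y) (at t)" for t :: real
      by (auto intro!: derivative_eq_intros)
    have "vector_derivative (\<lambda>t. t *\<^sub>R y) (at t within {0..1}) = y" if "t \<in> {0..1}" for t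
      using that by (intro vector_derivative_at_within_ivl[OF der]) auto
    then have "((\<lambda>t. 2 * norm (vector_derivative (\<lambda>t. t *\<^sub>R y) (at t within {0..1})) / (1 - (norm (t *\<^sub>R y))\<^sup>2))
        has_integral 2 * arsinh (sqrt (hyp_quot x y))) {0..1}"
      using len[OF y] True by (subst has_integral_cong[where g="\<lambda>t. 2 * norm y / (1 - (t * norm y)\<^sup>2)"])
         (auto simp: power_mult_distrib)
    moreover have "valid_path (\<lambda>t. t *\<^sub>R y)"
      unfolding valid_path_def
      by (intro C1_differentiable_imp_piecewise)
         (use der in \<open>auto simp: C1_differentiable_on_def intro!: exI[of _ "\<lambda>_. y"]\<close>)
    ultimately show ?thesis
      using True seg[OF y] by (intro exI[of _ "\<lambda>t. t *\<^sub>R y"])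
        (auto simp: path_image_def pathstart_def pathfinish_def)
  next
    case False
    \<comment> \<open>The reflection of \<open>x\<close> in the unit sphere; the inversion centred
      there exchanges \<open>x\<close> and 0.\<close>
    define c where "c = (1 / (norm x)\<^sup>2) *\<^sub>R x"
    have nc: "norm c = 1 / norm x"
      using False by (simp add: c_def power2_eq_square)
    have c1: "1 < norm c" unfolding nc using x False by (simp add: field_simps)
    define k where "k = (norm c)\<^sup>2 - 1"
    have k: "0 < k" using c1 by (simp add: k_def one_less_power)
    have xc: "x \<noteq> c" using x c1 by auto
    have ix: "inversion c x = 0"
    proof -
      have "x - c = - k *\<^sub>R x"
        unfolding k_def nc by (simp add: c_def algebra_simps power_one_over)
      then have "inversion c x = c + (k / (norm (- k *\<^sub>R x))\<^sup>2) *\<^sub>R (- k *\<^sub>R x)"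
        by (simp only: inversion_def k_def)
      then have "inversion c x = c - (1 / (norm x)\<^sup>2) *\<^sub>R x"
        using k False by (simp add: power2_eq_square)
      then show ?thesis by (simp add: c_def)
    qed
    define v where "v = inversion c y"
    have v: "norm v < 1" unfolding v_def using norm_inversion_less_1[OF c1 y] .
    define \<gamma> where "\<gamma> t = inversion c (t *\<^sub>R v)" for t
    have ne: "t *\<^sub>R v \<noteq> c" if "t \<in> {0..1}" for t
      using seg[OF v that] c1 by auto
    define d where "d t = (k / ((t *\<^sub>R v - c) \<bullet> (t *\<^sub>R v - c))) *\<^sub>R
      (v - (2 * ((t *\<^sub>R v - c) \<bullet> v) / ((t *\<^sub>R v - c) \<bullet> (t *\<^sub>R v - c))) *\<^sub>R (t *\<^sub>R v - c))" for t
    have der: "(\<gamma> has_vector_derivative d t) (at t)" if "t \<in> {0..1}" for t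
      unfolding \<gamma>_def d_def k_def using inversion_has_vector_derivative[OF ne[OF that]] .
    have "continuous_on {0..1} d"
      unfolding d_def using ne by (intro continuous_intros) auto
    then have "\<gamma> C1_differentiable_on {0..1}"
      unfolding C1_differentiable_on_def using der by blast
    then have vp: "valid_path \<gamma>"
      unfolding valid_path_def by (rule C1_differentiable_imp_piecewise)
    have nd: "norm (d t) = k * norm v / (norm (t *\<^sub>R v - c))\<^sup>2" if t: "t \<in> {0..1}" for t
    proof -
      define p where "p = t *\<^sub>R v - c"
      have p: "p \<bullet> p \<noteq> 0" using ne[OF t] by (simp add: p_def)
      have "(norm (v - (2 * (p \<bullet> v) / (p \<bullet> p)) *\<^sub>R p))\<^sup>2 = (norm v)\<^sup>2"
        unfolding power2_norm_eq_inner inner_diff_left inner_diff_right inner_scaleR_left inner_scaleR_right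
        using p by (simp add: field_simps power2_eq_square inner_commute)
      then have "norm (v - (2 * (p \<bullet> v) / (p \<bullet> p)) *\<^sub>R p) = norm v" by simp
      then show ?thesis
        unfolding d_def p_def[symmetric] using k by (simp add: power2_norm_eq_inner)
    qed
    have "vector_derivative \<gamma> (at t within {0..1}) = d t" if "t \<in> {0..1}" for t
      using that by (intro vector_derivative_at_within_ivl[OF der]) auto
    then have "2 * norm (vector_derivative \<gamma> (at t within {0..1})) / (1 - (norm (\<gamma> t))\<^sup>2)
        = 2 * norm v / (1 - (t * norm v)\<^sup>2)" if t: "t \<in> {0..1}" for t
    proof -
      have "1 - (norm (\<gamma> t))\<^sup>2 = k * (1 - (norm (t *\<^sub>R v))\<^sup>2) / (norm (t *\<^sub>R v - c))\<^sup>2"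
        using depth_inversion[OF ne[OF t]] by (simp add: depth_def \<gamma>_def k_def)
      then show ?thesis
        using that \<open>\<And>t. t \<in> {0..1} \<Longrightarrow> vector_derivative \<gamma> (at t within {0..1}) = d t\<close>[OF t] nd[OF t] ne[OF t] k
        by (simp add: power_mult_distrib)
    qed
    moreover have "hyp_quot 0 v = hyp_quot x y"
      using hyp_quot_inversion[OF c1 x y] by (simp add: ix v_def)
    ultimately have "((\<lambda>t. 2 * norm (vector_derivative \<gamma> (at t within {0..1})) / (1 - (norm (\<gamma> t))\<^sup>2))
        has_integral 2 * arsinh (sqrt (hyp_quot x y))) {0..1}"
      using len[OF v] by (subst has_integral_cong[where g="\<lambda>t. 2 * norm v / (1 - (t * norm v)\<^sup>2)"]) auto
    moreover have "\<gamma> 0 = x"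
      using inversion_inversion[OF xc c1] by (simp add: \<gamma>_def ix)
    moreover have "\<gamma> 1 = y"
    proof -
      have "y \<noteq> c" using y c1 by auto
      then show ?thesis using inversion_inversion[of y c] c1 by (simp add: \<gamma>_def v_def)
    qed
    moreover have "path_image \<gamma> \<subseteq> ball 0 1"
      unfolding path_image_def \<gamma>_def using norm_inversion_less_1[OF c1 seg[OF v]] by auto
    ultimately show ?thesis
      using vp by (intro exI[of _ \<gamma>]) (simp add: pathstart_def pathfinish_def)
  qed
qed

section \<open>The distance formula and comparison estimates\<close>

lemma hyp_dist_eq:
  assumes "norm x < 1" "norm y < 1"
  shows "hyp_dist x y = 2 * arsinh (sqrt (hyp_quot x y))"
  unfolding hyp_dist_def
proof (rule cInf_eq_minimum)
  show "2 * arsinh (sqrt (hyp_quot x y)) \<in> {l. \<exists>\<gamma>. valid_path \<gamma> \<and> path_image \<gamma> \<subseteq> Disc \<and>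
     pathstart \<gamma> = x \<and> pathfinish \<gamma> = y \<and>
     ((\<lambda>t. 2 * norm (vector_derivative \<gamma> (at t within {0..1})) / (1 - (norm (\<gamma> t))\<^sup>2))
        has_integral l) {0..1}}"
    using exists_path_of_length[OF assms] by simp
qed (auto simp: pathstart_def pathfinish_def dest: arsinh_le_path_length)

lemma hyp_dist_nonneg:
  assumes "norm x < 1" "norm y < 1"
  shows "0 \<le> hyp_dist x y"
  using hyp_quot_nonneg[OF assms] arsinh_less_iff_real[of "sqrt (hyp_quot x y)" 0]
  by (simp add: hyp_dist_eq[OF assms] not_less[symmetric])

lemma exp_minus_hyp_dist_0:
  assumes "norm x < 1"
  shows "exp (- hyp_dist 0 x) = (1 - norm x) / (1 + norm x)"
proof -
  have "hyp_dist 0 x = 2 * artanh (norm x)"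
    using artanh_eq_arsinh[OF norm_ge_zero assms] hyp_dist_eq[of 0 x] assms
    by (simp add: hyp_quot_0 depth_def)
  also have "\<dots> = - ln ((1 - norm x) / (1 + norm x))"
    using assms norm_ge_zero[of x] unfolding artanh_def by (simp add: ln_div del: norm_ge_zero)
  finally show ?thesis
    using assms norm_ge_zero[of x] by (simp add: add_pos_nonneg)
qed

text \<open>\<open>exp (- hyp_dist 0 x)\<close> equals
  \<open>depth x / (1 + norm x)\<^sup>2\<close>, whose denominator lies between 1 and 4.\<close>

lemma exp_minus_hyp_dist_0_bounds:
  assumes "norm x < 1"
  shows "depth x / 4 \<le> exp (- hyp_dist 0 x)" "exp (- hyp_dist 0 x) \<le> depth x"
proof -
  have e: "exp (- hyp_dist 0 x) = depth x / (1 + norm x)\<^sup>2"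
  proof -
    have "depth x = (1 - norm x) * (1 + norm x)" by (simp add: depth_def algebra_simps power2_eq_square)
    moreover have "a / p = a * p / p\<^sup>2" if "0 < p" for a p :: real
      using that by (simp add: power2_eq_square)
    ultimately show ?thesis
      unfolding exp_minus_hyp_dist_0[OF assms]
      using add_pos_nonneg[OF zero_less_one norm_ge_zero[of x]] by metis
  qed
  have b: "1 \<le> (1 + norm x)\<^sup>2" "(1 + norm x)\<^sup>2 \<le> 2\<^sup>2"
    using assms power_mono[of "1 + norm x" 2 2] by (auto intro!: one_le_power)
  have d: "0 < depth x" using assms by simp
  show "depth x / 4 \<le> exp (- hyp_dist 0 x)"
    unfolding e
  proof (rule frac_le)
    show "0 < (1 + norm x)\<^sup>2" using b(1) by linarith
  qed (use b d in auto)
  show "exp (- hyp_dist 0 x) \<le> depth x"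
    unfolding e using b(1) d mult_left_mono[OF b(1), of "depth x"] by (simp add: divide_le_eq)
qed

lemma con_plus_hyp_quot:
  assumes "f \<in> con_plus" "norm x < 1" "norm y < 1"
  shows "norm (f x) < 1" "hyp_quot (f x) (f y) = hyp_quot x y"
proof -
  have f: "norm (f z) < 1" if "norm z < 1" for z
    using assms(1) that Bij_imp_funcset[of f Disc] by (fastforce simp: con_plus_def)
  show "norm (f x) < 1" using f assms(2) .
  have "hyp_dist (f x) (f y) = hyp_dist x y"
    using assms by (simp add: con_plus_def)
  then have "arsinh (sqrt (hyp_quot (f x) (f y))) = arsinh (sqrt (hyp_quot x y))"
    using assms f by (simp add: hyp_dist_eq)
  then show "hyp_quot (f x) (f y) = hyp_quot x y"
    by (metis sinh_arsinh_real real_sqrt_eq_iff)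
qed

lemma hyp_quot_comparison:
  assumes xy: "norm x < 1" "norm y < 1" and q: "hyp_quot x y \<le> Q"
  shows "depth x \<le> (2 + 4 * Q) * depth y" "norm (x - y) \<le> (2 + 4 * Q) * depth y"
proof -
  have Q: "0 \<le> Q" using hyp_quot_nonneg[OF xy] q by linarith
  define a b where "a = depth x" and "b = depth y"
  have pos: "0 < a" "0 < b" using xy by (auto simp: a_def b_def)
  have "(norm (x - y))\<^sup>2 \<le> Q * a * b"
    unfolding norm_diff_sq_eq[OF xy] a_def[symmetric] b_def[symmetric]
    using q pos by (intro mult_right_mono) auto
  \<comment> \<open>The arithmetic-geometric mean inequality, weighted so that \<open>a\<close>
    enters with the factor 1/4: after doubling, the term \<open>a / 2\<close> can be absorbed on the
    left.\<close>
  also have "\<dots> \<le> (a / 4 + Q * b)\<^sup>2"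
    using zero_le_power2[of "a / 4 - Q * b"] by (simp add: power2_eq_square algebra_simps)
  finally have n: "norm (x - y) \<le> a / 4 + Q * b"
    using pos Q by (simp add: power2_le_iff_abs_le)
  have "a - b = (norm y - norm x) * (norm y + norm x)"
    by (simp add: a_def b_def depth_def algebra_simps power2_eq_square)
  also have "\<dots> \<le> norm (x - y) * 2"
    using xy norm_triangle_ineq3[of y x] by (intro mult_mono) (auto simp: norm_minus_commute)
  finally have "a - b \<le> norm (x - y) * 2" .
  moreover have "norm (x - y) * 2 \<le> a / 2 + 2 * (Q * b)" using n by simp
  ultimately have "a \<le> b + (a / 2 + 2 * (Q * b))" by linarith
  then have ab: "a \<le> (2 + 4 * Q) * b" by (simp add: algebra_simps)
  then show "depth x \<le> (2 + 4 * Q) * depth y" by (simp add: a_def b_def)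
  have "norm (x - y) \<le> (2 + 4 * Q) * b / 4 + Q * b"
    using n divide_right_mono[OF ab, of 4] by linarith
  also have "\<dots> \<le> (2 + 4 * Q) * b" using Q pos by (simp add: algebra_simps)
  finally show "norm (x - y) \<le> (2 + 4 * Q) * depth y" by (simp add: b_def)
qed

lemma hyp_bounded_imp_norm_le:
  assumes "hyp_bounded C" "C \<subseteq> Disc"
  obtains r where "0 < r" "r < 1" "\<And>x. x \<in> C \<Longrightarrow> norm x \<le> r"
proof (cases "C = {}")
  case True
  then show ?thesis using that[of "1/2"] by simp
next
  case False
  then obtain c where c: "c \<in> C" by blast
  obtain R where R: "\<And>x. x \<in> C \<Longrightarrow> hyp_dist c x \<le> R"
    using assms(1) c unfolding hyp_bounded_def by blast
  have n: "norm x < 1" if "x \<in> C" for x using assms(2) that by auto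
  \<comment> \<open>By the distance formula a distance of at most \<open>R\<close> from
    \<open>c\<close> bounds \<open>hyp_quot\<close> by this value, and comparison with the one point
    \<open>c\<close> then bounds the depth from below.\<close>
  define Q where "Q = (sinh (R / 2))\<^sup>2"
  have q: "hyp_quot c x \<le> Q" if x: "x \<in> C" for x
  proof -
    have "arsinh (sqrt (hyp_quot c x)) \<le> R / 2"
      using R[OF x] hyp_dist_eq[OF n[OF c] n[OF x]] by simp
    then have "sqrt (hyp_quot c x) \<le> sinh (R / 2)"
      by (metis sinh_arsinh_real sinh_real_le_iff)
    then have "(sqrt (hyp_quot c x))\<^sup>2 \<le> Q"
      unfolding Q_def using hyp_quot_nonneg[OF n[OF c] n[OF x]] by (intro power_mono) auto
    then show ?thesis using hyp_quot_nonneg[OF n[OF c] n[OF x]] by simp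
  qed
  define e where "e = depth c / (2 + 4 * Q)"
  have Q: "0 \<le> Q" by (simp add: Q_def)
  have e: "0 < e" "e \<le> 1/2"
    using Q n[OF c] depth_le_1[of c] by (auto simp: e_def field_simps add_pos_nonneg)
  have "(norm x)\<^sup>2 \<le> 1 - e" if x: "x \<in> C" for x
    using hyp_quot_comparison(1)[OF n[OF c] n[OF x] q[OF x]] Q
    by (simp add: e_def depth_def field_simps)
  then have "norm x \<le> sqrt (1 - e)" if "x \<in> C" for x
    using that by (metis real_le_rsqrt)
  then show ?thesis using that[of "sqrt (1 - e)"] e by auto
qed

section \<open>Discreteness\<close>

locale kleinian_group =
  fixes \<Gamma> :: "(real ^ 'n \<Rightarrow> real ^ 'n) set"
  assumes kleinian: "kleinian \<Gamma>"
begin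

lemma in_Bij: "g \<in> \<Gamma> \<Longrightarrow> g \<in> Bij Disc"
  using kleinian by (auto simp: kleinian_def con_plus_def)

lemma norm_image_less_1: "g \<in> \<Gamma> \<Longrightarrow> norm x < 1 \<Longrightarrow> norm (g x) < 1"
  using kleinian con_plus_hyp_quot(1)[of g x x] by (auto simp: kleinian_def)

lemma hyp_quot_image:
  "g \<in> \<Gamma> \<Longrightarrow> norm x < 1 \<Longrightarrow> norm y < 1 \<Longrightarrow> hyp_quot (g x) (g y) = hyp_quot x y"
  using kleinian con_plus_hyp_quot(2)[of g x y] by (auto simp: kleinian_def)

lemma depth_image_pos [simp]: "g \<in> \<Gamma> \<Longrightarrow> norm x < 1 \<Longrightarrow> 0 < depth (g x)"
  using norm_image_less_1 depth_pos by blast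

lemma eq_if_agree:
  assumes "g \<in> \<Gamma>" "h \<in> \<Gamma>" "\<And>x. norm x < 1 \<Longrightarrow> g x = h x"
  shows "g = h"
proof (rule extensionalityI[of g Disc h])
  show "g \<in> extensional Disc" "h \<in> extensional Disc"
    using in_Bij assms(1,2) by (auto simp: Bij_def)
qed (use assms(3) in auto)

lemma exists_identity:
  obtains e where "e \<in> \<Gamma>" "\<And>x. norm x < 1 \<Longrightarrow> e x = x"
proof -
  have "\<one>\<^bsub>BijGroup Disc\<^esub> \<in> \<Gamma>"
    using kleinian by (auto simp: kleinian_def intro: subgroup.one_closed)
  then show ?thesis using that[of "\<lambda>x\<in>Disc. x"] by (simp add: BijGroup_def)
qed

lemma exists_comp:
  assumes "g \<in> \<Gamma>" "h \<in> \<Gamma>"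
  obtains k where "k \<in> \<Gamma>" "\<And>x. norm x < 1 \<Longrightarrow> k x = g (h x)"
proof -
  have "g \<otimes>\<^bsub>BijGroup Disc\<^esub> h \<in> \<Gamma>"
    using kleinian assms by (auto simp: kleinian_def intro: subgroup.m_closed)
  then have "compose Disc g h \<in> \<Gamma>"
    using in_Bij assms by (simp add: BijGroup_def)
  then show ?thesis using that[of "compose Disc g h"] by (simp add: compose_def)
qed

lemma exists_inverse:
  assumes "g \<in> \<Gamma>"
  obtains k where "k \<in> \<Gamma>" "\<And>x. norm x < 1 \<Longrightarrow> k (g x) = x" "\<And>x. norm x < 1 \<Longrightarrow> g (k x) = x"
proof -
  have "inv\<^bsub>BijGroup Disc\<^esub> g \<in> \<Gamma>"
    using kleinian assms by (auto simp: kleinian_def intro: subgroup.m_inv_closed)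
  then have "restrict (inv_into Disc g) Disc \<in> \<Gamma>"
    using in_Bij assms by (simp add: inv_BijGroup)
  moreover have bij: "bij_betw g Disc Disc"
    using in_Bij[OF assms] by (simp add: Bij_def)
  then have "restrict (inv_into Disc g) Disc (g x) = x" if "norm x < 1" for x
    using norm_image_less_1[OF assms that] that by (simp add: bij_betw_inv_into_left)
  moreover have "g (restrict (inv_into Disc g) Disc x) = x" if "norm x < 1" for x
    using that by (simp add: bij_betw_inv_into_right[OF bij])
  ultimately show ?thesis using that by blast
qed

text \<open>A subbasic set restricts a map only on a compact subset of the ball, which lies in some
  \<open>cball 0 R\<close> with \<open>R < 1\<close> and has positive distance to the complement of
  \<open>U\<close>. So it contains a uniform neighbourhood of the identity; intersections take the
  larger radius and the smaller tolerance.\<close>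

lemma generate_topology_on_neighbourhood:
  assumes "generate_topology_on {{f. f ` K \<subseteq> U} | K U. compact K \<and> K \<subseteq> Disc \<and> open U} T"
    and "i \<in> T" and i: "\<And>x. norm x < 1 \<Longrightarrow> i x = x"
  shows "\<exists>R e. 0 < R \<and> R < 1 \<and> 0 < e \<and> (\<forall>f. (\<forall>x. norm x \<le> R \<longrightarrow> norm (f x - x) < e) \<longrightarrow> f \<in> T)"
  using assms(1,2)
proof induction
  case (Int a b)
  from Int obtain R e where A: "0 < R" "R < 1" "0 < e"
    "\<And>f. (\<forall>x. norm x \<le> R \<longrightarrow> norm (f x - x) < e) \<Longrightarrow> f \<in> a" by blast
  from Int obtain R' e' where B: "0 < R'" "R' < 1" "0 < e'"
    "\<And>f. (\<forall>x. norm x \<le> R' \<longrightarrow> norm (f x - x) < e') \<Longrightarrow> f \<in> b" by blast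
  show ?case
    using A B by (intro exI[of _ "max R R'"] exI[of _ "min e e'"]) auto
next
  case (UN K)
  then obtain k where "k \<in> K" "i \<in> k" by blast
  then show ?case using UN by (meson UnionI)
next
  case (Basis s)
  then obtain K U where s: "s = {f. f ` K \<subseteq> U}" and K: "compact K" "K \<subseteq> Disc" and U: "open U" by blast
  have KU: "K \<subseteq> U"
  proof
    fix x assume x: "x \<in> K"
    then have "i x = x" using K(2) i by auto
    then show "x \<in> U" using Basis(2) x unfolding s by force
  qed
  obtain e where e: "0 < e" "(\<Union>x\<in>K. ball x e) \<subseteq> U"
    using compact_subset_open_imp_ball_epsilon_subset[OF K(1) U KU] by blast
  have "\<exists>R. 0 < R \<and> R < 1 \<and> (\<forall>x\<in>K. norm x \<le> R)"
  proof (cases "K = {}")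
    case True
    then show ?thesis by (intro exI[of _ "1/2"]) auto
  next
    case False
    then obtain z where z: "z \<in> K" "\<forall>x\<in>K. norm x \<le> norm z"
      using continuous_attains_sup[OF K(1) False continuous_on_norm_id] by blast
    then have "norm z < 1" using K(2) by auto
    then show ?thesis using z by (intro exI[of _ "max (norm z) (1/2)"]) auto
  qed
  then obtain R where R: "0 < R" "R < 1" "\<And>x. x \<in> K \<Longrightarrow> norm x \<le> R" by blast
  have "f \<in> s" if f: "\<forall>x. norm x \<le> R \<longrightarrow> norm (f x - x) < e" for f
  proof -
    have "f x \<in> U" if "x \<in> K" for x
    proof -
      have "f x \<in> ball x e" using f R(3)[OF that] by (simp add: dist_norm norm_minus_commute)
      then show ?thesis using e(2) that by blast
    qed
    then show ?thesis unfolding s by blast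
  qed
  then show ?case using R(1,2) e(1) by blast
qed simp

lemma identity_isolated:
  obtains R e where "0 < R" "R < 1" "0 < e"
    "\<And>h x. h \<in> \<Gamma> \<Longrightarrow> (\<And>y. norm y \<le> R \<Longrightarrow> norm (h y - y) < e) \<Longrightarrow> norm x < 1 \<Longrightarrow> h x = x"
proof -
  obtain i where i: "i \<in> \<Gamma>" "\<And>x. norm x < 1 \<Longrightarrow> i x = x"
    using exists_identity by metis
  have "openin (subtopology compact_open \<Gamma>) {i}"
    using kleinian i(1) by (simp add: kleinian_def)
  then obtain T where T: "openin compact_open T" "{i} = T \<inter> \<Gamma>"
    by (auto simp: openin_subtopology)
  have "generate_topology_on {{f. f ` K \<subseteq> U} | K U. compact K \<and> K \<subseteq> Disc \<and> open U} T"
    using T(1) unfolding compact_open_def by (rule openin_topology_generated_by)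
  then obtain R e where Re: "0 < R" "R < 1" "0 < e"
    "\<And>f. (\<forall>x. norm x \<le> R \<longrightarrow> norm (f x - x) < e) \<Longrightarrow> f \<in> T"
    using generate_topology_on_neighbourhood[of T i] T(2) i(2) by blast
  show ?thesis
  proof (rule that[OF Re(1-3)])
    fix h x assume "h \<in> \<Gamma>" "\<And>y. norm y \<le> R \<Longrightarrow> norm (h y - y) < e" and x: "norm (x :: real ^ 'n) < 1"
    then have "h = i" using Re(4) T(2) by blast
    then show "h x = x" using i(2) x by simp
  qed
qed

text \<open>An Arzela--Ascoli type pigeonhole: elements that agree up to \<open>\<delta>\<close> on a finite net
  differ by an element close to the identity.\<close>

lemma finite_depth_ge:
  assumes eta: "0 < \<eta>"
  shows "finite {g \<in> \<Gamma>. \<eta> \<le> depth (g 0)}"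
proof -
  obtain R e where R: "0 < R" "R < 1" and e: "0 < e"
    and iso: "\<And>h x. h \<in> \<Gamma> \<Longrightarrow> (\<And>y. norm y \<le> R \<Longrightarrow> norm (h y - y) < e) \<Longrightarrow> norm x < 1 \<Longrightarrow> h x = x"
    by (rule identity_isolated) blast
  \<comment> \<open>\<open>L\<close> serves twice: as a Lipschitz constant on
    \<open>cball 0 R\<close> for all members of the group, and as a bound for
    \<open>hyp_quot (u 0) (u y)\<close> when \<open>norm y \<le> R\<close>. The second use makes
    \<open>\<beta>\<close> a lower bound for the depth of \<open>u y\<close>.\<close>
  define L where "L = 1 / (1 - R\<^sup>2)"
  have R2: "0 < 1 - R\<^sup>2" using R by (simp add: power_less_one_iff abs_square_less_1)
  then have L: "0 < L" by (simp add: L_def)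
  define \<beta> where "\<beta> = \<eta> / (2 + 4 * L)"
  have b: "0 < \<beta>" using eta L by (simp add: \<beta>_def)
  \<comment> \<open>If \<open>g\<close> and \<open>h\<close> share all cells, they differ by at most
    \<open>(2 * L + 1) * \<delta>\<close> on \<open>cball 0 R\<close>. Pulling back by
    \<open>g\<close> costs a factor \<open>1 / \<beta>\<close>, which leaves a displacement of at
    most \<open>e / 2\<close>.\<close>
  define \<delta> where "\<delta> = e * \<beta> / (2 * (2 * L + 1))"
  have d: "0 < \<delta>" using e b L by (simp add: \<delta>_def)
  have depR: "1 - R\<^sup>2 \<le> depth x" if "norm x \<le> R" for x :: "real ^ 'n"
    using that R by (simp add: depth_def power_mono)
  have lip: "norm (g x - g y) \<le> L * norm (x - y)"
    if "g \<in> \<Gamma>" "norm x \<le> R" "norm y \<le> R" for g x y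
  proof -
    have n: "norm x < 1" "norm y < 1" using that R by auto
    have "(norm (g x - g y))\<^sup>2 = hyp_quot x y * (depth (g x) * depth (g y))"
      using norm_diff_sq_eq[of "g x" "g y"] norm_image_less_1 hyp_quot_image that n by (simp add: mult.assoc)
    also have "\<dots> \<le> hyp_quot x y * 1"
      using hyp_quot_nonneg[OF n] that(1) n
      by (intro mult_left_mono mult_le_one depth_le_1) (auto intro: less_imp_le)
    also have "\<dots> \<le> (norm (x - y))\<^sup>2 / ((1 - R\<^sup>2) * (1 - R\<^sup>2))"
      unfolding hyp_quot_def using depR[OF that(2)] depR[OF that(3)] R2
      by (auto intro!: divide_left_mono mult_mono mult_pos_pos)
    also have "\<dots> = (L * norm (x - y))\<^sup>2"
      by (simp add: L_def power2_eq_square)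
    finally show ?thesis
      using L by (simp add: power2_le_iff_abs_le)
  qed
  have "seq_compact (cball 0 R :: (real ^ 'n) set)" by (simp add: seq_compact_eq_compact)
  then have "\<exists>X. finite X \<and> X \<subseteq> cball 0 R \<and> (cball 0 R :: (real ^ 'n) set) \<subseteq> (\<Union>x\<in>X. ball x \<delta>)"
    using seq_compact_imp_totally_bounded d by blast
  then obtain X :: "(real ^ 'n) set" where
    X: "finite X" "X \<subseteq> cball 0 R" "cball 0 R \<subseteq> (\<Union>x\<in>X. ball x \<delta>)"
    by (elim exE conjE)
  obtain \<U> where U: "scale_cover \<delta> (ball 0 1 :: (real ^ 'n) set) \<U>"
    using exists_scale_cover[OF bounded_ball d] by blast
  define Z where "Z = {g \<in> \<Gamma>. \<eta> \<le> depth (g 0)}"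
  define cell where "cell g = (\<lambda>x\<in>X. SOME U. U \<in> \<U> \<and> g x \<in> U)" for g :: "real ^ 'n \<Rightarrow> real ^ 'n"
  have cell: "cell g x \<in> \<U> \<and> g x \<in> cell g x" if "g \<in> \<Gamma>" "x \<in> X" for g x
  proof -
    have "norm x < 1" using X(2) R that(2) by auto
    then have "g x \<in> ball 0 1" using norm_image_less_1 that(1) by simp
    then have "\<exists>U. U \<in> \<U> \<and> g x \<in> U" using U unfolding scale_cover_def by blast
    from someI_ex[OF this] show ?thesis using that(2) by (simp add: cell_def)
  qed
  have "inj_on cell Z"
  proof (rule inj_onI)
    fix g h assume gh: "g \<in> Z" "h \<in> Z" and eq: "cell g = cell h"
    then have G: "g \<in> \<Gamma>" "h \<in> \<Gamma>" "\<eta> \<le> depth (g 0)" "\<eta> \<le> depth (h 0)" by (auto simp: Z_def)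
    obtain k where k: "k \<in> \<Gamma>" "\<And>x. norm x < 1 \<Longrightarrow> k (g x) = x" "\<And>x. norm x < 1 \<Longrightarrow> g (k x) = x"
      using exists_inverse[OF G(1)] by blast
    obtain f where f: "f \<in> \<Gamma>" "\<And>x. norm x < 1 \<Longrightarrow> f x = k (h x)"
      using exists_comp[OF k(1) G(2)] by blast
    have dep: "\<beta> \<le> depth (u y)" if u: "u \<in> \<Gamma>" "\<eta> \<le> depth (u 0)" and y: "norm y \<le> R" for u y
    proof -
      have y1: "norm y < 1" using y R by simp
      have "hyp_quot (u 0) (u y) = (norm y)\<^sup>2 / depth y"
        using hyp_quot_image[OF u(1) _ y1, of 0] by (simp add: hyp_quot_0)
      also have "\<dots> \<le> 1 / (1 - R\<^sup>2)"
        using y1 depR[OF y] R2 depth_pos[OF y1] power_le_one[of "norm y" 2]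
        by (intro frac_le) auto
      finally have "depth (u 0) \<le> (2 + 4 * L) * depth (u y)"
        using hyp_quot_comparison(1)[of "u 0" "u y" L] norm_image_less_1[OF u(1)] y1 by (simp add: L_def)
      then have "\<eta> \<le> (2 + 4 * L) * depth (u y)" using u(2) by simp
      then show ?thesis unfolding \<beta>_def using L by (simp add: divide_le_eq mult.commute)
    qed
    have "norm (f y - y) < e" if y: "norm y \<le> R" for y
    proof -
      have y1: "norm y < 1" using y R by simp
      obtain x where x: "x \<in> X" "dist x y < \<delta>" using X(3) y by force
      have xR: "norm x \<le> R" using X(2) x(1) by auto
      have "norm (g x - h x) \<le> \<delta>"
        using scale_coverD[OF U, of "cell g x" "g x" "h x"] cell[OF G(1) x(1)] cell[OF G(2) x(1)] eq
        by (simp add: dist_norm)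
      moreover have "L * norm (x - y) \<le> L * \<delta>"
        using mult_left_mono[OF less_imp_le[OF x(2)], of L] L by (simp add: dist_norm)
      then have "norm (g y - g x) \<le> L * \<delta>" "norm (h x - h y) \<le> L * \<delta>"
        using lip[OF G(1) y xR] lip[OF G(2) xR y] unfolding norm_minus_commute[of y x] by linarith+
      moreover have "norm (g y - h y) \<le> norm (g y - g x) + norm (g x - h x) + norm (h x - h y)"
        by (rule order_trans[OF _ add_right_mono[OF norm_triangle_ineq]])
           (rule order_trans[OF _ norm_triangle_ineq], simp)
      ultimately have gh': "norm (g y - h y) \<le> (2 * L + 1) * \<delta>" by (simp add: algebra_simps)
      have n: "norm (g y) < 1" "norm (h y) < 1" "norm (f y) < 1"
        using norm_image_less_1[OF _ y1] G(1,2) f(1) by auto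
      have "g (f y) = h y" using f(2)[OF y1] k(3)[OF n(2)] by simp
      then have q: "hyp_quot (f y) y = hyp_quot (h y) (g y)"
        using hyp_quot_image[OF G(1) n(3) y1] by simp
      have "(norm (f y - y))\<^sup>2 = hyp_quot (f y) y * (depth (f y) * depth y)"
        using norm_diff_sq_eq[OF n(3) y1] by (simp add: mult.assoc)
      also have "\<dots> \<le> hyp_quot (f y) y * 1"
        using hyp_quot_nonneg[OF n(3) y1] f(1) y1
        by (intro mult_left_mono mult_le_one depth_le_1) (auto intro: less_imp_le)
      also have "\<dots> = (norm (g y - h y))\<^sup>2 / (depth (h y) * depth (g y))"
        unfolding q by (simp add: hyp_quot_def norm_minus_commute)
      also have "\<dots> \<le> ((2 * L + 1) * \<delta>)\<^sup>2 / (\<beta> * \<beta>)"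
        using gh' dep[OF G(1,3) y] dep[OF G(2,4) y] b
        by (intro frac_le power_mono mult_mono) auto
      also have "\<dots> = (e / 2)\<^sup>2"
      proof -
        define m where "m = 2 * L + 1"
        have "m \<noteq> 0" using L by (simp add: m_def)
        then have "m * \<delta> = e / 2 * \<beta>" unfolding \<delta>_def m_def[symmetric] by simp
        moreover have "(e / 2 * \<beta>)\<^sup>2 / (\<beta> * \<beta>) = (e / 2)\<^sup>2" using b by (simp add: power2_eq_square)
        ultimately show ?thesis by (simp only: m_def)
      qed
      finally have "norm (f y - y) \<le> e / 2" using e by (simp add: power2_le_iff_abs_le)
      then show ?thesis using e by simp
    qed
    then have id: "f x = x" if "norm x < 1" for x using iso[OF f(1)] that by blast
    show "g = h"
    proof (rule eq_if_agree[OF G(1,2)])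
      fix x :: "real ^ 'n" assume x: "norm x < 1"
      then have "k (h x) = x" using id f(2) by simp
      then show "g x = h x" using k(3)[OF norm_image_less_1[OF G(2) x]] by simp
    qed
  qed
  moreover have "cell ` Z \<subseteq> PiE X (\<lambda>_. \<U>)"
    using cell by (auto simp: Z_def cell_def)
  moreover have "finite (PiE X (\<lambda>_. \<U>))"
    using X(1) U by (intro finite_PiE) (auto simp: scale_cover_def)
  ultimately have "finite Z" using inj_on_finite by blast
  then show ?thesis by (simp add: Z_def)
qed

end

section \<open>Orbits and limit sets\<close>

lemma sum_le_geometric:
  fixes w :: "'a \<Rightarrow> real" and f :: "'a \<Rightarrow> nat"
  assumes F: "finite F" and B: "0 \<le> B" and q: "0 \<le> q" "q < 1"
    and le: "\<And>k. sum w {z \<in> F. f z = k} \<le> B * q ^ k"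
  shows "sum w F \<le> B / (1 - q)"
proof -
  have "sum w F = (\<Sum>k\<in>f ` F. sum w {z \<in> F. f z = k})"
    using sum.image_gen[OF F] by blast
  also have "\<dots> \<le> (\<Sum>k\<in>f ` F. B * q ^ k)"
    by (intro sum_mono le)
  also have "\<dots> \<le> (\<Sum>k. B * q ^ k)"
    using F B q by (intro sum_le_suminf summable_mult summable_geometric) auto
  also have "\<dots> = B / (1 - q)"
    using q by (simp add: suminf_mult summable_geometric suminf_geometric)
  finally show ?thesis .
qed

lemma exists_dyadic_shell:
  assumes "0 < d" "d \<le> (1::real)"
  shows "\<exists>k. (1/2) ^ Suc k < d \<and> d \<le> (1/2) ^ k"
proof -
  define k where "k = (LEAST k. (1/2) ^ k < d)"
  obtain m where "(1/2) ^ m < d"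
    using real_arch_pow_inv[OF assms(1), of "1/2"] by auto
  then have k: "(1/2) ^ k < d" unfolding k_def by (rule LeastI)
  then have "k \<noteq> 0" using assms(2) by (auto intro: ccontr)
  then obtain j where j: "k = Suc j" by (cases k) auto
  have "\<not> (1/2) ^ j < d" using not_less_Least[of j "\<lambda>k. (1/2) ^ k < d"] j by (simp add: k_def)
  then show ?thesis using k j by (intro exI[of _ j]) auto
qed

lemma depth_le_dist_sphere:
  assumes "norm \<xi> = 1" "norm z < 1"
  shows "depth z \<le> 2 * norm (z - \<xi>)"
proof -
  have "depth z = (1 + norm z) * (1 - norm z)" by (simp add: depth_def algebra_simps power2_eq_square)
  also have "\<dots> \<le> 2 * (1 - norm z)" using assms by (intro mult_right_mono) auto
  also have "1 - norm z \<le> norm (z - \<xi>)"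
    using norm_triangle_ineq2[of \<xi> z] assms by (simp add: norm_minus_commute)
  finally show ?thesis by simp
qed

context kleinian_group
begin

lemma norm_orbit_less_1 [simp]: "g \<in> \<Gamma> \<Longrightarrow> norm (g 0) < 1"
  by (simp add: norm_image_less_1)

lemma comparison:
  assumes r: "r < 1"
  obtains K where "1 \<le> K"
    "\<And>g x. g \<in> \<Gamma> \<Longrightarrow> norm x \<le> r \<Longrightarrow> depth (g x) \<le> K * depth (g 0)"
    "\<And>g x. g \<in> \<Gamma> \<Longrightarrow> norm x \<le> r \<Longrightarrow> depth (g 0) \<le> K * depth (g x)"
    "\<And>g x. g \<in> \<Gamma> \<Longrightarrow> norm x \<le> r \<Longrightarrow> norm (g x - g 0) \<le> K * depth (g 0)"
    "\<And>g x y. g \<in> \<Gamma> \<Longrightarrow> norm x \<le> r \<Longrightarrow> norm y \<le> r \<Longrightarrow> norm (g x - g y) \<le> K * depth (g 0) * norm (x - y)"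
proof -
  \<comment> \<open>A negative \<open>r\<close> admits no \<open>x\<close>; with \<open>r'\<close>
    squaring is monotone in every case.\<close>
  define r' where "r' = max r 0"
  have r': "0 \<le> r'" "r' < 1" using r by (auto simp: r'_def)
  define L where "L = 1 / (1 - r'\<^sup>2)"
  have R2: "0 < 1 - r'\<^sup>2" using r' by (simp add: power_less_one_iff abs_square_less_1)
  have "1 - r'\<^sup>2 \<le> 1" by simp
  then have L: "1 \<le> L" using R2 by (simp add: L_def)
  have n1: "norm x < 1" if "norm x \<le> r" for x :: "real ^ 'n" using that r by simp
  have dep: "1 - r'\<^sup>2 \<le> depth x" if "norm x \<le> r" for x :: "real ^ 'n"
    using that r' by (simp add: depth_def r'_def power_mono)
  define K0 where "K0 = 2 + 4 * L"
  have q: "hyp_quot (g x) (g 0) \<le> L" if "g \<in> \<Gamma>" "norm x \<le> r" for g x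
  proof -
    have "hyp_quot (g x) (g 0) = (norm x)\<^sup>2 / depth x"
      using hyp_quot_image[OF that(1) n1[OF that(2)], of 0] by (simp add: hyp_quot_0 hyp_quot_commute[of x])
    also have "\<dots> \<le> 1 / (1 - r'\<^sup>2)"
      using n1[OF that(2)] dep[OF that(2)] R2 power_le_one[of "norm x" 2]
      by (intro frac_le) auto
    finally show ?thesis by (simp add: L_def)
  qed
  have c: "depth (g x) \<le> K0 * depth (g 0)" "norm (g x - g 0) \<le> K0 * depth (g 0)"
    "depth (g 0) \<le> K0 * depth (g x)" if "g \<in> \<Gamma>" "norm x \<le> r" for g x
    using hyp_quot_comparison[OF _ _ q[OF that]] hyp_quot_comparison(1)[of "g 0" "g x" L] q[OF that]
      norm_image_less_1[OF that(1)] n1[OF that(2)] that(1)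
    by (auto simp: K0_def hyp_quot_commute[of "g 0"])
  define K where "K = K0 * L"
  have K0: "1 \<le> K0" using L by (simp add: K0_def)
  have "K0 \<le> K" using mult_left_mono[OF L, of K0] K0 by (simp add: K_def)
  then have K: "K0 \<le> K" "1 \<le> K" using K0 by auto
  have up: "K0 * t \<le> K * t" if "0 \<le> t" for t using K that by (intro mult_right_mono)
  show ?thesis
  proof (rule that[OF K(2)])
    fix g x assume gx: "g \<in> \<Gamma>" "norm (x :: real ^ 'n) \<le> r"
    have p: "0 \<le> depth (g 0)" "0 \<le> depth (g x)" using gx n1 by (auto intro!: less_imp_le)
    show "depth (g x) \<le> K * depth (g 0)" "depth (g 0) \<le> K * depth (g x)"
      "norm (g x - g 0) \<le> K * depth (g 0)"
      using c[OF gx] up[OF p(1)] up[OF p(2)] by linarith+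
    fix y :: "real ^ 'n" assume y: "norm y \<le> r"
    have n: "norm (g x) < 1" "norm (g y) < 1" using gx y n1 norm_image_less_1 by auto
    have p': "0 \<le> depth (g y)" using n by (simp add: less_imp_le)
    have "(norm (g x - g y))\<^sup>2 = hyp_quot x y * (depth (g x) * depth (g y))"
      using norm_diff_sq_eq[OF n] hyp_quot_image gx y n1 by (simp add: mult.assoc)
    also have "\<dots> \<le> (norm (x - y))\<^sup>2 / ((1 - r'\<^sup>2) * (1 - r'\<^sup>2)) * ((K0 * depth (g 0)) * (K0 * depth (g 0)))"
    proof (rule mult_mono)
      show "hyp_quot x y \<le> (norm (x - y))\<^sup>2 / ((1 - r'\<^sup>2) * (1 - r'\<^sup>2))"
        unfolding hyp_quot_def using dep[OF gx(2)] dep[OF y] R2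
        by (intro divide_left_mono mult_mono) (auto intro!: mult_pos_pos)
      show "depth (g x) * depth (g y) \<le> (K0 * depth (g 0)) * (K0 * depth (g 0))"
        using c(1)[OF gx] c(1)[OF gx(1) y] p p' K0 by (intro mult_mono) auto
      show "0 \<le> (norm (x - y))\<^sup>2 / ((1 - r'\<^sup>2) * (1 - r'\<^sup>2))" using R2 by simp
      show "0 \<le> depth (g x) * depth (g y)" using p p' by simp
    qed
    also have "\<dots> = (K * depth (g 0) * norm (x - y))\<^sup>2"
      by (simp add: K_def L_def power2_eq_square)
    finally show "norm (g x - g y) \<le> K * depth (g 0) * norm (x - y)"
      using p K by (simp add: power2_le_iff_abs_le abs_mult)
  qed
qed

lemma finite_hyp_quot_le:
  assumes c: "norm c < 1"
  shows "finite {h \<in> \<Gamma>. hyp_quot c (h c) \<le> Q}"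
proof -
  obtain K where K: "1 \<le> K" "\<And>g x. g \<in> \<Gamma> \<Longrightarrow> norm x \<le> norm c \<Longrightarrow> depth (g x) \<le> K * depth (g 0)"
    by (rule comparison[OF c]) blast
  define Q' where "Q' = max Q 0"
  have pos: "0 < (2 + 4 * Q') * K" using K(1) by (simp add: Q'_def add_pos_nonneg)
  have "depth c / ((2 + 4 * Q') * K) \<le> depth (h 0)" if h: "h \<in> \<Gamma>" "hyp_quot c (h c) \<le> Q" for h
  proof -
    have "depth c \<le> (2 + 4 * Q') * depth (h c)"
      using hyp_quot_comparison(1)[OF c norm_image_less_1[OF h(1) c], of Q'] h(2) by (simp add: Q'_def)
    also have "\<dots> \<le> (2 + 4 * Q') * (K * depth (h 0))"
      using K(2)[OF h(1) order_refl] by (intro mult_left_mono) (auto simp: Q'_def)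
    finally show ?thesis using pos by (simp add: divide_le_eq mult_ac)
  qed
  then have "{h \<in> \<Gamma>. hyp_quot c (h c) \<le> Q} \<subseteq> {h \<in> \<Gamma>. depth c / ((2 + 4 * Q') * K) \<le> depth (h 0)}"
    by blast
  moreover have "0 < depth c / ((2 + 4 * Q') * K)" using c pos by simp
  ultimately show ?thesis using finite_depth_ge finite_subset by blast
qed

text \<open>Left translation by the inverse of \<open>g\<close> injects the set around
  \<open>g c\<close> into the one around \<open>c\<close>, so a single \<open>M\<close> serves all
  \<open>g\<close>. Group elements are counted, not orbit points, so that stabilisers of
  \<open>c\<close> are taken into account.\<close>

lemma card_hyp_quot_le:
  assumes c: "norm c < 1"
  obtains M where "\<And>g. g \<in> \<Gamma> \<Longrightarrow> finite {h \<in> \<Gamma>. hyp_quot (g c) (h c) \<le> Q}"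
    "\<And>g. g \<in> \<Gamma> \<Longrightarrow> card {h \<in> \<Gamma>. hyp_quot (g c) (h c) \<le> Q} \<le> M"
proof -
  define A where "A = {h \<in> \<Gamma>. hyp_quot c (h c) \<le> Q}"
  have A: "finite A" unfolding A_def by (rule finite_hyp_quot_le[OF c])
  have main: "\<exists>\<phi>. inj_on \<phi> {h \<in> \<Gamma>. hyp_quot (g c) (h c) \<le> Q} \<and> \<phi> ` {h \<in> \<Gamma>. hyp_quot (g c) (h c) \<le> Q} \<subseteq> A"
    if g: "g \<in> \<Gamma>" for g
  proof -
    have "\<exists>k\<in>\<Gamma>. \<forall>x. norm x < 1 \<longrightarrow> g (k x) = h x" if h: "h \<in> \<Gamma>" for h
    proof -
      obtain g' where g': "g' \<in> \<Gamma>" "\<And>x. norm x < 1 \<Longrightarrow> g (g' x) = x"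
        using exists_inverse[OF g] by metis
      obtain k where "k \<in> \<Gamma>" "\<And>x. norm x < 1 \<Longrightarrow> k x = g' (h x)"
        using exists_comp[OF g'(1) h] by metis
      then show ?thesis using g' norm_image_less_1[OF h] by (intro bexI[of _ k]) auto
    qed
    then obtain \<phi> where phi: "\<And>h. h \<in> \<Gamma> \<Longrightarrow> \<phi> h \<in> \<Gamma>"
      "\<And>h x. h \<in> \<Gamma> \<Longrightarrow> norm x < 1 \<Longrightarrow> g (\<phi> h x) = h x"
      by metis
    have "inj_on \<phi> {h \<in> \<Gamma>. hyp_quot (g c) (h c) \<le> Q}"
    proof (rule inj_onI)
      fix h h' assume "h \<in> {h \<in> \<Gamma>. hyp_quot (g c) (h c) \<le> Q}" "h' \<in> {h \<in> \<Gamma>. hyp_quot (g c) (h c) \<le> Q}"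
        and eq: "\<phi> h = \<phi> h'"
      then have hh: "h \<in> \<Gamma>" "h' \<in> \<Gamma>" by auto
      show "h = h'"
        by (rule eq_if_agree[OF hh]) (metis phi(2) hh eq)
    qed
    moreover have "\<phi> h \<in> A" if h: "h \<in> \<Gamma>" "hyp_quot (g c) (h c) \<le> Q" for h
      using hyp_quot_image[OF g c norm_image_less_1[OF phi(1)[OF h(1)] c]] phi h c by (simp add: A_def)
    ultimately show ?thesis by blast
  qed
  show ?thesis
  proof (rule that[of "card A"])
    fix g assume "g \<in> \<Gamma>"
    then obtain \<phi> where phi: "inj_on \<phi> {h \<in> \<Gamma>. hyp_quot (g c) (h c) \<le> Q}"
      "\<phi> ` {h \<in> \<Gamma>. hyp_quot (g c) (h c) \<le> Q} \<subseteq> A" using main by blast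
    show "finite {h \<in> \<Gamma>. hyp_quot (g c) (h c) \<le> Q}"
      using inj_on_finite[OF phi A] .
    show "card {h \<in> \<Gamma>. hyp_quot (g c) (h c) \<le> Q} \<le> card A"
      using card_inj_on_le[OF phi A] .
  qed
qed

lemma bounded_orbit_set:
  assumes "C \<subseteq> Disc"
  shows "bounded (orbit_set \<Gamma> C)"
proof (rule bounded_subset[OF bounded_ball])
  show "orbit_set \<Gamma> C \<subseteq> ball 0 1"
    using assms norm_image_less_1 by (fastforce simp: orbit_set_def)
qed

text \<open>Near a point of the open ball there are only finitely many orbit points, so a point of
  the closure there already belongs to the orbit.\<close>

lemma norm_limit_set:
  assumes "\<xi> \<in> limit_set \<Gamma>"
  shows "norm \<xi> = 1"
proof (rule ccontr)
  assume ne: "norm \<xi> \<noteq> 1"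
  have cl: "\<xi> \<in> closure (orbit_set \<Gamma> {0})" and nin: "\<xi> \<notin> orbit_set \<Gamma> {0}"
    using assms by (auto simp: limit_set_def)
  have "orbit_set \<Gamma> {0} \<subseteq> cball 0 1"
    using less_imp_le[OF norm_orbit_less_1] unfolding orbit_set_def by fastforce
  then have "closure (orbit_set \<Gamma> {0}) \<subseteq> cball 0 1" by (simp add: closure_minimal)
  then have "norm \<xi> \<le> 1" using cl by auto
  then have n: "norm \<xi> < 1" using ne by simp
  define e where "e = (1 - norm \<xi>) / 2"
  have e: "0 < e" "norm \<xi> + e < 1" using n by (auto simp: e_def field_simps)
  have e0: "0 \<le> norm \<xi> + e" using e by (simp add: add_nonneg_nonneg)
  define \<eta> where "\<eta> = 1 - (norm \<xi> + e)\<^sup>2"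
  have eta: "0 < \<eta>" using e e0 by (simp add: \<eta>_def abs_square_less_1)
  define S where "S = (\<lambda>g. g 0) ` {g \<in> \<Gamma>. \<eta> \<le> depth (g 0)}"
  have S: "finite S" unfolding S_def using finite_depth_ge[OF eta] by simp
  have sub: "orbit_set \<Gamma> {0} \<inter> ball \<xi> e \<subseteq> S"
  proof
    fix z assume z: "z \<in> orbit_set \<Gamma> {0} \<inter> ball \<xi> e"
    then obtain g where g: "g \<in> \<Gamma>" "z = g 0" by (auto simp: orbit_set_def)
    have "norm z \<le> norm \<xi> + e"
      using z norm_triangle_ineq2[of z \<xi>] by (auto simp: dist_norm norm_minus_commute)
    then have "(norm z)\<^sup>2 \<le> (norm \<xi> + e)\<^sup>2" by (intro power_mono) auto
    then show "z \<in> S" using g by (auto simp: S_def depth_def \<eta>_def)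
  qed
  have "\<xi> \<in> closure (orbit_set \<Gamma> {0} \<inter> ball \<xi> e)"
    using cl open_Int_closure_subset[OF open_ball, of \<xi> e "orbit_set \<Gamma> {0}"] e(1)
    by (auto simp: Int_commute)
  also have "closure (orbit_set \<Gamma> {0} \<inter> ball \<xi> e) = orbit_set \<Gamma> {0} \<inter> ball \<xi> e"
    using finite_subset[OF sub S] by (intro closure_closed finite_imp_closed)
  finally show False using nin by blast
qed

lemma limit_set_iff:
  "\<xi> \<in> limit_set \<Gamma> \<longleftrightarrow> norm \<xi> = 1 \<and> (\<forall>e>0. \<exists>g\<in>\<Gamma>. norm (g 0 - \<xi>) < e)"
proof -
  have "\<xi> \<in> closure (orbit_set \<Gamma> {0}) \<longleftrightarrow> (\<forall>e>0. \<exists>g\<in>\<Gamma>. norm (g 0 - \<xi>) < e)"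
    unfolding closure_approachable orbit_set_def dist_norm by auto
  moreover have "\<xi> \<notin> orbit_set \<Gamma> {0}" if "norm \<xi> = 1"
    using that norm_orbit_less_1 unfolding orbit_set_def by fastforce
  ultimately show ?thesis
    using norm_limit_set by (auto simp: limit_set_def)
qed

text \<open>Compactness of the closed ball yields an accumulation point, and depth tending to 0
  forces it onto the sphere. The set \<open>S\<close> prescribes where the limit point is to be
  found.\<close>

lemma limit_set_meets_closed:
  assumes S: "closed S" and w: "\<And>e. 0 < e \<Longrightarrow> \<exists>g\<in>\<Gamma>. g 0 \<in> S \<and> depth (g 0) < e"
  obtains \<zeta> where "\<zeta> \<in> limit_set \<Gamma>" "\<zeta> \<in> S"
proof -
  have "\<exists>g\<in>\<Gamma>. g 0 \<in> S \<and> depth (g 0) < 1 / real (Suc n)" for n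
    by (rule w) simp
  then obtain g where g: "\<And>n. g n \<in> \<Gamma>" "\<And>n. g n 0 \<in> S" "\<And>n. depth (g n 0) < 1 / real (Suc n)"
    by metis
  have "\<forall>n. g n 0 \<in> cball 0 1" using g(1) by (auto intro: less_imp_le)
  then obtain \<zeta> r where r: "strict_mono r" "((\<lambda>n. g n 0) \<circ> r) \<longlonglongrightarrow> \<zeta>"
    using compact_cball[of "0 :: real ^ 'n" 1] unfolding compact_def by metis
  then have lim: "(\<lambda>n. g (r n) 0) \<longlonglongrightarrow> \<zeta>" by (simp add: o_def)
  have "(\<lambda>n. depth (g (r n) 0)) \<longlonglongrightarrow> depth \<zeta>"
    unfolding depth_def by (intro tendsto_intros lim)
  moreover have "(\<lambda>n. depth (g (r n) 0)) \<longlonglongrightarrow> 0"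
  proof (rule tendsto_sandwich[of "\<lambda>_. 0"])
    show "\<forall>\<^sub>F n in sequentially. 0 \<le> depth (g (r n) 0)"
      using g(1) by (auto intro!: always_eventually less_imp_le)
    show "\<forall>\<^sub>F n in sequentially. depth (g (r n) 0) \<le> 1 / real (Suc n)"
    proof (rule always_eventually, rule allI)
      fix n
      have "depth (g (r n) 0) \<le> 1 / real (Suc (r n))" using g(3) less_imp_le by blast
      also have "\<dots> \<le> 1 / real (Suc n)"
        using strict_mono_imp_increasing[OF r(1), of n] by (intro divide_left_mono) auto
      finally show "depth (g (r n) 0) \<le> 1 / real (Suc n)" .
    qed
    show "(\<lambda>n. 1 / real (Suc n)) \<longlonglongrightarrow> 0" using LIMSEQ_inverse_real_of_nat by (simp add: inverse_eq_divide)
  qed simp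
  ultimately have "depth \<zeta> = 0" using LIMSEQ_unique by blast
  then have "norm \<zeta> = 1" by (simp add: depth_def abs_square_eq_1)
  moreover have "\<exists>h\<in>\<Gamma>. norm (h 0 - \<zeta>) < e" if "0 < e" for e
  proof -
    obtain n where "norm (g (r n) 0 - \<zeta>) < e" using LIMSEQ_D[OF lim \<open>0 < e\<close>] by blast
    then show ?thesis using g(1) by blast
  qed
  ultimately have "\<zeta> \<in> limit_set \<Gamma>" by (simp add: limit_set_iff)
  moreover have "\<zeta> \<in> S"
    using closed_sequentially[OF S _ lim] g(2) by blast
  ultimately show ?thesis by (rule that)
qed

text \<open>\<open>g c\<close> is within \<open>K * depth (g 0)\<close> of \<open>g 0\<close>, and
  the depth is at most twice the distance from \<open>g 0\<close> to \<xi>. So the orbit of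
  \<open>c\<close> follows that of 0 to every limit point.\<close>

lemma limit_set_subset_closure:
  assumes "c \<in> C" "norm c < 1"
  shows "limit_set \<Gamma> \<subseteq> closure (orbit_set \<Gamma> C)"
proof
  fix \<xi> assume xi: "\<xi> \<in> limit_set \<Gamma>"
  obtain K where K: "1 \<le> K" "\<And>g x. g \<in> \<Gamma> \<Longrightarrow> norm x \<le> norm c \<Longrightarrow> norm (g x - g 0) \<le> K * depth (g 0)"
    by (rule comparison[OF assms(2)]) blast
  show "\<xi> \<in> closure (orbit_set \<Gamma> C)"
    unfolding closure_approachable
  proof (intro allI impI)
    fix e :: real assume "0 < e"
    then have "0 < e / (2 * K + 1)" using K(1) by simp
    then obtain g where g: "g \<in> \<Gamma>" "norm (g 0 - \<xi>) < e / (2 * K + 1)"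
      using xi unfolding limit_set_iff by blast
    have "norm (g c - g 0) \<le> K * depth (g 0)" using K(2)[OF g(1)] by simp
    also have "\<dots> \<le> K * (2 * norm (g 0 - \<xi>))"
      using depth_le_dist_sphere[OF norm_limit_set[OF xi], of "g 0"] g(1) K(1) by (intro mult_left_mono) auto
    finally have "norm (g c - \<xi>) \<le> K * (2 * norm (g 0 - \<xi>)) + norm (g 0 - \<xi>)"
      using norm_triangle_ineq[of "g c - g 0" "g 0 - \<xi>"] by simp
    also have "\<dots> = (2 * K + 1) * norm (g 0 - \<xi>)" by (simp add: algebra_simps)
    also have "\<dots> < e" using g(2) K(1) by (simp add: field_simps)
    finally show "\<exists>y\<in>orbit_set \<Gamma> C. dist y \<xi> < e"
      using g(1) assms(1) by (auto simp: orbit_set_def dist_norm)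
  qed
qed

section \<open>The Poincare series, and its exponent as a lower bound for the dimension\<close>

lemma hyp_dist_orbit_nonneg: "g \<in> \<Gamma> \<Longrightarrow> 0 \<le> hyp_dist 0 (g 0)"
  by (simp add: hyp_dist_nonneg)

text \<open>Trades the extended nonnegative series for bounded finite partial sums of reals, the
  form in which convergence is used throughout.\<close>

lemma poincare_series_finite_iff:
  "poincare_series \<Gamma> s < \<infinity> \<longleftrightarrow>
    (\<exists>B. \<forall>F. finite F \<longrightarrow> F \<subseteq> \<Gamma> \<longrightarrow> (\<Sum>g\<in>F. exp (- s * hyp_dist 0 (g 0))) \<le> B)"
proof -
  have eq: "poincare_series \<Gamma> s = (SUP F\<in>{F. finite F \<and> F \<subseteq> \<Gamma>}. ennreal (\<Sum>g\<in>F. exp (- s * hyp_dist 0 (g 0))))"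
    unfolding poincare_series_def by (subst nonneg_infsum_complete) (auto simp: sum_ennreal)
  show ?thesis
  proof
    assume fin: "poincare_series \<Gamma> s < \<infinity>"
    have "(\<Sum>g\<in>F. exp (- s * hyp_dist 0 (g 0))) \<le> enn2real (poincare_series \<Gamma> s)"
      if "finite F" "F \<subseteq> \<Gamma>" for F
    proof -
      have "ennreal (\<Sum>g\<in>F. exp (- s * hyp_dist 0 (g 0))) \<le> poincare_series \<Gamma> s"
        unfolding eq using that by (intro SUP_upper) auto
      then have "enn2real (ennreal (\<Sum>g\<in>F. exp (- s * hyp_dist 0 (g 0)))) \<le> enn2real (poincare_series \<Gamma> s)"
        using fin by (intro enn2real_mono) auto
      then show ?thesis by (simp add: sum_nonneg)
    qed
    then show "\<exists>B. \<forall>F. finite F \<longrightarrow> F \<subseteq> \<Gamma> \<longrightarrow> (\<Sum>g\<in>F. exp (- s * hyp_dist 0 (g 0))) \<le> B" by blast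
  next
    assume "\<exists>B. \<forall>F. finite F \<longrightarrow> F \<subseteq> \<Gamma> \<longrightarrow> (\<Sum>g\<in>F. exp (- s * hyp_dist 0 (g 0))) \<le> B"
    then obtain B where "\<And>F. finite F \<Longrightarrow> F \<subseteq> \<Gamma> \<Longrightarrow> (\<Sum>g\<in>F. exp (- s * hyp_dist 0 (g 0))) \<le> B" by blast
    then have "poincare_series \<Gamma> s \<le> ennreal B"
      unfolding eq by (intro SUP_least ennreal_leI) auto
    then show "poincare_series \<Gamma> s < \<infinity>"
      using ennreal_less_top[of B] unfolding infinity_ennreal_def by (rule le_less_trans)
  qed
qed

lemma exp_hyp_dist_bounds:
  assumes "g \<in> \<Gamma>" "0 \<le> s"
  shows "exp (- s * hyp_dist 0 (g 0)) \<le> depth (g 0) powr s"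
    and "(depth (g 0) / 4) powr s \<le> exp (- s * hyp_dist 0 (g 0))"
proof -
  have e: "exp (- s * hyp_dist 0 (g 0)) = exp (- hyp_dist 0 (g 0)) powr s"
    by (simp add: powr_def)
  have d: "0 < depth (g 0)" using assms(1) by simp
  show "exp (- s * hyp_dist 0 (g 0)) \<le> depth (g 0) powr s"
    unfolding e using exp_minus_hyp_dist_0_bounds[of "g 0"] assms by (intro powr_mono2) auto
  show "(depth (g 0) / 4) powr s \<le> exp (- s * hyp_dist 0 (g 0))"
    unfolding e using exp_minus_hyp_dist_0_bounds[of "g 0"] assms d by (intro powr_mono2) auto
qed

text \<open>Group elements are sorted by dyadic shells of \<open>depth (g 0)\<close>. In the shell
  of depth about \<rho>, a covering set of diameter \<rho> contains only boundedly many points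
  \<open>g c\<close>, so the covering number bounds the shell and the shells sum
  geometrically.\<close>

lemma poincare_exponent_le_upper_box_dim:
  assumes c: "c \<in> C" and C: "C \<subseteq> Disc"
  shows "poincare_exponent \<Gamma> \<le> upper_box_dim (orbit_set \<Gamma> C)"
proof (rule dense_ge)
  fix s' assume s': "upper_box_dim (orbit_set \<Gamma> C) < s'"
  have bnd: "bounded (orbit_set \<Gamma> C)" using bounded_orbit_set C .
  have c1: "norm c < 1" using c C by auto
  show "poincare_exponent \<Gamma> \<le> s'"
  proof (cases s')
    case (real s)
    \<comment> \<open>The gap between \<open>t\<close> and \<open>s\<close> is what produces the
      ratio \<open>2 powr (t - s)\<close> of the geometric series.\<close>
    obtain t where t: "upper_box_dim (orbit_set \<Gamma> C) < ereal t" "ereal t < ereal s"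
      using s' ereal_dense2[of "upper_box_dim (orbit_set \<Gamma> C)" "ereal s"] real by auto
    have "0 \<le> ereal t" using upper_box_dim_nonneg[OF bnd] t(1) by (meson less_imp_le order_trans)
    then have t0: "0 \<le> t" "t < s" using t(2) by auto
    obtain B where B: "0 < B" "\<And>\<rho>. 0 < \<rho> \<Longrightarrow> \<rho> \<le> 1 \<Longrightarrow> real (covering_number \<rho> (orbit_set \<Gamma> C)) \<le> B * \<rho> powr (- t)"
      by (rule covering_number_bound[OF bnd t0(1) t(1)]) blast
    obtain K where K: "1 \<le> K" "\<And>g x. g \<in> \<Gamma> \<Longrightarrow> norm x \<le> norm c \<Longrightarrow> depth (g 0) \<le> K * depth (g x)"
      by (rule comparison[OF c1]) blast
    \<comment> \<open>Two points of depth at least \<open>\<rho> / (2 * K)\<close> at distance at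
      most \<rho> have \<open>hyp_quot\<close> at most \<open>4 * K\<^sup>2\<close>.\<close>
    obtain M where M: "\<And>g. g \<in> \<Gamma> \<Longrightarrow> finite {h \<in> \<Gamma>. hyp_quot (g c) (h c) \<le> 4 * K\<^sup>2}"
      "\<And>g. g \<in> \<Gamma> \<Longrightarrow> card {h \<in> \<Gamma>. hyp_quot (g c) (h c) \<le> 4 * K\<^sup>2} \<le> M"
      by (rule card_hyp_quot_le[OF c1]) blast
    have "\<exists>k. (1/2) ^ Suc k < depth (g 0) \<and> depth (g 0) \<le> (1/2) ^ k" if "g \<in> \<Gamma>" for g
      using exists_dyadic_shell[OF _ depth_le_1, of "g 0"] that by simp
    then obtain f where f: "\<And>g. g \<in> \<Gamma> \<Longrightarrow> (1/2) ^ Suc (f g) < depth (g 0) \<and> depth (g 0) \<le> (1/2) ^ f g"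
      by metis
    define q where "q = (2::real) powr (t - s)"
    have q: "0 \<le> q" "q < 1" using t0 by (auto simp: q_def powr_less_one)
    have half: "((1/2) ^ k) powr a = 2 powr (- a * real k)" for a :: real and k
    proof -
      have "(1/2::real) ^ k = 2 powr (- real k)" by (simp add: powr_minus powr_realpow power_one_over inverse_eq_divide)
      then show ?thesis by (simp add: powr_powr mult.commute)
    qed
    have "(\<Sum>g\<in>F. exp (- s * hyp_dist 0 (g 0))) \<le> (real M * B) / (1 - q)" if F: "finite F" "F \<subseteq> \<Gamma>" for F
    proof (rule sum_le_geometric[OF F(1) _ q, where f = f])
      show "0 \<le> real M * B" using B by simp
      fix k
      define \<rho> where "\<rho> = (1/2::real) ^ k"
      have r: "0 < \<rho>" "\<rho> \<le> 1" by (auto simp: \<rho>_def power_le_one)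
      obtain \<U> where U: "scale_cover \<rho> (orbit_set \<Gamma> C) \<U>" "card \<U> = covering_number \<rho> (orbit_set \<Gamma> C)"
        by (rule covering_number_witness[OF bnd r(1)])
      define Fk where "Fk = {g \<in> F. f g = k}"
      define V where "V U = {g \<in> Fk. g c \<in> U}" for U
      have fin: "finite Fk" "finite \<U>" "finite (V U)" for U
        using F U by (auto simp: Fk_def scale_cover_def V_def)
      have "g \<in> (\<Union>U\<in>\<U>. V U)" if "g \<in> Fk" for g
      proof -
        have "g c \<in> orbit_set \<Gamma> C" using that F c by (auto simp: orbit_set_def Fk_def)
        then show ?thesis using U that by (auto simp: scale_cover_def V_def)
      qed
      then have "card Fk \<le> card (\<Union>U\<in>\<U>. V U)"
        using fin by (intro card_mono) auto
      also have "\<dots> \<le> (\<Sum>U\<in>\<U>. card (V U))" using fin(2) by (rule card_UN_le)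
      also have "\<dots> \<le> (\<Sum>U\<in>\<U>. M)"
      proof (rule sum_mono)
        fix U assume UU: "U \<in> \<U>"
        show "card (V U) \<le> M"
        proof (cases "V U = {}")
          case False
          then obtain g where g: "g \<in> V U" by blast
          then have gG: "g \<in> \<Gamma>" "f g = k" using F by (auto simp: V_def Fk_def)
          have "V U \<subseteq> {h \<in> \<Gamma>. hyp_quot (g c) (h c) \<le> 4 * K\<^sup>2}"
          proof
            fix h assume h: "h \<in> V U"
            then have hG: "h \<in> \<Gamma>" "f h = k" using F by (auto simp: V_def Fk_def)
            have "norm (g c - h c) \<le> \<rho>"
              using scale_coverD[OF U(1) UU, of "g c" "h c"] g h by (simp add: V_def dist_norm)
            moreover have "\<rho> / 2 / K \<le> depth (g c)" "\<rho> / 2 / K \<le> depth (h c)"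
            proof -
              have "\<rho> / 2 < depth (u 0)" if "u \<in> \<Gamma>" "f u = k" for u
                using f[OF that(1)] that(2) by (simp add: \<rho>_def)
              then have "\<rho> / 2 \<le> K * depth (u c)" if "u \<in> \<Gamma>" "f u = k" for u
                using K(2)[OF that(1) order_refl] that by fastforce
              then show "\<rho> / 2 / K \<le> depth (g c)" "\<rho> / 2 / K \<le> depth (h c)"
                using gG hG K(1) by (simp_all add: divide_le_eq mult_ac)
            qed
            ultimately have "hyp_quot (g c) (h c) \<le> \<rho>\<^sup>2 / ((\<rho> / 2 / K) * (\<rho> / 2 / K))"
              unfolding hyp_quot_def using r K(1) c1 gG(1)
              by (intro frac_le power_mono mult_mono) (auto intro!: less_imp_le)
            also have "\<dots> = 4 * K\<^sup>2" using r K(1) by (simp add: field_simps power2_eq_square)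
            finally show "h \<in> {h \<in> \<Gamma>. hyp_quot (g c) (h c) \<le> 4 * K\<^sup>2}" using hG by simp
          qed
          then have "card (V U) \<le> card {h \<in> \<Gamma>. hyp_quot (g c) (h c) \<le> 4 * K\<^sup>2}"
            using M(1)[OF gG(1)] by (intro card_mono)
          then show ?thesis using M(2)[OF gG(1)] by simp
        qed simp
      qed
      also have "\<dots> = card \<U> * M" by simp
      finally have "real (card Fk) \<le> real (card \<U> * M)" by (simp only: of_nat_le_iff)
      also have "\<dots> \<le> B * \<rho> powr (- t) * real M"
        using B(2)[OF r] U(2) by (simp add: mult_right_mono)
      finally have card: "real (card Fk) \<le> B * \<rho> powr (- t) * real M" .
      have "(\<Sum>g\<in>Fk. exp (- s * hyp_dist 0 (g 0))) \<le> (\<Sum>g\<in>Fk. \<rho> powr s)"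
      proof (rule sum_mono)
        fix g assume "g \<in> Fk"
        then have g: "g \<in> \<Gamma>" "f g = k" using F by (auto simp: Fk_def)
        have "exp (- s * hyp_dist 0 (g 0)) \<le> depth (g 0) powr s"
          using exp_hyp_dist_bounds(1)[OF g(1)] t0 by simp
        also have "\<dots> \<le> \<rho> powr s"
          using f[OF g(1)] g t0 depth_image_pos[OF g(1), of 0] by (intro powr_mono2) (auto simp: \<rho>_def)
        finally show "exp (- s * hyp_dist 0 (g 0)) \<le> \<rho> powr s" .
      qed
      also have "\<dots> = real (card Fk) * \<rho> powr s" by simp
      also have "\<dots> \<le> (B * \<rho> powr (- t) * real M) * \<rho> powr s"
        using card by (intro mult_right_mono) auto
      also have "\<dots> = real M * B * (\<rho> powr (s - t))"
        using r by (simp add: powr_diff powr_minus field_simps)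
      also have "\<rho> powr (s - t) = q ^ k"
        unfolding \<rho>_def half q_def by (simp add: powr_powr powr_realpow[symmetric])
      finally show "(\<Sum>g\<in>{z \<in> F. f z = k}. exp (- s * hyp_dist 0 (g 0))) \<le> real M * B * q ^ k"
        by (simp add: Fk_def)
    qed
    then have "poincare_series \<Gamma> s < \<infinity>"
      unfolding poincare_series_finite_iff by blast
    then show ?thesis
      unfolding poincare_exponent_def real using t0 by (intro Inf_lower) auto
  next
    case MInf
    then show ?thesis using s' by simp
  qed simp
qed

end

section \<open>Separated subsets of semigroups\<close>

lemma le_0_of_halves:
  fixes t c :: real
  assumes "\<And>n::nat. \<exists>k\<ge>n. t \<le> c * (1/2) ^ k"
  shows "t \<le> 0"
proof (rule ccontr)
  assume "\<not> t \<le> 0"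
  then have "0 < t / (\<bar>c\<bar> + 1)" by simp
  then obtain n where n: "(1/2) ^ n < t / (\<bar>c\<bar> + 1)"
    using real_arch_pow_inv[of "t / (\<bar>c\<bar> + 1)" "1/2"] by auto
  obtain k where k: "k \<ge> n" "t \<le> c * (1/2) ^ k" using assms by blast
  have "c * (1/2) ^ k \<le> (\<bar>c\<bar> + 1) * (1/2) ^ k" by (intro mult_right_mono) auto
  also have "\<dots> \<le> (\<bar>c\<bar> + 1) * (1/2) ^ n"
    using power_decreasing[OF k(1), of "1/2::real"] by (intro mult_left_mono) auto
  also have "\<dots> < t" using n by (simp add: field_simps)
  finally show False using k(2) by simp
qed

text \<open>The tensor power trick: a constant that does not depend on the exponent disappears when
  roots are taken.\<close>

lemma le_of_power_le:
  fixes a b c :: real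
  assumes "0 < b" "0 \<le> a" "\<And>m. a ^ Suc m \<le> c * b ^ Suc m"
  shows "a \<le> b"
proof (rule ccontr)
  assume "\<not> a \<le> b"
  then have "1 < a / b" using assms(1) by simp
  then obtain m where m: "c < (a / b) ^ m" using real_arch_pow by blast
  have "(a / b) ^ m \<le> (a / b) ^ Suc m" using \<open>1 < a / b\<close> by (intro power_increasing) auto
  also have "\<dots> \<le> c" using assms(3)[of m] assms(1) by (simp add: power_divide divide_le_eq)
  finally show False using m by simp
qed

fun digit_set :: "'a::real_vector set \<Rightarrow> nat \<Rightarrow> nat \<Rightarrow> 'a set" where
  "digit_set T l 0 = T"
| "digit_set T l (Suc k) = (\<lambda>(t, u). t + real l *\<^sub>R u) ` (T \<times> digit_set T l k)"

text \<open>Expansions to base \<open>l\<close> with digits from a separated set \<open>T\<close> are unique and separated, so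
  the growth of the ambient semigroup bounds the number of digits. This yields a bound at every
  pair of scales from the asymptotic growth alone.\<close>

lemma card_separated_in_semigroup:
  fixes T \<Lambda> :: "'a::real_normed_vector set"
  assumes add: "\<And>u v. u \<in> \<Lambda> \<Longrightarrow> v \<in> \<Lambda> \<Longrightarrow> u + v \<in> \<Lambda>"
    and T: "finite T" "T \<subseteq> \<Lambda>" "\<And>t. t \<in> T \<Longrightarrow> norm t \<le> R"
    and sep: "\<And>t t'. t \<in> T \<Longrightarrow> t' \<in> T \<Longrightarrow> t \<noteq> t' \<Longrightarrow> r \<le> norm (t - t')"
    and r: "0 < r" "r \<le> R" "1 \<le> R" and s: "0 \<le> s"
    and count: "\<And>X. 1 \<le> X \<Longrightarrow> finite (\<Lambda> \<inter> cball 0 X) \<and> real (card (\<Lambda> \<inter> cball 0 X)) \<le> C * X powr s"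
  shows "real (card T) \<le> (4 * R / r) powr s"
proof -
  \<comment> \<open>Large enough for \<open>2 * R + r \<le> l * r\<close>, so that a difference of
    lower digits, at most \<open>2 * R\<close>, cannot cancel a separated higher part; small enough
    for \<open>l \<le> 4 * R / r\<close>, the base of the final bound.\<close>
  define l where "l = nat \<lceil>2 * R / r\<rceil> + 1"
  have Rr: "1 \<le> R / r" using r by simp
  have l1: "2 * R / r \<le> real l - 1"
    unfolding l_def using Rr by (simp add: real_nat_ceiling_ge)
  have l2: "real l \<le> 4 * R / r"
  proof -
    have "real (nat \<lceil>2 * R / r\<rceil>) \<le> 2 * R / r + 1"
      using Rr of_int_ceiling_le_add_one[of "2 * R / r"] by simp
    moreover have "4 * R / r = 2 * R / r + 2 * (R / r)" by (simp add: add_divide_distrib[symmetric])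
    moreover have "real l = real (nat \<lceil>2 * R / r\<rceil>) + 1" by (simp add: l_def)
    ultimately show ?thesis using Rr by linarith
  qed
  have l3: "2 \<le> real l" using l1 Rr by simp
  have l4: "2 * R + r \<le> real l * r" using l1 r by (simp add: field_simps)
  have scale: "real (Suc n) *\<^sub>R u \<in> \<Lambda>" if "u \<in> \<Lambda>" for u n
  proof (induction n)
    case (Suc n)
    have "real (Suc (Suc n)) *\<^sub>R u = u + real (Suc n) *\<^sub>R u"
      by (simp only: of_nat_Suc scaleR_add_left scaleR_one)
    then show ?case using add[OF that Suc] by (simp only:)
  qed (use that in simp)
  have lu: "real l *\<^sub>R u \<in> \<Lambda>" if "u \<in> \<Lambda>" for u
    using scale[OF that, of "nat \<lceil>2 * R / r\<rceil>"] by (simp add: l_def)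
  have inj: "inj_on (\<lambda>(t, u). t + real l *\<^sub>R u) (T \<times> U) \<and>
      (\<forall>v\<in>(\<lambda>(t, u). t + real l *\<^sub>R u) ` (T \<times> U). \<forall>v'\<in>(\<lambda>(t, u). t + real l *\<^sub>R u) ` (T \<times> U).
        v \<noteq> v' \<longrightarrow> r \<le> norm (v - v'))"
    if sepU: "\<And>u u'. u \<in> U \<Longrightarrow> u' \<in> U \<Longrightarrow> u \<noteq> u' \<Longrightarrow> r \<le> norm (u - u')" for U
  proof -
    have *: "r \<le> norm ((t + real l *\<^sub>R u) - (t' + real l *\<^sub>R u'))"
      if tu: "t \<in> T" "u \<in> U" "t' \<in> T" "u' \<in> U" "(t, u) \<noteq> (t', u')" for t u t' u'
    proof (cases "u = u'")
      case True
      then show ?thesis using sep tu by auto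
    next
      case False
      then have "real l * r \<le> norm (real l *\<^sub>R (u - u'))"
        using sepU tu(2,4) by (auto intro!: mult_left_mono)
      moreover have "norm (t' - t) \<le> 2 * R"
        using norm_triangle_ineq4[of t' t] T(3)[OF tu(1)] T(3)[OF tu(3)] by linarith
      moreover have "norm (real l *\<^sub>R (u - u')) - norm (t' - t) \<le> norm (real l *\<^sub>R (u - u') - (t' - t))"
        by (rule norm_triangle_ineq2)
      moreover have "real l *\<^sub>R (u - u') - (t' - t) = (t + real l *\<^sub>R u) - (t' + real l *\<^sub>R u')"
        by (simp add: algebra_simps)
      ultimately show ?thesis using l4 by simp
    qed
    show ?thesis
    proof (intro conjI ballI impI)
      show "inj_on (\<lambda>(t, u). t + real l *\<^sub>R u) (T \<times> U)"
      proof (rule inj_onI, clarify)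
        fix t u t' u' assume a: "t \<in> T" "u \<in> U" "t' \<in> T" "u' \<in> U" "t + real l *\<^sub>R u = t' + real l *\<^sub>R u'"
        then show "t = t' \<and> u = u'"
          using *[OF a(1-4)] r(1) by auto
      qed
      fix v v' assume "v \<in> (\<lambda>(t, u). t + real l *\<^sub>R u) ` (T \<times> U)"
        "v' \<in> (\<lambda>(t, u). t + real l *\<^sub>R u) ` (T \<times> U)" and ne: "v \<noteq> v'"
      then obtain t u t' u' where e: "t \<in> T" "u \<in> U" "t' \<in> T" "u' \<in> U"
        "v = t + real l *\<^sub>R u" "v' = t' + real l *\<^sub>R u'" by auto
      then show "r \<le> norm (v - v')" using * ne by auto
    qed
  qed
  \<comment> \<open>Level \<open>k\<close> has \<open>k + 1\<close> digits, hence the exponents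
    \<open>Suc k\<close>. The \<open>- 1\<close> in the norm bound leaves room for the digit added
    at the next level, since \<open>l\<close> is at least 2.\<close>
  have main: "digit_set T l k \<subseteq> \<Lambda> \<and> finite (digit_set T l k) \<and> card (digit_set T l k) = card T ^ Suc k \<and>
      (\<forall>u\<in>digit_set T l k. norm u \<le> R * (real l ^ Suc k - 1)) \<and>
      (\<forall>u\<in>digit_set T l k. \<forall>u'\<in>digit_set T l k. u \<noteq> u' \<longrightarrow> r \<le> norm (u - u'))" for k
  proof (induction k)
    case 0
    have "norm t \<le> R * (real l - 1)" if "t \<in> T" for t
    proof -
      have "R * 1 \<le> R * (real l - 1)" using l3 r by (intro mult_left_mono) auto
      then show ?thesis using T(3)[OF that] by linarith
    qed
    then show ?case using T sep by auto
  next
    case (Suc k)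
    note IH = Suc.IH
    have sub: "digit_set T l (Suc k) \<subseteq> \<Lambda>"
    proof clarify
      fix v assume "v \<in> digit_set T l (Suc k)"
      then obtain t u where tu: "t \<in> T" "u \<in> digit_set T l k" "v = t + real l *\<^sub>R u" by auto
      have "t \<in> \<Lambda>" "u \<in> \<Lambda>" using tu(1,2) T(2) IH by auto
      then show "v \<in> \<Lambda>" unfolding tu(3) by (intro add lu)
    qed
    have fin: "finite (digit_set T l (Suc k))" using IH T(1) by simp
    have card: "card (digit_set T l (Suc k)) = card T ^ Suc (Suc k)"
      using inj[of "digit_set T l k"] IH by (simp add: card_image card_cartesian_product)
    have norm: "norm v \<le> R * (real l ^ Suc (Suc k) - 1)" if v: "v \<in> digit_set T l (Suc k)" for v
    proof -
      obtain t u where tu: "t \<in> T" "u \<in> digit_set T l k" "v = t + real l *\<^sub>R u" using v by auto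
      have "norm v \<le> norm t + real l * norm u"
        unfolding tu(3) using norm_triangle_ineq[of t "real l *\<^sub>R u"] by simp
      also have "\<dots> \<le> R + real l * (R * (real l ^ Suc k - 1))"
        using T(3)[OF tu(1)] IH tu(2) by (intro add_mono mult_left_mono) auto
      also have "\<dots> = R * (real l ^ Suc (Suc k) - (real l - 1))"
        by (simp add: algebra_simps)
      also have "\<dots> \<le> R * (real l ^ Suc (Suc k) - 1)"
        using l3 r by (intro mult_left_mono) auto
      finally show ?thesis .
    qed
    show ?case
      using sub fin card norm inj[of "digit_set T l k"] IH by auto
  qed
  have C: "0 \<le> C" using count[of 1] by (metis mult.right_neutral of_nat_0_le_iff order_refl order_trans powr_one_eq_one)
  have "real (card T) \<le> real l powr s"
  proof (rule le_of_power_le)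
    show "0 < real l powr s" using l3 by simp
    fix m
    define X where "X = R * real l ^ Suc m"
    have X: "1 \<le> X"
      unfolding X_def using r(3) l3 mult_mono[of 1 R 1 "real l ^ Suc m"] one_le_power[of "real l" "Suc m"] by simp
    have "norm u \<le> X" if "u \<in> digit_set T l m" for u
    proof -
      have "norm u \<le> R * (real l ^ Suc m - 1)" using main[of m] that by blast
      also have "\<dots> \<le> X" unfolding X_def using r by (intro mult_left_mono) auto
      finally show ?thesis .
    qed
    then have "digit_set T l m \<subseteq> \<Lambda> \<inter> cball 0 X" using main[of m] by auto
    then have "card T ^ Suc m \<le> card (\<Lambda> \<inter> cball 0 X)"
      using main[of m] card_mono count[OF X] by metis
    then have "real (card T) ^ Suc m \<le> real (card (\<Lambda> \<inter> cball 0 X))"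
      by (metis of_nat_le_iff of_nat_power)
    also have "\<dots> \<le> C * X powr s" using count[OF X] by blast
    also have "\<dots> = (C * R powr s) * (real l powr s) ^ Suc m"
    proof -
      have "(real l ^ Suc m) powr s = (real l powr s) ^ Suc m"
        using l3 by (simp only: powr_realpow[symmetric] powr_powr powr_gt_zero zero_less_power mult.commute)
      then show ?thesis
        unfolding X_def using r l3 by (simp add: powr_mult)
    qed
    finally show "real (card T) ^ Suc m \<le> C * R powr s * (real l powr s) ^ Suc m" .
  qed simp
  also have "\<dots> \<le> (4 * R / r) powr s" using l2 l3 s by (intro powr_mono2) auto
  finally show ?thesis .
qed

text \<open>A linear group has no small subgroups. For \<open>D = C ^^ k\<close> and
  \<open>y = D x - x\<close> one has \<open>D (D x) - x = 2 *\<^sub>R y + (D y - y)\<close>, so a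
  displacement bound valid for all powers improves itself by the factor 2/3, again and
  again.\<close>

lemma fixed_if_powers_near_identity:
  fixes C :: "'a::real_normed_vector \<Rightarrow> 'a"
  assumes lin: "linear C" and near: "\<And>k x. norm ((C ^^ k) x - x) \<le> norm x / 2"
  shows "C x = x"
proof -
  have lin_pow: "linear (C ^^ k)" for k
  proof (induction k)
    case (Suc k)
    show ?case using linear_compose[OF Suc lin] by (simp add: o_def)
  qed (simp add: id_def linear_ident)
  have *: "norm ((C ^^ k) x - x) \<le> (2/3) ^ m * norm x" for k m x
  proof (induction m arbitrary: k x)
    case 0
    show ?case using near[of k x] norm_ge_zero[of x] unfolding power_0 by linarith
  next
    case (Suc m)
    define D where "D = C ^^ k"
    have D: "linear D" unfolding D_def by (rule lin_pow)
    define y where "y = D x - x"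
    have "D (D x) - x = 2 *\<^sub>R y + (D y - y)"
      unfolding y_def by (simp add: linear_diff[OF D] scaleR_2)
    moreover have "D (D x) = (C ^^ (k + k)) x" by (simp add: D_def funpow_add)
    ultimately have "2 *\<^sub>R y = ((C ^^ (k + k)) x - x) - (D y - y)" by simp
    then have "norm (2 *\<^sub>R y) \<le> norm ((C ^^ (k + k)) x - x) + norm (D y - y)"
      by (metis norm_triangle_ineq4)
    also have "\<dots> \<le> (2/3) ^ m * norm x + norm y / 2"
      using Suc.IH[of "k + k" x] near[of k y] by (intro add_mono) (auto simp: D_def)
    finally show ?case by (simp add: y_def D_def)
  qed
  have "norm (C x - x) \<le> 0"
  proof (rule ccontr)
    assume "\<not> ?thesis"
    then have p: "0 < norm (C x - x)" by simp
    moreover have "norm (C x - x) \<le> norm x / 2" using near[of 1 x] by simp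
    ultimately have "0 < norm x" by linarith
    note p = p this
    then obtain m where "(2/3) ^ m < norm (C x - x) / norm x"
      using real_arch_pow_inv[of "norm (C x - x) / norm x" "2/3"] by auto
    then show False using *[of 1 x m] p by (simp add: field_simps)
  qed
  then show ?thesis by simp
qed

text \<open>A nontrivial Jordan block of eigenvalue 1 would make the orbit of \<open>u\<close> grow
  linearly, which a norm preserving map forbids.\<close>

lemma fixed_if_square_fixed:
  fixes A :: "'a::real_normed_vector \<Rightarrow> 'a"
  assumes lin: "linear A" and norm: "\<And>x. norm (A x) = norm x"
    and fixed: "A (A u - u) = A u - u"
  shows "A u = u"
proof -
  define v where "v = A u - u"
  have pow: "(A ^^ n) u = u + real n *\<^sub>R v" for n
  proof (induction n)
    case (Suc n)
    have "A u = u + v" "A v = v" using fixed by (auto simp: v_def)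
    then show ?case using Suc by (simp add: linear_add[OF lin] linear_scale[OF lin] algebra_simps)
  qed simp
  have "norm ((A ^^ n) u) = norm u" for n by (induction n) (auto simp: norm)
  have "real n * norm v \<le> 2 * norm u" for n
  proof -
    have "real n * norm v = norm ((A ^^ n) u - u)" using pow[of n] by simp
    also have "\<dots> \<le> norm ((A ^^ n) u) + norm u" by (rule norm_triangle_ineq4)
    finally show ?thesis using \<open>\<And>n. norm ((A ^^ n) u) = norm u\<close> by simp
  qed
  then have "\<not> 0 < norm v" using reals_Archimedean3[of "norm v"] by (meson not_le)
  then have "norm v = 0" by simp
  then show ?thesis by (simp add: v_def)
qed

section \<open>Discrete groups of Euclidean isometries\<close>

definition lin_part :: "('a::real_vector \<Rightarrow> 'a) \<Rightarrow> 'a \<Rightarrow> 'a" where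
  "lin_part f x = f x - f 0"

definition near_translation :: "real \<Rightarrow> ('a::real_normed_vector \<Rightarrow> 'a) \<Rightarrow> bool" where
  "near_translation e f \<longleftrightarrow> (\<forall>x. norm (lin_part f x - x) \<le> e * norm x)"

definition isometry_commutator :: "('a \<Rightarrow> 'a) \<Rightarrow> ('a \<Rightarrow> 'a) \<Rightarrow> 'a \<Rightarrow> 'a" where
  "isometry_commutator f g = f \<circ> g \<circ> inv_into UNIV f \<circ> inv_into UNIV g"

locale discrete_isometry_group =
  fixes G :: "('a::euclidean_space \<Rightarrow> 'a) set"
  assumes isometry: "f \<in> G \<Longrightarrow> dist (f x) (f y) = dist x y"
    and id_mem: "id \<in> G"
    and comp_mem: "f \<in> G \<Longrightarrow> g \<in> G \<Longrightarrow> f \<circ> g \<in> G"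
    and inverse: "f \<in> G \<Longrightarrow> \<exists>g\<in>G. g \<circ> f = id \<and> f \<circ> g = id"
    and discrete: "finite {f \<in> G. norm (f 0) \<le> R}"
begin

lemma bij_mem: "f \<in> G \<Longrightarrow> bij f"
  using inverse o_bij by blast

lemma inv_mem: "f \<in> G \<Longrightarrow> inv_into UNIV f \<in> G"
  using inverse inv_unique_comp by metis

lemma orthogonal_lin_part: "f \<in> G \<Longrightarrow> orthogonal_transformation (lin_part f)"
  unfolding orthogonal_transformation_isometry lin_part_def
  using isometry[of f] by (auto simp: dist_norm)

lemma linear_lin_part: "f \<in> G \<Longrightarrow> linear (lin_part f)"
  using orthogonal_lin_part orthogonal_transformation_linear by blast

lemma norm_lin_part: "f \<in> G \<Longrightarrow> norm (lin_part f x) = norm x"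
  using orthogonal_lin_part orthogonal_transformation_norm by blast

lemma inner_lin_part: "f \<in> G \<Longrightarrow> lin_part f x \<bullet> lin_part f y = x \<bullet> y"
  using orthogonal_lin_part orthogonal_transformation_def by blast

lemma surj_lin_part: "f \<in> G \<Longrightarrow> \<exists>x. lin_part f x = y"
  using orthogonal_transformation_surj[OF orthogonal_lin_part] by (metis surjD)

lemma diff_eval: "f \<in> G \<Longrightarrow> f x - f y = lin_part f (x - y)"
  using linear_diff[OF linear_lin_part, of f x y] by (simp add: lin_part_def)

lemma lin_part_comp: "f \<in> G \<Longrightarrow> lin_part (f \<circ> g) x = lin_part f (lin_part g x)"
  using diff_eval[of f "g x" "g 0"] by (simp add: lin_part_def)

lemma eq_idI:
  assumes "\<And>x. lin_part f x = x" "f 0 = 0"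
  shows "f = id"
  using assms by (auto simp: fun_eq_iff lin_part_def)

lemma commutator_mem: "f \<in> G \<Longrightarrow> g \<in> G \<Longrightarrow> isometry_commutator f g \<in> G"
  unfolding isometry_commutator_def by (intro comp_mem inv_mem)

lemma commutator_swap:
  assumes "f \<in> G" "g \<in> G"
  shows "isometry_commutator f g (g (f x)) = f (g x)"
  using bij_mem[OF assms(1)] bij_mem[OF assms(2)]
  by (simp add: isometry_commutator_def bij_is_inj)

lemma lin_part_commutator_swap:
  assumes "f \<in> G" "g \<in> G"
  shows "lin_part (isometry_commutator f g) (lin_part g (lin_part f x)) = lin_part f (lin_part g x)"
proof -
  have "isometry_commutator f g \<circ> (g \<circ> f) = f \<circ> g"
    using commutator_swap[OF assms] by (auto simp: fun_eq_iff)
  then have "lin_part (isometry_commutator f g \<circ> (g \<circ> f)) x = lin_part (f \<circ> g) x" by simp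
  then show ?thesis
    using assms commutator_mem[OF assms] by (simp add: lin_part_comp)
qed

text \<open>For linear parts A and B, the difference AB - BA equals (A-1)(B-1) - (B-1)(A-1), so the
  two distances to the identity multiply.\<close>

lemma near_commutator:
  assumes fg: "f \<in> G" "g \<in> G" and f: "near_translation a f" and g: "near_translation b g"
    and ab: "0 \<le> a" "0 \<le> b"
  shows "near_translation (2 * a * b) (isometry_commutator f g)"
  unfolding near_translation_def
proof
  fix y
  define A B where "A = lin_part f" and "B = lin_part g"
  have lin: "linear A" "linear B" using fg linear_lin_part by (auto simp: A_def B_def)
  obtain x where x: "B (A x) = y" using surj_lin_part fg by (metis A_def B_def)
  have nx: "norm x = norm y" using x fg norm_lin_part by (metis A_def B_def)
  have nA: "norm (A z - z) \<le> a * norm z" and nB: "norm (B z - z) \<le> b * norm z" for z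
    using f g by (auto simp: near_translation_def A_def B_def)
  have "lin_part (isometry_commutator f g) y - y = A (B x) - B (A x)"
    using lin_part_commutator_swap[OF fg, of x] x by (simp add: A_def B_def)
  also have "\<dots> = (A (B x - x) - (B x - x)) - (B (A x - x) - (A x - x))"
    by (simp add: linear_diff[OF lin(1)] linear_diff[OF lin(2)])
  also have "norm \<dots> \<le> a * norm (B x - x) + b * norm (A x - x)"
    using norm_triangle_ineq4 nA[of "B x - x"] nB[of "A x - x"] by (metis add_mono order_trans)
  also have "\<dots> \<le> a * (b * norm x) + b * (a * norm x)"
    using nA[of x] nB[of x] ab by (intro add_mono mult_left_mono) auto
  finally show "norm (lin_part (isometry_commutator f g) y - y) \<le> 2 * a * b * norm y"
    by (simp add: nx algebra_simps)
qed

text \<open>The translation part of the commutator splits into the displacement of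
  \<open>g 0\<close> by the linear part of \<open>f\<close>, that of \<open>f 0\<close> by the
  linear part of \<open>g\<close>, and that of \<open>g (f 0)\<close> by the linear part of the
  commutator itself.\<close>

lemma norm_commutator_0:
  assumes fg: "f \<in> G" "g \<in> G" and f: "near_translation a f" and g: "near_translation b g"
    and ab: "0 \<le> a" "0 \<le> b"
  shows "norm (isometry_commutator f g 0)
    \<le> a * norm (g 0) + b * norm (f 0) + 2 * a * b * (norm (f 0) + norm (g 0))"
proof -
  define C where "C = isometry_commutator f g"
  have CG: "C \<in> G" using commutator_mem fg by (simp add: C_def)
  have nC: "norm (lin_part C z - z) \<le> 2 * a * b * norm z" for z
    using near_commutator[OF fg f g ab] by (simp add: near_translation_def C_def)
  have "C 0 = C (g (f 0)) - lin_part C (g (f 0))" by (simp add: lin_part_def)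
  also have "C (g (f 0)) = f (g 0)" using commutator_swap[OF fg] by (simp add: C_def)
  finally have "C 0 = (lin_part f (g 0) - g 0) - (lin_part g (f 0) - f 0) - (lin_part C (g (f 0)) - g (f 0))"
    by (simp add: lin_part_def)
  also have "norm \<dots> \<le> norm (lin_part f (g 0) - g 0) + norm (lin_part g (f 0) - f 0) + norm (lin_part C (g (f 0)) - g (f 0))"
    by (rule order_trans[OF norm_triangle_ineq4 add_right_mono[OF norm_triangle_ineq4]])
  also have "\<dots> \<le> a * norm (g 0) + b * norm (f 0) + 2 * a * b * norm (g (f 0))"
    using f g nC by (intro add_mono) (auto simp: near_translation_def)
  also have "\<dots> \<le> a * norm (g 0) + b * norm (f 0) + 2 * a * b * (norm (f 0) + norm (g 0))"
  proof -
    have "norm (g (f 0)) \<le> norm (lin_part g (f 0)) + norm (g 0)"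
      using norm_triangle_ineq[of "lin_part g (f 0)" "g 0"] by (simp add: lin_part_def)
    then have "norm (g (f 0)) \<le> norm (f 0) + norm (g 0)" using norm_lin_part[OF fg(2)] by simp
    then show ?thesis using ab by (intro add_left_mono mult_left_mono) auto
  qed
  finally show ?thesis by (simp add: C_def)
qed

section \<open>Iterated commutators of near translations\<close>

lemma iterated_commutator_mem:
  "f \<in> G \<Longrightarrow> g \<in> G \<Longrightarrow> (isometry_commutator f ^^ k) g \<in> G"
  by (induction k) (auto intro: commutator_mem)

lemma near_translation_mono:
  "near_translation a f \<Longrightarrow> a \<le> b \<Longrightarrow> near_translation b f"
  unfolding near_translation_def by (meson mult_right_mono norm_ge_zero order_trans)

text \<open>With the constant 1/8 each commutator with \<open>f\<close> multiplies the rotational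
  part by \<open>2 * (1/8) = 1/4\<close>. In the translation part the three contributions add up to
  5/16, which is below 1/2.\<close>

lemma iterated_commutator_bounds:
  assumes fg: "f \<in> G" "g \<in> G" and f: "near_translation (1/8) f" and g: "near_translation (1/8) g"
  shows "near_translation ((1/4) ^ k / 8) ((isometry_commutator f ^^ k) g)"
    and "norm ((isometry_commutator f ^^ k) g 0) \<le> (norm (f 0) + norm (g 0)) * (1/2) ^ k"
proof (induction k)
  case 0
  { case 1 show ?case using g by simp }
  { case 2 show ?case by simp }
next
  case (Suc k)
  define h where "h = (isometry_commutator f ^^ k) g"
  have hG: "h \<in> G" using iterated_commutator_mem[OF fg] by (simp add: h_def)
  have IH: "near_translation ((1/4) ^ k / 8) h" "norm (h 0) \<le> (norm (f 0) + norm (g 0)) * (1/2) ^ k"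
    using Suc by (auto simp: h_def)
  have eq: "(isometry_commutator f ^^ Suc k) g = isometry_commutator f h" by (simp add: h_def)
  { case 1
    show ?case
      unfolding eq using near_commutator[OF fg(1) hG f IH(1)]
      by (auto elim!: near_translation_mono)
  }
  { case 2
    define S where "S = norm (f 0) + norm (g 0)"
    define p where "p = (1/2::real) ^ k"
    have p: "0 < p" "p \<le> 1" by (auto simp: p_def power_le_one)
    have pp: "(1/4::real) ^ k = p * p" by (simp add: p_def power_mult_distrib[symmetric])
    have "norm (isometry_commutator f h 0) \<le> 1/8 * norm (h 0) + p * p / 8 * norm (f 0)
        + 2 * (1/8) * (p * p / 8) * (norm (f 0) + norm (h 0))"
      using norm_commutator_0[OF fg(1) hG f IH(1)] unfolding pp by simp
    also have "\<dots> \<le> 1/8 * (S * p) + p / 8 * S + 1/32 * p * (S + S)"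
    proof -
      have a: "p * p \<le> p * 1" using p by (intro mult_left_mono) auto
      have S: "0 \<le> S" "norm (f 0) \<le> S" by (auto simp: S_def)
      have h: "norm (h 0) \<le> S * p" using IH(2) by (simp add: S_def p_def)
      also have "\<dots> \<le> S * 1" using S p by (intro mult_left_mono) auto
      finally have h': "norm (h 0) \<le> S" by simp
      have "p * p / 8 * norm (f 0) \<le> p / 8 * S"
        using a S p by (intro mult_mono) auto
      moreover have "2 * (1/8) * (p * p / 8) * (norm (f 0) + norm (h 0)) \<le> 1/32 * p * (S + S)"
      proof -
        have "p * p / 32 * (norm (f 0) + norm (h 0)) \<le> p / 32 * (S + S)"
          using a S p h' by (intro mult_mono add_mono) auto
        then show ?thesis by simp
      qed
      moreover have "1/8 * norm (h 0) \<le> 1/8 * (S * p)" using h by simp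
      ultimately show ?thesis by (intro add_mono)
    qed
    also have "\<dots> \<le> S * (p * (1/2))"
    proof -
      have "0 \<le> S * p" using p by (simp add: S_def)
      moreover have "1/8 * (S * p) + p / 8 * S + 1/32 * p * (S + S) = 5/16 * (S * p)"
        by (simp add: field_simps)
      ultimately show ?thesis by simp
    qed
    finally show ?case unfolding eq by (simp add: S_def p_def mult_ac)
  }
qed

text \<open>The translation parts stay bounded, so by discreteness only finitely many commutators
  occur and one of them recurs infinitely often. The decaying bounds then force that one to be the
  identity.\<close>

lemma iterated_commutator_eq_id:
  assumes fg: "f \<in> G" "g \<in> G" and f: "near_translation (1/8) f" and g: "near_translation (1/8) g"
  obtains k where "(isometry_commutator f ^^ k) g = id"
proof -
  define h where "h k = (isometry_commutator f ^^ k) g" for k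
  define S where "S = norm (f 0) + norm (g 0)"
  have "range h \<subseteq> {u \<in> G. norm (u 0) \<le> S}"
  proof clarify
    fix k
    have "norm (h k 0) \<le> S * (1/2) ^ k"
      using iterated_commutator_bounds(2)[OF fg f g] by (simp add: h_def S_def)
    also have "\<dots> \<le> S * 1" by (intro mult_left_mono) (auto simp: S_def power_le_one)
    finally show "h k \<in> G \<and> norm (h k 0) \<le> S"
      using iterated_commutator_mem[OF fg] by (simp add: h_def)
  qed
  then have "finite (range h)" using discrete finite_subset by blast
  then obtain k0 where inf: "infinite {k. h k = h k0}"
    using pigeonhole_infinite[of UNIV h] by auto
  have arb: "\<exists>k\<ge>n. h k = h k0" for n
    using inf unfolding infinite_nat_iff_unbounded_le by blast
  have "norm (lin_part (h k0) x - x) \<le> 0" for x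
  proof (rule le_0_of_halves[where c = "norm x"])
    fix n
    obtain k where k: "k \<ge> n" "h k = h k0" using arb by blast
    have "norm (lin_part (h k) x - x) \<le> (1/4) ^ k / 8 * norm x"
      using iterated_commutator_bounds(1)[OF fg f g, of k] by (simp add: near_translation_def h_def)
    also have "\<dots> \<le> (1/2) ^ k * norm x"
    proof (intro mult_right_mono)
      have "(1/4::real) ^ k \<le> (1/2) ^ k" by (intro power_mono) auto
      moreover have "0 \<le> (1/4::real) ^ k" by simp
      ultimately show "(1/4::real) ^ k / 8 \<le> (1/2) ^ k" by linarith
    qed simp
    finally show "\<exists>k\<ge>n. norm (lin_part (h k0) x - x) \<le> norm x * (1/2) ^ k"
      using k by (auto simp: mult.commute)
  qed
  moreover have "norm (h k0 0) \<le> 0"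
  proof (rule le_0_of_halves[where c = S])
    fix n
    obtain k where k: "k \<ge> n" "h k = h k0" using arb by blast
    then show "\<exists>k\<ge>n. norm (h k0 0) \<le> S * (1/2) ^ k"
      using iterated_commutator_bounds(2)[OF fg f g, of k] by (auto simp: h_def S_def)
  qed
  ultimately have "h k0 = id" by (intro eq_idI) auto
  then show ?thesis using that by (simp add: h_def)
qed

text \<open>Descending induction from the level where the iterated commutator is the identity. If A
  commutes with the commutator C of A and B, then C^n is the commutator of A^n and B. It is
  therefore close to the identity for every n, because B is, and
  \<open>fixed_if_powers_near_identity\<close> gives C = 1.\<close>

lemma lin_parts_commute:
  assumes fg: "f \<in> G" "g \<in> G" and f: "near_translation (1/8) f" and g: "near_translation (1/8) g"
  shows "lin_part f (lin_part g x) = lin_part g (lin_part f x)"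
proof -
  define h where "h k = (isometry_commutator f ^^ k) g" for k
  define A where "A = lin_part f"
  define B where "B k = lin_part (h k)" for k
  have hG: "h k \<in> G" for k using iterated_commutator_mem[OF fg] by (simp add: h_def)
  have lin: "linear A" "linear (B k)" for k
    using fg(1) hG linear_lin_part by (auto simp: A_def B_def)
  have swap: "B (Suc k) (B k (A x)) = A (B k x)" for k x
    using lin_part_commutator_swap[OF fg(1) hG, of k x] by (simp add: A_def B_def h_def)
  have nB: "norm (B k x - x) \<le> norm x / 8" for k x
  proof -
    have "near_translation (1/8) (h k)"
      using iterated_commutator_bounds(1)[OF fg f g, of k]
      by (auto elim!: near_translation_mono simp: h_def power_le_one)
    then show ?thesis by (simp add: near_translation_def B_def)
  qed
  have down: "\<forall>x. A (B k x) = B k (A x)" if IH: "\<forall>x. A (B (Suc k) x) = B (Suc k) (A x)" for k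
  proof -
    define C where "C = B (Suc k)"
    \<comment> \<open>This says that \<open>C ^^ n\<close> is the commutator of
      \<open>A ^^ n\<close> and \<open>B k\<close>, without mentioning inverses.\<close>
    have pow: "(A ^^ n) (B k x) = (C ^^ n) (B k ((A ^^ n) x))" for n x
    proof (induction n arbitrary: x)
      case (Suc n)
      have comm: "A ((C ^^ m) z) = (C ^^ m) (A z)" for m z
        by (induction m) (use IH in \<open>auto simp: C_def\<close>)
      have "(A ^^ Suc n) (B k x) = (C ^^ n) (A (B k ((A ^^ n) x)))"
        using Suc comm by simp
      also have "\<dots> = (C ^^ n) (C (B k (A ((A ^^ n) x))))"
        using swap[of k "(A ^^ n) x"] by (simp add: C_def)
      finally show ?case by (simp add: funpow_swap1)
    qed simp
    have linpow: "linear (A ^^ n)" for n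
    proof (induction n)
      case (Suc n)
      show ?case using linear_compose[OF Suc lin(1)] by (simp add: o_def)
    qed (simp add: id_def linear_ident)
    have normpow: "norm ((A ^^ n) x) = norm x" for n x
      by (induction n) (use norm_lin_part[OF fg(1)] in \<open>auto simp: A_def\<close>)
    have surjpow: "\<exists>x. (A ^^ n) x = y" for n y
    proof (induction n arbitrary: y)
      case (Suc n)
      obtain z where "A z = y" using surj_lin_part[OF fg(1)] by (metis A_def)
      moreover obtain x where "(A ^^ n) x = z" using Suc by blast
      ultimately show ?case by auto
    qed simp
    have "C y = y" for y
    proof (rule fixed_if_powers_near_identity)
      show "linear C" using lin by (simp add: C_def)
      fix n y
      obtain z where z: "B k z = y" using surj_lin_part[OF hG] by (metis B_def)
      obtain x where x: "(A ^^ n) x = z" using surjpow by blast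
      have nx: "norm x = norm y"
        using normpow[of n x] x z norm_lin_part[OF hG, of k z] by (simp add: B_def)
      have "(C ^^ n) y - y = (A ^^ n) (B k x - x) - (B k z - z)"
        using pow[of n x] x z by (simp add: linear_diff[OF linpow])
      also have "norm \<dots> \<le> norm (B k x - x) + norm (B k z - z)"
        using norm_triangle_ineq4 normpow by metis
      also have "\<dots> \<le> norm x / 8 + norm z / 8" using nB by (intro add_mono)
      also have "norm z = norm x" using normpow x by metis
      finally show "norm ((C ^^ n) y - y) \<le> norm y / 2" using nx norm_ge_zero[of y] by linarith
    qed
    then show ?thesis using swap[of k] by (simp add: C_def)
  qed
  obtain K where "h K = id" using iterated_commutator_eq_id[OF fg f g] by (auto simp: h_def)
  then have base: "\<forall>x. A (B K x) = B K (A x)" by (simp add: B_def lin_part_def)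
  have "\<forall>x. A (B (K - j) x) = B (K - j) (A x)" if "j \<le> K" for j
    using that
  proof (induction j)
    case (Suc j)
    then have "K - j = Suc (K - Suc j)" by simp
    then show ?case using Suc down[of "K - Suc j"] by simp
  qed (use base in simp)
  from this[of K] show ?thesis by (simp add: A_def B_def h_def)
qed

text \<open>Since the linear parts commute, every iterated commutator is a translation, and one
  further commutator with \<open>f\<close> applies \<open>lin_part f - id\<close> to its vector. The
  vectors end at 0, and \<open>fixed_if_square_fixed\<close> carries the property of being fixed by
  \<open>lin_part f\<close> back to the first of them.\<close>

lemma commutator_fixed:
  assumes fg: "f \<in> G" "g \<in> G" and f: "near_translation (1/8) f" and g: "near_translation (1/8) g"
  shows "lin_part (isometry_commutator f g) x = x"
    and "lin_part f (isometry_commutator f g 0) = isometry_commutator f g 0"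
proof -
  \<comment> \<open>The numbering starts at the first commutator, as \<open>g\<close> itself may
    have a nontrivial linear part.\<close>
  define h where "h k = (isometry_commutator f ^^ Suc k) g" for k
  have hG: "h k \<in> G" for k using iterated_commutator_mem[OF fg] unfolding h_def by blast
  have lin: "linear (lin_part f)" by (rule linear_lin_part[OF fg(1)])
  have trans: "lin_part (isometry_commutator f u) x = x"
    if u: "u \<in> G" and c: "\<And>x. lin_part f (lin_part u x) = lin_part u (lin_part f x)" for u x
  proof -
    obtain z where "lin_part u (lin_part f z) = x" using surj_lin_part u fg(1) by metis
    then show ?thesis using lin_part_commutator_swap[OF fg(1) u, of z] c by simp
  qed
  have h1: "lin_part (h k) x = x" for k x
  proof (induction k arbitrary: x)
    case 0
    show ?case using trans[OF fg(2) lin_parts_commute[OF fg f g]] by (simp add: h_def)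
  next
    case (Suc k)
    show ?case using trans[OF hG[of k]] Suc by (simp add: h_def)
  qed
  have step: "h (Suc k) 0 = lin_part f (h k 0) - h k 0" for k
  proof -
    have eq: "h (Suc k) = isometry_commutator f (h k)" by (simp add: h_def)
    have v: "u x = x + u 0" if "\<And>x. lin_part u x = x" for u :: "'a \<Rightarrow> 'a" and x
      using that[of x] by (simp add: lin_part_def algebra_simps)
    have e: "h (Suc k) (h k (f 0)) = f (h k 0)"
      unfolding eq by (rule commutator_swap[OF fg(1) hG])
    have e1: "h k (f 0) = f 0 + h k 0" by (rule v) (rule h1)
    have e2: "h (Suc k) (h k (f 0)) = h k (f 0) + h (Suc k) 0" by (rule v) (rule h1)
    have "f (h k 0) = f 0 + h k 0 + h (Suc k) 0" using e e2 e1 by (metis)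
    then have "lin_part f (h k 0) = h k 0 + h (Suc k) 0" by (simp only: lin_part_def add.assoc add_diff_cancel_left')
    then show ?thesis by (simp only: add_diff_cancel_left')
  qed
  obtain K where K: "(isometry_commutator f ^^ K) g = id" using iterated_commutator_eq_id[OF fg f g] by blast
  have "isometry_commutator f id = id"
    using bij_mem[OF fg(1)] by (simp add: isometry_commutator_def bij_is_surj surj_iff[symmetric])
  then have "h K = id" using K by (simp add: h_def)
  then have base: "lin_part f (h K 0) = h K 0" by (simp add: lin_part_def)
  have down: "lin_part f (h k 0) = h k 0" if "lin_part f (h (Suc k) 0) = h (Suc k) 0" for k
    by (rule fixed_if_square_fixed[OF lin norm_lin_part[OF fg(1)]])
       (simp only: step[of k, symmetric] that)
  have "lin_part f (h (K - j) 0) = h (K - j) 0" if "j \<le> K" for j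
    using that
  proof (induction j)
    case (Suc j)
    then have "K - j = Suc (K - Suc j)" by simp
    then show ?case using Suc down[of "K - Suc j"] by simp
  qed (use base in simp)
  from this[of K] show "lin_part f (isometry_commutator f g 0) = isometry_commutator f g 0"
    by (simp add: h_def)
  show "lin_part (isometry_commutator f g) x = x" using h1[of 0 x] by (simp add: h_def)
qed

text \<open>The translation vector \<open>w\<close> of the commutator lies in the range of the two maps
  \<open>lin_part f - id\<close> and \<open>lin_part g - id\<close> combined, and is fixed by both linear parts,
  hence orthogonal to itself.\<close>

lemma near_translations_commute:
  assumes fg: "f \<in> G" "g \<in> G" and f: "near_translation (1/8) f" and g: "near_translation (1/8) g"
  shows "f \<circ> g = g \<circ> f"
proof -
  define c where "c = isometry_commutator f g"
  define w where "w = c 0"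
  have c: "c x = x + w" for x
    using commutator_fixed(1)[OF fg f g, of x] by (simp add: c_def w_def lin_part_def algebra_simps)
  define c' where "c' = isometry_commutator g f"
  have c': "c' x = x + c' 0" for x
    using commutator_fixed(1)[OF fg(2,1) g f, of x] by (simp add: c'_def lin_part_def algebra_simps)
  have "c (g (f 0)) = f (g 0)" "c' (f (g 0)) = g (f 0)"
    using commutator_swap[OF fg] commutator_swap[OF fg(2,1)] by (auto simp: c_def c'_def)
  then have w1: "f (g 0) = g (f 0) + w" "g (f 0) = f (g 0) + c' 0"
    using c[of "g (f 0)"] c'[of "f (g 0)"] by auto
  then have "g (f 0) = g (f 0) + (w + c' 0)" by (metis add.assoc)
  then have "w + c' 0 = 0" by simp
  then have w': "f (g 0) = g (f 0) + w" "c' 0 = - w"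
    using w1(1) by (auto simp: add_eq_0_iff)
  have fx: "lin_part f w = w" "lin_part g (- w) = - w"
    using commutator_fixed(2)[OF fg f g] commutator_fixed(2)[OF fg(2,1) g f] w'(2)
    by (auto simp: w_def c_def c'_def)
  then have fixg: "lin_part g w = w" using linear_neg[OF linear_lin_part[OF fg(2)], of w] by simp
  have "w = (lin_part f (g 0) - g 0) - (lin_part g (f 0) - f 0)"
    using w'(1) by (simp add: lin_part_def algebra_simps)
  then have "w \<bullet> w = (w \<bullet> lin_part f (g 0) - w \<bullet> g 0) - (w \<bullet> lin_part g (f 0) - w \<bullet> f 0)"
    by (metis inner_diff_right)
  also have "\<dots> = 0"
    using inner_lin_part[OF fg(1), of w "g 0"] inner_lin_part[OF fg(2), of w "f 0"] fx fixg by simp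
  finally have "w = 0" by simp
  then have "f (g x) = g (f x)" for x
    using c[of "g (f x)"] commutator_swap[OF fg, of x] by (simp add: c_def)
  then show ?thesis by (simp add: fun_eq_iff)
qed

end

lemma norm_add_diff_diff:
  "norm (a + b - c - d) \<le> norm a + norm b + norm c + norm (d :: 'a::real_normed_vector)"
  using norm_triangle_ineq4[of "a + b - c" d] norm_triangle_ineq4[of "a + b" c] norm_triangle_ineq[of a b]
  by linarith

context discrete_isometry_group
begin

section \<open>The abelian part, its index and its translation vectors\<close>

lemma inv_right: "f \<in> G \<Longrightarrow> f (inv_into UNIV f x) = x"
  using bij_mem by (simp add: bij_is_surj surj_f_inv_f)

text \<open>A pigeonhole argument in the orthogonal group: finitely many cells describe where a
  linear part sends the basis, and two elements with the same cells differ by a near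
  translation.\<close>

lemma exists_coset_representatives:
  obtains K where "finite K" "K \<subseteq> G"
    "\<And>f. f \<in> G \<Longrightarrow> \<exists>u\<in>K. \<exists>s\<in>G. near_translation (1/8) s \<and> f = u \<circ> s"
proof -
  \<comment> \<open>Errors of at most \<open>\<delta>\<close> on each basis vector add up to at most
    \<open>DIM('a) * \<delta> = 1/8\<close> relative to \<open>norm x\<close>.\<close>
  define \<delta> where "\<delta> = 1 / (8 * real DIM('a))"
  have d: "0 < \<delta>" by (simp add: \<delta>_def)
  obtain \<U> where U: "scale_cover \<delta> (cball 0 1 :: 'a set) \<U>"
    using exists_scale_cover[OF bounded_cball d] by blast
  define cell where "cell f = (\<lambda>b\<in>Basis. SOME U. U \<in> \<U> \<and> lin_part f b \<in> U)" for f :: "'a \<Rightarrow> 'a"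
  have cell: "cell f b \<in> \<U> \<and> lin_part f b \<in> cell f b" if "f \<in> G" "b \<in> Basis" for f b
  proof -
    have "lin_part f b \<in> cball 0 1" using norm_lin_part[OF that(1)] that(2) by simp
    then have "\<exists>U. U \<in> \<U> \<and> lin_part f b \<in> U" using U unfolding scale_cover_def by blast
    from someI_ex[OF this] show ?thesis using that(2) by (simp add: cell_def)
  qed
  define rep where "rep c = (SOME f. f \<in> G \<and> cell f = c)" for c
  have rep: "rep (cell f) \<in> G \<and> cell (rep (cell f)) = cell f" if "f \<in> G" for f
    unfolding rep_def by (rule someI[of _ f]) (use that in simp)
  have "cell ` G \<subseteq> PiE Basis (\<lambda>_. \<U>)"
    using cell by (auto simp: cell_def)
  moreover have "finite (PiE (Basis :: 'a set) (\<lambda>_. \<U>))"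
    using U by (intro finite_PiE) (auto simp: scale_cover_def)
  ultimately have "finite (rep ` cell ` G)" using finite_subset by blast
  moreover have "rep ` cell ` G \<subseteq> G" using rep by auto
  moreover have "\<exists>u\<in>rep ` cell ` G. \<exists>s\<in>G. near_translation (1/8) s \<and> f = u \<circ> s" if f: "f \<in> G" for f
  proof -
    define u where "u = rep (cell f)"
    have u: "u \<in> G" "cell u = cell f" using rep[OF f] by (auto simp: u_def)
    define s where "s = inv_into UNIV u \<circ> f"
    have s: "s \<in> G" "f = u \<circ> s"
      using u(1) f by (auto simp: s_def fun_eq_iff inv_right intro: comp_mem inv_mem)
    have close: "norm (lin_part f b - lin_part u b) \<le> \<delta>" if b: "b \<in> Basis" for b
      using scale_coverD[OF U, of "cell f b" "lin_part f b" "lin_part u b"] cell[OF f b] cell[OF u(1) b] u(2)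
      by (simp add: dist_norm)
    have "norm (lin_part s x - x) \<le> 1/8 * norm x" for x
    proof -
      have "norm (lin_part s x - x) = norm (lin_part u (lin_part s x - x))"
        using norm_lin_part[OF u(1)] by simp
      also have "\<dots> = norm (lin_part f x - lin_part u x)"
        using lin_part_comp[OF u(1), of s x] s(2) by (simp add: linear_diff[OF linear_lin_part[OF u(1)]])
      also have "lin_part f x - lin_part u x = (\<Sum>b\<in>Basis. (x \<bullet> b) *\<^sub>R (lin_part f b - lin_part u b))"
      proof -
        have "lin_part w x = (\<Sum>b\<in>Basis. (x \<bullet> b) *\<^sub>R lin_part w b)" if "w \<in> G" for w
          by (subst euclidean_representation[of x, symmetric])
             (simp add: linear_sum[OF linear_lin_part[OF that]] linear_scale[OF linear_lin_part[OF that]])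
        then show ?thesis using f u(1) by (simp add: scaleR_diff_right sum_subtractf)
      qed
      also have "norm \<dots> \<le> (\<Sum>b\<in>(Basis :: 'a set). norm x * \<delta>)"
      proof (rule sum_norm_le)
        fix b :: 'a assume b: "b \<in> Basis"
        show "norm ((x \<bullet> b) *\<^sub>R (lin_part f b - lin_part u b)) \<le> norm x * \<delta>"
          using close[OF b] Basis_le_norm[OF b, of x] by (auto intro: mult_mono)
      qed
      also have "\<dots> = 1/8 * norm x" by (simp add: \<delta>_def)
      finally show ?thesis .
    qed
    then have "near_translation (1/8) s" by (simp add: near_translation_def)
    then show ?thesis using s f by (auto simp: u_def)
  qed
  ultimately show ?thesis using that by blast
qed

text \<open>The bicentralizer of the set of near translations: an abelian group of finite index.\<close>

definition abelian_part :: "('a \<Rightarrow> 'a) set" where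
  "abelian_part = {h \<in> G. \<forall>k\<in>G. (\<forall>s\<in>G. near_translation (1/8) s \<longrightarrow> k \<circ> s = s \<circ> k) \<longrightarrow> h \<circ> k = k \<circ> h}"

lemma abelian_part_subset: "abelian_part \<subseteq> G"
  by (auto simp: abelian_part_def)

lemma near_translation_in_abelian_part:
  "s \<in> G \<Longrightarrow> near_translation (1/8) s \<Longrightarrow> s \<in> abelian_part"
  by (auto simp: abelian_part_def)

text \<open>Near translations commute with each other, so each of them is an admissible
  \<open>k\<close> in the definition. Hence a member of \<open>abelian_part\<close> commutes with
  all near translations and is itself an admissible \<open>k\<close> for the other member.\<close>

lemma abelian_part_commute:
  assumes "h \<in> abelian_part" "k \<in> abelian_part"
  shows "h \<circ> k = k \<circ> h"
proof -
  have "k \<circ> s = s \<circ> k" if "s \<in> G" "near_translation (1/8) s" for s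
    using assms(2) that near_translations_commute[OF _ that(1) _ that(2)] near_translations_commute[OF that(1)]
    by (auto simp: abelian_part_def)
  then show ?thesis using assms by (auto simp: abelian_part_def)
qed

lemma abelian_part_comp:
  assumes "h \<in> abelian_part" "h' \<in> abelian_part"
  shows "h \<circ> h' \<in> abelian_part"
proof -
  have "(h \<circ> h') \<circ> k = k \<circ> (h \<circ> h')"
    if "k \<in> G" "\<forall>s\<in>G. near_translation (1/8) s \<longrightarrow> k \<circ> s = s \<circ> k" for k
  proof -
    have "h \<circ> k = k \<circ> h" "h' \<circ> k = k \<circ> h'" using assms that by (auto simp: abelian_part_def)
    then show ?thesis by (metis comp_assoc)
  qed
  moreover have "h \<circ> h' \<in> G" using assms comp_mem by (auto simp: abelian_part_def)
  ultimately show ?thesis unfolding abelian_part_def by blast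
qed

definition common_fixed :: "('a \<Rightarrow> 'a) set \<Rightarrow> 'a set" where
  "common_fixed F = {x. \<forall>f\<in>F. lin_part f x = x}"

lemma subspace_common_fixed: "F \<subseteq> G \<Longrightarrow> subspace (common_fixed F)"
  unfolding common_fixed_def subspace_def
  using linear_lin_part by (auto simp: linear_0 linear_add linear_scale subset_iff)

text \<open>A least squares argument: \<open>x0\<close> is a critical point of \<open>\<Sum>f\<in>F. (norm (f x - x))\<^sup>2\<close>.\<close>

lemma exists_critical_point:
  fixes F :: "('a \<Rightarrow> 'a) set"
  assumes F: "finite F" "F \<subseteq> G"
  obtains x0 where "\<And>y. (\<Sum>f\<in>F. (lin_part f y - y) \<bullet> (f x0 - x0)) = 0"
proof -
  define L where "L f x = lin_part f x - x" for f :: "'a \<Rightarrow> 'a" and x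
  have linL: "linear (L f)" if "f \<in> F" for f
    unfolding L_def using linear_lin_part F that by (intro linear_compose_sub linear_ident) auto
  define Q where "Q x = (\<Sum>f\<in>F. adjoint (L f) (L f x))" for x
  have Q: "y \<bullet> Q x = (\<Sum>f\<in>F. L f y \<bullet> L f x)" for x y
    unfolding Q_def inner_sum_right using linL adjoint_works by (intro sum.cong) auto
  have linQ: "linear Q"
    unfolding Q_def
  proof (rule linear_compose_sum, rule ballI)
    fix f assume "f \<in> F"
    then show "linear (\<lambda>x. adjoint (L f) (L f x))"
      using linear_compose[OF linL adjoint_linear[OF linL]] by (simp add: o_def)
  qed
  define b where "b = (\<Sum>f\<in>F. adjoint (L f) (f 0))"
  have b: "y \<bullet> b = (\<Sum>f\<in>F. L f y \<bullet> f 0)" for y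
    unfolding b_def inner_sum_right using linL adjoint_works by (intro sum.cong) auto
  have sub: "subspace (range Q)" using linQ by (simp add: linear_subspace_image)
  \<comment> \<open>Solvability of the normal equations: the component \<open>q\<close> of
    \<open>b\<close> orthogonal to the range of \<open>Q\<close> satisfies
    \<open>q \<bullet> Q q = 0\<close>, so every \<open>L f\<close> kills it. Then \<open>q\<close>
    is orthogonal to \<open>b\<close> as well and must vanish.\<close>
  obtain p q where pq: "p \<in> range Q" "\<And>w. w \<in> range Q \<Longrightarrow> orthogonal q w" "b = p + q"
    using orthogonal_subspace_decomp_exists[of "range Q" b] sub by (metis span_eq_iff)
  have "q \<bullet> Q q = 0" using pq(2)[of "Q q"] by (simp add: orthogonal_def)
  then have "(\<Sum>f\<in>F. (norm (L f q))\<^sup>2) = 0" by (simp add: Q power2_norm_eq_inner)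
  then have fixq: "L f q = 0" if "f \<in> F" for f
    using F(1) that by (simp add: sum_nonneg_eq_0_iff)
  have "q \<bullet> b = 0"
  proof -
    have "L f q \<bullet> f 0 = 0" if "f \<in> F" for f using fixq[OF that] by simp
    then show ?thesis by (simp add: b)
  qed
  moreover have "q \<bullet> p = 0" using pq(1,2) by (simp add: orthogonal_def)
  ultimately have "q \<bullet> q = 0" using pq(3) by (simp add: inner_add_right)
  then obtain z where z: "b = Q z" using pq by auto
  have "(\<Sum>f\<in>F. (lin_part f y - y) \<bullet> (f (- z) - (- z))) = 0" for y
  proof -
    have e: "f (- z) - (- z) = f 0 - L f z" if "f \<in> F" for f
      using linear_neg[OF linL[OF that], of z] by (simp add: L_def lin_part_def algebra_simps)
    have "(\<Sum>f\<in>F. (lin_part f y - y) \<bullet> (f (- z) - (- z))) = (\<Sum>f\<in>F. L f y \<bullet> f 0 - L f y \<bullet> L f z)"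
      by (intro sum.cong refl) (simp only: e inner_diff_right L_def[symmetric])
    also have "\<dots> = y \<bullet> b - y \<bullet> Q z" by (simp add: sum_subtractf b Q)
    finally show ?thesis by (simp add: z)
  qed
  then show ?thesis by (rule that)
qed

text \<open>A member \<open>h\<close> of \<open>abelian_part\<close> commutes with the members of
  \<open>F\<close>, so it sends the critical point \<open>x0\<close> to another critical point, and
  the difference of two critical points is fixed by all linear parts from \<open>F\<close>. By the
  choice of \<open>F\<close> it is fixed by the linear parts of all of \<open>abelian_part\<close>,
  which makes displacements of \<open>x0\<close> additive.\<close>

lemma exists_translation_base_point:
  obtains x0 where "\<And>h h'. h \<in> abelian_part \<Longrightarrow> h' \<in> abelian_part \<Longrightarrow>
    (h \<circ> h') x0 - x0 = (h x0 - x0) + (h' x0 - x0)"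
proof -
  define P where "P F \<longleftrightarrow> finite F \<and> F \<subseteq> abelian_part" for F
  \<comment> \<open>A finite subset whose common fixed space has least dimension: adding one more
    element cannot shrink that space.\<close>
  obtain F where F: "P F" "\<And>F'. P F' \<Longrightarrow> dim (common_fixed F) \<le> dim (common_fixed F')"
    using ex_has_least_nat[of P "{}" "\<lambda>F. dim (common_fixed F)"] by (auto simp: P_def)
  then have Ff: "finite F" "F \<subseteq> G" "F \<subseteq> abelian_part" using abelian_part_subset by (auto simp: P_def)
  have all_fix: "lin_part h v = v" if v: "v \<in> common_fixed F" and h: "h \<in> abelian_part" for v h
  proof -
    have hG: "h \<in> G" using h abelian_part_subset by auto
    have "common_fixed (insert h F) = common_fixed F"
    proof (rule subspace_dim_equal)
      show "dim (common_fixed F) \<le> dim (common_fixed (insert h F))"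
        using F(1) h by (intro F(2)) (auto simp: P_def)
      show "subspace (common_fixed (insert h F))" "subspace (common_fixed F)"
        using Ff(2) hG by (intro subspace_common_fixed; simp)+
      show "common_fixed (insert h F) \<subseteq> common_fixed F" by (auto simp: common_fixed_def)
    qed
    then show ?thesis using v by (auto simp: common_fixed_def)
  qed
  obtain x0 where x0: "\<And>y. (\<Sum>f\<in>F. (lin_part f y - y) \<bullet> (f x0 - x0)) = 0"
    using exists_critical_point[OF Ff(1,2)] by blast
  have tau: "h x0 - x0 \<in> common_fixed F" if h: "h \<in> abelian_part" for h
  proof -
    have hG: "h \<in> G" using h abelian_part_subset by auto
    have comm: "f (h x) = h (f x)" if "f \<in> F" for f x
      using abelian_part_commute[OF h, of f] that Ff(3) by (metis comp_apply subsetD)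
    have commlin: "lin_part f (lin_part h x) = lin_part h (lin_part f x)" if f: "f \<in> F" for f x
    proof -
      have "f \<circ> h = h \<circ> f" using comm[OF f] by auto
      then show ?thesis using lin_part_comp[OF hG, of f x] lin_part_comp[of f h x] f Ff(2) by auto
    qed
    have crit: "(\<Sum>f\<in>F. (lin_part f y - y) \<bullet> (f (h x0) - h x0)) = 0" for y
    proof -
      obtain z where z: "lin_part h z = y" using surj_lin_part[OF hG] by blast
      have "(lin_part f y - y) \<bullet> (f (h x0) - h x0) = (lin_part f z - z) \<bullet> (f x0 - x0)" if f: "f \<in> F" for f
      proof -
        have "lin_part f y - y = lin_part h (lin_part f z - z)"
          using commlin[OF f, of z] z by (simp add: linear_diff[OF linear_lin_part[OF hG]])
        moreover have "f (h x0) - h x0 = lin_part h (f x0 - x0)"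
          using comm[OF f] diff_eval[OF hG] by simp
        ultimately show ?thesis using inner_lin_part[OF hG] by simp
      qed
      then show ?thesis using x0[of z] by simp
    qed
    define u where "u = h x0 - x0"
    have "f (h x0) - h x0 - (f x0 - x0) = lin_part f u - u" if "f \<in> F" for f
      using diff_eval[of f "h x0" x0] that Ff(2) by (auto simp: u_def algebra_simps)
    then have "(\<Sum>f\<in>F. (lin_part f u - u) \<bullet> (lin_part f u - u))
        = (\<Sum>f\<in>F. (lin_part f u - u) \<bullet> (f (h x0) - h x0) - (lin_part f u - u) \<bullet> (f x0 - x0))"
      by (intro sum.cong) (auto simp: inner_diff_right[symmetric])
    also have "\<dots> = 0" by (simp only: sum_subtractf crit x0)
    finally have "(\<Sum>f\<in>F. (norm (lin_part f u - u))\<^sup>2) = 0" by (simp add: power2_norm_eq_inner)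
    then show ?thesis
      using Ff(1) by (simp add: sum_nonneg_eq_0_iff common_fixed_def u_def)
  qed
  show ?thesis
  proof (rule that[of x0])
    fix h h' assume h: "h \<in> abelian_part" and h': "h' \<in> abelian_part"
    have hG: "h \<in> G" using h abelian_part_subset by auto
    have "h (h' x0) - h x0 = h' x0 - x0"
      using diff_eval[OF hG, of "h' x0" x0] all_fix[OF tau[OF h'] h] by simp
    then show "(h \<circ> h') x0 - x0 = (h x0 - x0) + (h' x0 - x0)" by (simp add: algebra_simps)
  qed
qed

text \<open>The orbit is cut into finitely many pieces by coset representatives. In each piece the
  base point \<open>y0\<close> is exchanged for \<open>x0\<close>, at bounded cost, because
  displacements of \<open>x0\<close> form an additive semigroup to which
  \<open>card_separated_in_semigroup\<close> applies.\<close>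

lemma card_separated_orbit:
  assumes t: "0 \<le> t"
    and count: "\<And>X. 1 \<le> X \<Longrightarrow> real (card {f \<in> G. norm (f 0) \<le> X}) \<le> C * X powr t"
  obtains D where "1 \<le> D"
    "\<And>R r T. D \<le> r \<Longrightarrow> r \<le> R \<Longrightarrow> finite T \<Longrightarrow> T \<subseteq> (\<lambda>f. f y0) ` G \<Longrightarrow>
      (\<And>y. y \<in> T \<Longrightarrow> norm y \<le> R) \<Longrightarrow>
      (\<And>y y'. y \<in> T \<Longrightarrow> y' \<in> T \<Longrightarrow> y \<noteq> y' \<Longrightarrow> r \<le> norm (y - y')) \<Longrightarrow>
      real (card T) \<le> D * (R / r) powr t"
proof -
  obtain x0 where x0: "\<And>h h'. h \<in> abelian_part \<Longrightarrow> h' \<in> abelian_part \<Longrightarrow>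
    (h \<circ> h') x0 - x0 = (h x0 - x0) + (h' x0 - x0)"
    using exists_translation_base_point by blast
  obtain K where K: "finite K" "K \<subseteq> G"
    "\<And>f. f \<in> G \<Longrightarrow> \<exists>u\<in>K. \<exists>s\<in>G. near_translation (1/8) s \<and> f = u \<circ> s"
    using exists_coset_representatives by blast
  define \<tau> where "\<tau> h = h x0 - x0" for h
  define \<Lambda> where "\<Lambda> = \<tau> ` abelian_part"
  define E where "E = norm (y0 - x0)"
  define P where "P = (\<Sum>u\<in>K. norm (inv_into UNIV u 0))"
  have P: "norm (inv_into UNIV u 0) \<le> P" if "u \<in> K" for u
    unfolding P_def using K(1) that by (intro member_le_sum) auto
  have HG: "h \<in> G" if "h \<in> abelian_part" for h using that abelian_part_subset by auto
  have dE: "norm (h y0 - h x0) = E" if "h \<in> G" for h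
    using isometry[OF that, of y0 x0] by (simp add: E_def dist_norm)
  have add: "u + v \<in> \<Lambda>" if uv: "u \<in> \<Lambda>" "v \<in> \<Lambda>" for u v
  proof -
    obtain h h' where h: "h \<in> abelian_part" "h' \<in> abelian_part" "u = \<tau> h" "v = \<tau> h'"
      using uv by (auto simp: \<Lambda>_def)
    then have "u + v = \<tau> (h \<circ> h')" using x0[OF h(1,2)] by (simp add: \<tau>_def)
    then show ?thesis using abelian_part_comp[OF h(1,2)] by (auto simp: \<Lambda>_def)
  qed
  have countL: "finite (\<Lambda> \<inter> cball 0 X) \<and> real (card (\<Lambda> \<inter> cball 0 X)) \<le> (C * (1 + 2 * norm x0) powr t) * X powr t"
    if X: "1 \<le> X" for X
  proof -
    define S where "S = {f \<in> G. norm (f 0) \<le> X + 2 * norm x0}"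
    have S: "finite S" unfolding S_def by (rule discrete)
    have "\<Lambda> \<inter> cball 0 X \<subseteq> \<tau> ` S"
    proof
      fix v assume "v \<in> \<Lambda> \<inter> cball 0 X"
      then obtain h where h: "h \<in> abelian_part" "v = \<tau> h" "norm (\<tau> h) \<le> X" by (auto simp: \<Lambda>_def)
      have "norm (h 0 - h x0) = norm x0" using isometry[OF HG[OF h(1)], of 0 x0] by (simp add: dist_norm)
      moreover have "h 0 = (h 0 - h x0) + \<tau> h + x0" by (simp add: \<tau>_def)
      then have "norm (h 0) \<le> norm (h 0 - h x0) + norm (\<tau> h) + norm x0"
        by (metis norm_triangle_ineq add_right_mono order_trans)
      ultimately have "norm (h 0) \<le> X + 2 * norm x0" using h(3) by simp
      then show "v \<in> \<tau> ` S" using h HG by (auto simp: S_def)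
    qed
    then have fin: "finite (\<Lambda> \<inter> cball 0 X)" "card (\<Lambda> \<inter> cball 0 X) \<le> card S"
      using S by (auto intro: finite_subset surj_card_le)
    have "real (card S) \<le> C * (X + 2 * norm x0) powr t"
      unfolding S_def using X by (intro count) (simp add: add_increasing2)
    also have "\<dots> \<le> C * ((1 + 2 * norm x0) * X) powr t"
    proof (rule mult_left_mono)
      have "real (card {f \<in> G. norm (f 0) \<le> 1}) \<le> C" using count[of 1] by simp
      then show "0 \<le> C" by (meson of_nat_0_le_iff order_trans)
      have "norm x0 * 1 \<le> norm x0 * X" using X by (intro mult_left_mono) auto
      then show "(X + 2 * norm x0) powr t \<le> ((1 + 2 * norm x0) * X) powr t"
        using X t by (intro powr_mono2) (auto simp: algebra_simps)
    qed
    also have "\<dots> = (C * (1 + 2 * norm x0) powr t) * X powr t"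
      using X by (simp add: powr_mult)
    finally show ?thesis using fin by simp
  qed
  \<comment> \<open>\<open>4 * E \<le> r\<close> keeps a separation of \<open>r / 2\<close> after
    the change of base point, and \<open>P + E + norm x0 \<le> R\<close> keeps the norms below
    \<open>2 * R\<close>. The semigroup bound for these values has base
    \<open>4 * (2 * R) / (r / 2) = 16 * (R / r)\<close>.\<close>
  define D where "D = Max {1, real (card K) * 16 powr t, 4 * E, P + E + norm x0}"
  have D: "1 \<le> D" "real (card K) * 16 powr t \<le> D" "4 * E \<le> D" "P + E + norm x0 \<le> D"
    by (auto simp: D_def)
  show ?thesis
  proof (rule that[OF D(1)])
    fix R r T assume r: "D \<le> r" "r \<le> R" and T: "finite T" "T \<subseteq> (\<lambda>f. f y0) ` G"
      and TR: "\<And>y. y \<in> T \<Longrightarrow> norm y \<le> R"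
      and sep: "\<And>y y'. y \<in> T \<Longrightarrow> y' \<in> T \<Longrightarrow> y \<noteq> y' \<Longrightarrow> r \<le> norm (y - y')"
    define Tu where "Tu u = {y \<in> T. \<exists>h\<in>abelian_part. y = u (h y0)}" for u
    have cardTu: "real (card (Tu u)) \<le> 16 powr t * (R / r) powr t" if u: "u \<in> K" for u
    proof -
      have uG: "u \<in> G" using u K(2) by auto
      have "\<forall>y\<in>Tu u. \<exists>h. h \<in> abelian_part \<and> y = u (h y0)" by (auto simp: Tu_def)
      then obtain h where h: "\<And>y. y \<in> Tu u \<Longrightarrow> h y \<in> abelian_part" "\<And>y. y \<in> Tu u \<Longrightarrow> y = u (h y y0)"
        by (metis (no_types))
      define \<sigma> where "\<sigma> y = \<tau> (h y)" for y
      have norm: "norm (\<sigma> y) \<le> 2 * R" if y: "y \<in> Tu u" for y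
      proof -
        have "norm (h y y0 - inv_into UNIV u 0) = norm (u (h y y0) - u (inv_into UNIV u 0))"
          using isometry[OF uG] by (simp add: dist_norm)
        also have "\<dots> = norm y" using h(2)[OF y] inv_right[OF uG] by simp
        finally have "norm (h y y0 - inv_into UNIV u 0) \<le> R" using TR y by (simp add: Tu_def)
        moreover have "\<sigma> y = (h y y0 - inv_into UNIV u 0) + inv_into UNIV u 0 - (h y y0 - h y x0) - x0"
          by (simp add: \<sigma>_def \<tau>_def)
        then have "norm (\<sigma> y) \<le> norm (h y y0 - inv_into UNIV u 0) + norm (inv_into UNIV u 0)
            + norm (h y y0 - h y x0) + norm x0"
          by (simp only: norm_add_diff_diff)
        ultimately have "norm (\<sigma> y) \<le> R + P + E + norm x0"
          using dE[OF HG[OF h(1)[OF y]]] P[OF u] by simp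
        then show ?thesis using D(4) r by simp
      qed
      have sep': "r / 2 \<le> norm (\<sigma> y - \<sigma> y')" if y: "y \<in> Tu u" "y' \<in> Tu u" "y \<noteq> y'" for y y'
      proof -
        have "r \<le> norm (u (h y y0) - u (h y' y0))"
          using sep y h(2) by (metis (no_types, lifting) Tu_def mem_Collect_eq)
        also have "\<dots> = norm (h y y0 - h y' y0)" using isometry[OF uG] by (simp add: dist_norm)
        also have "h y y0 - h y' y0 = (\<sigma> y - \<sigma> y') + (h y y0 - h y x0) - (h y' y0 - h y' x0)"
          by (simp add: \<sigma>_def \<tau>_def)
        also have "norm \<dots> \<le> norm (\<sigma> y - \<sigma> y') + norm (h y y0 - h y x0) + norm (h y' y0 - h y' x0)"
          using norm_add_diff_diff[where d = 0] by simp
        also have "\<dots> = norm (\<sigma> y - \<sigma> y') + 2 * E"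
          using dE[OF HG[OF h(1)]] y by simp
        finally show ?thesis using D(3) r by simp
      qed
      have rpos: "0 < r" using D(1) r by simp
      have inj: "inj_on \<sigma> (Tu u)"
      proof (rule inj_onI, rule ccontr)
        fix y y' assume "y \<in> Tu u" "y' \<in> Tu u" "\<sigma> y = \<sigma> y'" "y \<noteq> y'"
        then show False using sep'[of y y'] rpos by simp
      qed
      have "real (card (\<sigma> ` Tu u)) \<le> (4 * (2 * R) / (r / 2)) powr t"
      proof (rule card_separated_in_semigroup[OF add _ _ _ _ _ _ _ t countL])
        show "finite (\<sigma> ` Tu u)" using T(1) by (simp add: Tu_def)
        show "\<sigma> ` Tu u \<subseteq> \<Lambda>" using h(1) by (auto simp: \<sigma>_def \<Lambda>_def)
        show "norm v \<le> 2 * R" if "v \<in> \<sigma> ` Tu u" for v using that norm by auto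
        show "r / 2 \<le> norm (v - v')" if "v \<in> \<sigma> ` Tu u" "v' \<in> \<sigma> ` Tu u" "v \<noteq> v'" for v v'
          using that sep' by auto
      qed (use rpos r D(1) in auto)
      also have "4 * (2 * R) / (r / 2) = 16 * (R / r)" by simp
      also have "(16 * (R / r)) powr t = 16 powr t * (R / r) powr t"
        by (rule powr_mult)
      finally show ?thesis using card_image[OF inj] by simp
    qed
    have "T \<subseteq> (\<Union>u\<in>K. Tu u)"
    proof
      fix y assume y: "y \<in> T"
      then obtain f where f: "f \<in> G" "y = f y0" using T(2) by auto
      then obtain u s where us: "u \<in> K" "s \<in> G" "near_translation (1/8) s" "f = u \<circ> s" using K(3) by blast
      then have "s \<in> abelian_part" "y = u (s y0)" using near_translation_in_abelian_part f(2) by auto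
      then show "y \<in> (\<Union>u\<in>K. Tu u)" using us(1) y by (auto simp: Tu_def)
    qed
    moreover have "finite (\<Union>u\<in>K. Tu u)" using T(1) K(1) by (auto simp: Tu_def)
    ultimately have "card T \<le> card (\<Union>u\<in>K. Tu u)" by (intro card_mono)
    also have "\<dots> \<le> (\<Sum>u\<in>K. card (Tu u))" using K(1) by (rule card_UN_le)
    finally have "real (card T) \<le> (\<Sum>u\<in>K. real (card (Tu u)))" by (metis of_nat_le_iff of_nat_sum)
    also have "\<dots> \<le> (\<Sum>u\<in>K. 16 powr t * (R / r) powr t)" using cardTu by (rule sum_mono)
    also have "\<dots> = (real (card K) * 16 powr t) * (R / r) powr t" by simp
    also have "\<dots> \<le> D * (R / r) powr t" using D(2) by (intro mult_right_mono) auto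
    finally show "real (card T) \<le> D * (R / r) powr t" .
  qed
qed

end

section \<open>Groups with at least two limit points\<close>

lemma isometry_lin_part:
  fixes f :: "'a::real_inner \<Rightarrow> 'a"
  assumes "\<And>x y. dist (f x) (f y) = dist x y"
  shows "linear (lin_part f)" "f x - f y = lin_part f (x - y)"
proof -
  show lin: "linear (lin_part f)"
    by (rule isometry_linear) (auto simp: lin_part_def dist_norm assms[unfolded dist_norm])
  show "f x - f y = lin_part f (x - y)"
    using linear_diff[OF lin, of x y] by (simp add: lin_part_def)
qed

lemma isometry_unique:
  fixes f g :: "'a::real_inner \<Rightarrow> 'a"
  assumes f: "\<And>x y. dist (f x) (f y) = dist x y" and g: "\<And>x y. dist (g x) (g y) = dist x y"
    and U: "open U" "U \<noteq> {}" and eq: "\<And>x. x \<in> U \<Longrightarrow> f x = g x"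
  shows "f = g"
proof -
  obtain x0 where x0: "x0 \<in> U" using U(2) by blast
  obtain r where r: "0 < r" "ball x0 r \<subseteq> U" using U(1) x0 openE by blast
  have lin: "lin_part f v = lin_part g v" for v
  proof -
    define t where "t = r / (2 * (norm v + 1))"
    have p: "0 < norm v + 1" by (simp add: add_nonneg_pos)
    have t: "0 < t" using r(1) p by (simp add: t_def)
    have "t * norm v \<le> t * (norm v + 1)" using t by simp
    also have "\<dots> = r / 2"
    proof -
      have "r / (2 * m) * m = r / 2" if "0 < m" for m using that by simp
      then show ?thesis using p by (simp only: t_def)
    qed
    also have "\<dots> < r" using r(1) by simp
    finally have "norm (t *\<^sub>R v) < r" using t by simp
    then have "x0 + t *\<^sub>R v \<in> U" using r(2) by (auto simp: dist_norm)
    then have "f (x0 + t *\<^sub>R v) - f x0 = g (x0 + t *\<^sub>R v) - g x0" using eq x0 by simp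
    then have "lin_part f (t *\<^sub>R v) = lin_part g (t *\<^sub>R v)"
      using isometry_lin_part(2)[of f "x0 + t *\<^sub>R v" x0, OF f] isometry_lin_part(2)[of g "x0 + t *\<^sub>R v" x0, OF g]
      by simp
    then show ?thesis
      using t by (simp add: linear_scale[OF isometry_lin_part(1)[of f, OF f]]
          linear_scale[OF isometry_lin_part(1)[of g, OF g]])
  qed
  have "f x = g x" for x
    using isometry_lin_part(2)[of f x x0, OF f] isometry_lin_part(2)[of g x x0, OF g] lin eq[OF x0]
    by (metis diff_add_cancel)
  then show ?thesis by auto
qed

text \<open>By polarisation \<open>f\<close> preserves inner products based at \<open>x0\<close>, so
  it maps a small coordinate cross at \<open>x0\<close> to an orthogonal one. The linear isometry
  \<open>M\<close> read off from that cross reproduces \<open>f\<close>, since the difference vector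
  has inner product 0 with itself.\<close>

lemma isometry_extension:
  fixes f :: "'a::euclidean_space \<Rightarrow> 'a"
  assumes U: "open U" "U \<noteq> {}" and f: "\<And>x y. x \<in> U \<Longrightarrow> y \<in> U \<Longrightarrow> dist (f x) (f y) = dist x y"
  obtains \<phi> where "\<And>x y. dist (\<phi> x) (\<phi> y) = dist x y" "\<And>x. x \<in> U \<Longrightarrow> \<phi> x = f x"
proof -
  obtain x0 where x0: "x0 \<in> U" using U(2) by blast
  obtain r where r: "0 < r" "ball x0 r \<subseteq> U" using U(1) x0 openE by blast
  have polar: "(f x - f x0) \<bullet> (f y - f x0) = (x - x0) \<bullet> (y - x0)" if "x \<in> U" "y \<in> U" for x y
  proof -
    have "norm (f x - f x0) = norm (x - x0)" "norm (f y - f x0) = norm (y - x0)"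
      "norm ((f x - f x0) - (f y - f x0)) = norm ((x - x0) - (y - x0))"
      using f[OF that(1) x0] f[OF that(2) x0] f[OF that] by (auto simp: dist_norm)
    then show ?thesis unfolding dot_norm_neg by simp
  qed
  define pt where "pt b = x0 + (r/2) *\<^sub>R b" for b
  have pt: "pt b \<in> U" if "b \<in> Basis" for b
    using r that by (auto simp: pt_def dist_norm)
  define e where "e b = (2/r) *\<^sub>R (f (pt b) - f x0)" for b
  have fe: "(f x - f x0) \<bullet> e b = (x - x0) \<bullet> b" if "x \<in> U" "b \<in> Basis" for x b
  proof -
    have "(f x - f x0) \<bullet> (f (pt b) - f x0) = (r/2) * ((x - x0) \<bullet> b)"
      using polar[OF that(1) pt[OF that(2)]] by (simp add: pt_def)
    then have "(2/r) * ((f x - f x0) \<bullet> (f (pt b) - f x0)) = (2/r) * ((r/2) * ((x - x0) \<bullet> b))"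
      by (rule arg_cong)
    also have "\<dots> = (x - x0) \<bullet> b" using r(1) by simp
    finally show ?thesis unfolding e_def inner_scaleR_right .
  qed
  have ee: "e b \<bullet> e b' = (if b = b' then 1 else 0)" if "b \<in> Basis" "b' \<in> Basis" for b b'
  proof -
    have "(f (pt b) - f x0) \<bullet> e b' = (r/2) * (if b = b' then 1 else 0)"
      using fe[OF pt[OF that(1)] that(2)] that by (simp add: pt_def inner_Basis)
    then show ?thesis using r(1) by (auto simp: e_def[of b])
  qed
  define M where "M v = (\<Sum>b\<in>Basis. (v \<bullet> b) *\<^sub>R e b)" for v
  have M: "M v \<bullet> M v = v \<bullet> v" for v
  proof -
    have "M v \<bullet> M v = (\<Sum>b\<in>Basis. (v \<bullet> b) * (v \<bullet> b))"
      unfolding M_def by (simp add: inner_sum_left inner_sum_right ee if_distrib sum.delta cong: if_cong sum.cong)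
    also have "\<dots> = v \<bullet> v" by (rule euclidean_inner[symmetric])
    finally show ?thesis .
  qed
  have Mdiff: "M v - M w = M (v - w)" for v w
    by (simp add: M_def inner_diff_left scaleR_diff_left sum_subtractf)
  define \<phi> where "\<phi> x = f x0 + M (x - x0)" for x
  show ?thesis
  proof (rule that[of \<phi>])
    fix x y
    have "\<phi> x - \<phi> y = M (x - y)" using Mdiff[of "x - x0" "y - x0"] by (simp add: \<phi>_def)
    then show "dist (\<phi> x) (\<phi> y) = dist x y" using M[of "x - y"] by (simp add: dist_norm norm_eq_sqrt_inner)
  next
    fix x assume x: "x \<in> U"
    have "(f x - f x0) \<bullet> M (x - x0) = (x - x0) \<bullet> (x - x0)"
      unfolding M_def inner_sum_right by (simp add: fe[OF x] euclidean_inner[of "x - x0" "x - x0"])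
    moreover have "(f x - f x0 - M (x - x0)) \<bullet> (f x - f x0 - M (x - x0))
      = (f x - f x0) \<bullet> (f x - f x0) - 2 * ((f x - f x0) \<bullet> M (x - x0)) + M (x - x0) \<bullet> M (x - x0)"
      by (simp add: inner_simps inner_commute algebra_simps)
    ultimately have "(f x - f x0 - M (x - x0)) \<bullet> (f x - f x0 - M (x - x0)) = 0"
      using polar[OF x x] M[of "x - x0"] by simp
    then have "f x - f x0 - M (x - x0) = 0" by (simp only: inner_eq_zero_iff)
    then show "\<phi> x = f x" by (simp add: \<phi>_def algebra_simps)
  qed
qed

section \<open>Half space coordinates at a boundary point\<close>

definition poisson :: "'a::real_inner \<Rightarrow> 'a \<Rightarrow> real" where
  "poisson p x = depth x / (norm (x - p))\<^sup>2"

text \<open>\<open>horo p\<close> maps the unit ball onto a half space, with \<open>p\<close> going to infinity.\<close>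

definition horo :: "'a::real_inner \<Rightarrow> 'a \<Rightarrow> 'a" where
  "horo p x = (1 / (norm (x - p))\<^sup>2) *\<^sub>R (x - p)"

definition horo_inv :: "'a::real_inner \<Rightarrow> 'a \<Rightarrow> 'a" where
  "horo_inv p y = p + (1 / (norm y)\<^sup>2) *\<^sub>R y"

lemma norm_horo: "norm (horo p x) = 1 / norm (x - p)"
  by (simp add: horo_def power2_eq_square)

lemma norm_horo_diff:
  assumes "x \<noteq> p" "y \<noteq> p"
  shows "norm (horo p x - horo p y) = norm (x - y) / (norm (x - p) * norm (y - p))"
proof -
  define u v where "u = x - p" and "v = y - p"
  have uv: "u \<bullet> u \<noteq> 0" "v \<bullet> v \<noteq> 0" using assms by (auto simp: u_def v_def)
  have "(norm (horo p x - horo p y))\<^sup>2 = (norm ((1 / (u \<bullet> u)) *\<^sub>R u - (1 / (v \<bullet> v)) *\<^sub>R v))\<^sup>2"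
    by (simp add: horo_def u_def v_def power2_norm_eq_inner)
  also have "\<dots> = ((u - v) \<bullet> (u - v)) / ((u \<bullet> u) * (v \<bullet> v))"
    unfolding power2_norm_eq_inner inner_diff_left inner_diff_right inner_scaleR_left inner_scaleR_right
    using uv by (simp add: field_simps power2_eq_square inner_commute)
  also have "\<dots> = (norm (x - y) / (norm (x - p) * norm (y - p)))\<^sup>2"
    by (simp add: u_def v_def power_divide power_mult_distrib power2_norm_eq_inner)
  finally show ?thesis by (simp add: power2_eq_iff_nonneg)
qed

text \<open>In these coordinates \<open>poisson p\<close> is twice the height above the bounding
  plane, and its level sets are the horospheres at \<open>p\<close>. A map that preserves both
  \<open>hyp_quot\<close> and \<open>poisson p\<close> therefore becomes a Euclidean
  isometry.\<close>

lemma hyp_quot_poisson: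
  assumes "norm x < 1" "norm y < 1" "norm p = 1"
  shows "(norm (horo p x - horo p y))\<^sup>2 = hyp_quot x y * poisson p x * poisson p y"
proof -
  have n: "x \<noteq> p" "y \<noteq> p" using assms by auto
  show ?thesis
    unfolding norm_horo_diff[OF n] hyp_quot_def poisson_def
    using depth_pos[OF assms(1)] depth_pos[OF assms(2)] by (simp add: power_divide power_mult_distrib)
qed

lemma horo_horo_inv: "y \<noteq> 0 \<Longrightarrow> horo p (horo_inv p y) = y"
  by (simp add: horo_def horo_inv_def power2_eq_square)

lemma horo_inv_horo: "x \<noteq> p \<Longrightarrow> horo_inv p (horo p x) = x"
  by (simp add: horo_def horo_inv_def power2_eq_square)

lemma horo_in_half_space:
  assumes "norm p = 1" "norm x < 1"
  shows "p \<bullet> horo p x < - 1/2"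
proof -
  have n: "x \<noteq> p" using assms by auto
  define u where "u = x - p"
  have u: "0 < u \<bullet> u" using n by (simp add: u_def)
  have "x \<bullet> x < 1" using assms(2) by (simp add: dot_square_norm abs_square_less_1)
  moreover have "x \<bullet> x = 1 + 2 * (p \<bullet> u) + u \<bullet> u"
  proof -
    have "x = p + u" by (simp add: u_def)
    moreover have "p \<bullet> p = 1" using assms(1) by (simp add: dot_square_norm)
    ultimately show ?thesis by (simp add: inner_simps inner_commute)
  qed
  ultimately have "p \<bullet> u / (u \<bullet> u) < - 1/2" using u by (simp add: divide_less_eq)
  then show ?thesis by (simp add: horo_def u_def power2_norm_eq_inner)
qed

lemma norm_horo_inv:
  assumes "norm p = 1" "p \<bullet> y < - 1/2"
  shows "norm (horo_inv p y) < 1"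
proof -
  have y: "y \<noteq> 0" using assms(2) by auto
  then have yy: "0 < y \<bullet> y" by simp
  have "horo_inv p y \<bullet> horo_inv p y = 1 + 2 * (p \<bullet> y) / (y \<bullet> y) + 1 / (y \<bullet> y)"
  proof -
    have "p \<bullet> p = 1" using assms(1) by (simp add: dot_square_norm)
    then show ?thesis
      unfolding horo_inv_def power2_norm_eq_inner inner_add_left inner_add_right inner_scaleR_left inner_scaleR_right
      using yy by (simp add: field_simps inner_commute power2_eq_square)
  qed
  also have "\<dots> = 1 + (2 * (p \<bullet> y) + 1) / (y \<bullet> y)" by (simp add: add_divide_distrib)
  also have "\<dots> < 1" using assms(2) yy by (simp add: divide_less_0_iff)
  finally show ?thesis by (simp add: dot_square_norm abs_square_less_1)
qed

text \<open>A separated set of largest cardinality, which exists because of the bound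
  \<open>N\<close>, is a \<delta>-net; its balls have diameter at most
  \<open>2 * \<delta>\<close>.\<close>

lemma exists_maximal_separated_cover:
  fixes W :: "'a::euclidean_space set"
  assumes d: "0 < \<delta>"
    and N: "\<And>Z. finite Z \<Longrightarrow> Z \<subseteq> W \<Longrightarrow> (\<And>z z'. z \<in> Z \<Longrightarrow> z' \<in> Z \<Longrightarrow> z \<noteq> z' \<Longrightarrow> \<delta> \<le> norm (z - z')) \<Longrightarrow> real (card Z) \<le> N"
  shows "\<exists>\<U>. scale_cover (2 * \<delta>) W \<U> \<and> real (card \<U>) \<le> N"
proof -
  define P where "P Z \<longleftrightarrow> finite Z \<and> Z \<subseteq> W \<and> (\<forall>z\<in>Z. \<forall>z'\<in>Z. z \<noteq> z' \<longrightarrow> \<delta> \<le> norm (z - z'))" for Z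
  have PN: "real (card Z) \<le> N" if "P Z" for Z using that N[of Z] by (auto simp: P_def)
  have "\<forall>Z. P Z \<longrightarrow> card Z \<le> nat \<lceil>N\<rceil>"
  proof clarify
    fix Z assume "P Z"
    then have "real (card Z) \<le> N" by (rule PN)
    then show "card Z \<le> nat \<lceil>N\<rceil>" by linarith
  qed
  moreover have "P {}" by (simp add: P_def)
  ultimately obtain Z where Z: "P Z" "\<And>Z'. P Z' \<Longrightarrow> card Z' \<le> card Z"
    using ex_has_greatest_nat[of P "{}" card "nat \<lceil>N\<rceil> + 1"] by (auto simp: less_Suc_eq_le)
  have Zf: "finite Z" using Z(1) by (simp add: P_def)
  define \<U> where "\<U> = (\<lambda>z. ball z \<delta>) ` Z"
  have "w \<in> \<Union>\<U>" if w: "w \<in> W" for w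
  proof (rule ccontr)
    assume n: "w \<notin> \<Union>\<U>"
    then have far: "\<delta> \<le> norm (z - w)" if "z \<in> Z" for z
      using that by (auto simp: \<U>_def dist_norm not_less)
    then have "w \<notin> Z" using d by force
    moreover have "P (insert w Z)"
      using Z(1) w far by (auto simp: P_def norm_minus_commute)
    ultimately show False using Z(2)[of "insert w Z"] Zf by simp
  qed
  then have "scale_cover (2 * \<delta>) W \<U>"
    using Zf d by (auto simp: scale_cover_def \<U>_def)
  moreover have "real (card \<U>) \<le> N"
    using card_image_le[OF Zf, of "\<lambda>z. ball z \<delta>"] PN[OF Z(1)] by (simp add: \<U>_def)
  ultimately show ?thesis by blast
qed

section \<open>Orbit points close to a limit set with two points\<close>

context kleinian_group
begin

text \<open>Used with \<open>g\<close> fixed and \<open>w\<close> tending to the sphere: the image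
  tends to the sphere too. Away from 0, \<open>hyp_quot 0 w\<close> is at least
  \<open>1 / (4 * depth w)\<close>, while at the image points it is at most 4 divided by the product
  of the depths; this gives the factor 16.\<close>

lemma depth_image_le:
  assumes "g \<in> \<Gamma>" "norm w < 1" "1/2 \<le> norm w"
  shows "depth (g w) \<le> 16 * depth w / depth (g 0)"
proof -
  have n: "norm (g w) < 1" "norm (g 0) < 1" using assms norm_image_less_1 by auto
  have q: "hyp_quot (g w) (g 0) = (norm w)\<^sup>2 / depth w"
    using hyp_quot_image[OF assms(1,2), of 0] by (simp add: hyp_quot_0 hyp_quot_commute[of w])
  have "(1/2)\<^sup>2 \<le> (norm w)\<^sup>2" using assms(3) by (intro power_mono) auto
  then have "1/4 \<le> (norm w)\<^sup>2" by (simp add: power2_eq_square)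
  then have "1/4 / depth w \<le> hyp_quot (g w) (g 0)"
    unfolding q using assms by (intro divide_right_mono) (auto intro: less_imp_le)
  then have "1/4 / depth w * (depth (g w) * depth (g 0)) \<le> hyp_quot (g w) (g 0) * (depth (g w) * depth (g 0))"
    using assms by (intro mult_right_mono) (auto intro!: mult_nonneg_nonneg less_imp_le)
  also have "\<dots> = (norm (g w - g 0))\<^sup>2" using norm_diff_sq_eq[OF n] by (simp add: mult.assoc)
  also have "\<dots> \<le> 2\<^sup>2"
    using norm_triangle_ineq4[of "g w" "g 0"] n by (intro power_mono) auto
  finally show ?thesis
    using assms depth_pos[OF assms(2)] depth_image_pos[OF assms(1), of 0] by (simp add: field_simps)
qed

text \<open>Orbit points near \<open>\<xi>\<close> and \<open>\<eta>\<close> are seen from \<open>0\<close> under a large angle. By invariance of the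
  cross ratio their images under \<open>g\<close> are seen from \<open>g 0\<close> under a large angle, so one of them is close
  to \<open>g 0\<close>.\<close>

lemma orbit_near_limit_set:
  assumes xi: "\<xi> \<in> limit_set \<Gamma>" and eta: "\<eta> \<in> limit_set \<Gamma>" and ne: "\<xi> \<noteq> \<eta>"
  obtains K where "0 < K" "\<And>g. g \<in> \<Gamma> \<Longrightarrow> \<exists>\<zeta>\<in>limit_set \<Gamma>. norm (g 0 - \<zeta>) \<le> K * depth (g 0)"
proof -
  define c where "c = norm (\<xi> - \<eta>) / 2"
  have c: "0 < c" using ne by (simp add: c_def)
  show ?thesis
  proof (rule that[of "2 / c"])
    show "0 < 2 / c" using c by simp
    fix g assume g: "g \<in> \<Gamma>"
    define z where "z = g 0"
    define \<alpha> where "\<alpha> = depth z"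
    have a: "0 < \<alpha>" using g by (simp add: \<alpha>_def z_def)
    have nz: "norm z < 1" using g by (simp add: z_def)
    have "\<exists>h\<in>\<Gamma>. h 0 \<in> cball z (2 / c * \<alpha>) \<and> depth (h 0) < e" if e: "0 < e" for e
    proof -
      \<comment> \<open>The first entry keeps \<open>u 0\<close> and \<open>v 0\<close> at least
        \<open>c\<close> apart, as \<xi> and \<eta> have distance \<open>2 * c\<close>. The second
        keeps their norms above 1/2 for \<open>depth_image_le\<close>, and the third makes the depth
        of their images at most \<open>e / 2\<close>.\<close>
      define d where "d = min (c / 2) (min (1/2) (e * \<alpha> / 64))"
      have d: "0 < d" "d \<le> c / 2" "d \<le> 1/2" "d \<le> e * \<alpha> / 64" using c e a by (auto simp: d_def)
      obtain u where u: "u \<in> \<Gamma>" "norm (u 0 - \<xi>) < d" using xi d(1) unfolding limit_set_iff by blast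
      obtain v where v: "v \<in> \<Gamma>" "norm (v 0 - \<eta>) < d" using eta d(1) unfolding limit_set_iff by blast
      have small: "\<exists>h\<in>\<Gamma>. h 0 = g (w 0) \<and> depth (h 0) < e"
        if w: "w \<in> \<Gamma>" "norm (w 0 - \<zeta>) < d" "\<zeta> \<in> limit_set \<Gamma>" for w \<zeta>
      proof -
        obtain h where h: "h \<in> \<Gamma>" "\<And>x. norm x < 1 \<Longrightarrow> h x = g (w x)" using exists_comp[OF g w(1)] by metis
        have n1: "norm \<zeta> = 1" using norm_limit_set[OF w(3)] .
        have "1/2 \<le> norm (w 0)"
          using norm_triangle_ineq2[of \<zeta> "w 0"] n1 w(2) d(3) by (simp add: norm_minus_commute)
        then have "depth (g (w 0)) \<le> 16 * depth (w 0) / \<alpha>"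
          using depth_image_le[OF g, of "w 0"] w(1) by (simp add: \<alpha>_def z_def)
        also have "depth (w 0) \<le> 2 * norm (w 0 - \<zeta>)" using depth_le_dist_sphere[OF n1, of "w 0"] w(1) by simp
        then have "16 * depth (w 0) / \<alpha> \<le> 16 * (2 * (e * \<alpha> / 64)) / \<alpha>"
          using w(2) d(4) a by (intro divide_right_mono mult_left_mono order_trans[OF \<open>depth (w 0) \<le> 2 * norm (w 0 - \<zeta>)\<close>]) auto
        also have "\<dots> = e / 2" using a by simp
        also have "\<dots> < e" using e by simp
        finally show ?thesis using h by (intro bexI[of _ h]) auto
      qed
      define a b where "a = u 0" and "b = v 0"
      have n: "norm a < 1" "norm b < 1" using u v by (auto simp: a_def b_def)
      have ab: "c \<le> norm (a - b)"
      proof -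
        have "norm (\<xi> - \<eta>) \<le> norm (\<xi> - a) + norm (a - b) + norm (b - \<eta>)"
          using norm_triangle_ineq[of "\<xi> - a" "a - b"] norm_triangle_ineq[of "\<xi> - b" "b - \<eta>"]
          by simp
        then show ?thesis using u(2) v(2) d(2) by (simp add: a_def b_def c_def norm_minus_commute)
      qed
      define a' b' where "a' = g a" and "b' = g b"
      have n': "norm a' < 1" "norm b' < 1" using n g norm_image_less_1 by (auto simp: a'_def b'_def)
      have pos: "0 < depth a" "0 < depth b" "0 < depth a'" "0 < depth b'" using n n' by auto
      have "c\<^sup>2 * (hyp_quot 0 a * hyp_quot 0 b) \<le> hyp_quot a b"
      proof -
        have "c\<^sup>2 * (hyp_quot 0 a * hyp_quot 0 b) = c\<^sup>2 * ((norm a)\<^sup>2 * (norm b)\<^sup>2) / (depth a * depth b)"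
          by (simp add: hyp_quot_0)
        also have "\<dots> \<le> (norm (a - b))\<^sup>2 * 1 / (depth a * depth b)"
          using ab c n pos
          by (intro divide_right_mono mult_mono power_mono mult_le_one power_le_one mult_nonneg_nonneg)
             (auto intro: less_imp_le)
        finally show ?thesis by (simp add: hyp_quot_def)
      qed
      also have "hyp_quot a b = hyp_quot a' b'" using hyp_quot_image[OF g n] by (simp add: a'_def b'_def)
      also have "hyp_quot 0 a = hyp_quot z a'" using hyp_quot_image[OF g _ n(1), of 0] by (simp add: a'_def z_def)
      also have "hyp_quot 0 b = hyp_quot z b'" using hyp_quot_image[OF g _ n(2), of 0] by (simp add: b'_def z_def)
      finally have "c\<^sup>2 * ((norm (z - a'))\<^sup>2 / (\<alpha> * depth a') * ((norm (z - b'))\<^sup>2 / (\<alpha> * depth b')))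
          \<le> (norm (a' - b'))\<^sup>2 / (depth a' * depth b')"
        by (simp add: hyp_quot_def \<alpha>_def)
      then have "(c * (norm (z - a') * norm (z - b')))\<^sup>2 \<le> (norm (a' - b') * \<alpha>)\<^sup>2"
        using pos a by (simp add: field_simps power2_eq_square)
      then have prod: "c * (norm (z - a') * norm (z - b')) \<le> norm (a' - b') * \<alpha>"
        using a by (simp add: power2_le_iff_abs_le abs_le_square_iff[symmetric] c less_imp_le)
      have tri: "norm (a' - b') \<le> norm (z - a') + norm (z - b')"
        using norm_triangle_ineq4[of "z - b'" "z - a'"] by simp
      have "norm (z - a') \<le> 2 / c * \<alpha> \<or> norm (z - b') \<le> 2 / c * \<alpha>"
      proof (rule ccontr)
        assume "\<not> ?thesis"
        then have big: "2 * \<alpha> < c * norm (z - a')" "2 * \<alpha> < c * norm (z - b')"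
          using c by (auto simp: not_le divide_less_eq mult.commute)
        define s t where "s = norm (z - a')" and "t = norm (z - b')"
        have st: "0 < s" "0 < t"
          using big a c by (auto simp: s_def t_def intro: ccontr)
        have "c * (s * t) \<le> (s + t) * \<alpha>"
          using order_trans[OF prod mult_right_mono[OF tri less_imp_le[OF a]]] by (simp only: s_def t_def)
        moreover have "2 * \<alpha> * t < c * s * t" "2 * \<alpha> * s < c * t * s"
          using big st by (simp_all add: s_def t_def)
        ultimately show False by (simp add: algebra_simps)
      qed
      then show ?thesis
        using small[OF u xi] small[OF v eta] unfolding a'_def b'_def a_def b_def mem_cball dist_norm
        by metis
    qed
    then obtain \<zeta> where "\<zeta> \<in> limit_set \<Gamma>" "\<zeta> \<in> cball z (2 / c * \<alpha>)"
      using limit_set_meets_closed[OF closed_cball] by metis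
    then show "\<exists>\<zeta>\<in>limit_set \<Gamma>. norm (g 0 - \<zeta>) \<le> 2 / c * depth (g 0)"
      by (auto simp: dist_norm z_def \<alpha>_def)
  qed
qed

end

section \<open>Groups with a single limit point\<close>

text \<open>Both quotients blow up as \<open>a n\<close> tends to the sphere, but the depth of
  \<open>a n\<close> cancels in their ratio. The limit is the exponential of a Busemann
  function.\<close>

lemma tendsto_hyp_quot_ratio:
  fixes p :: "'a::real_inner"
  assumes p: "norm p = 1" and x: "norm x < 1" and y: "norm y < 1"
    and a: "a \<longlonglongrightarrow> p" "\<And>n. norm (a n) < 1"
  shows "(\<lambda>n::nat. hyp_quot x (a n) / hyp_quot y (a n)) \<longlonglongrightarrow> poisson p y / poisson p x"
proof -
  have n: "x \<noteq> p" "y \<noteq> p" using p x y by auto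
  have pos: "depth x \<noteq> 0" "depth y \<noteq> 0" using depth_pos[OF x] depth_pos[OF y] by auto
  have "hyp_quot x (a n) / hyp_quot y (a n) = ((norm (x - a n))\<^sup>2 * depth y) / ((norm (y - a n))\<^sup>2 * depth x)" for n
    using depth_pos[OF a(2)[of n]] pos by (simp add: hyp_quot_def)
  moreover have "(\<lambda>n. ((norm (x - a n))\<^sup>2 * depth y) / ((norm (y - a n))\<^sup>2 * depth x))
      \<longlonglongrightarrow> ((norm (x - p))\<^sup>2 * depth y) / ((norm (y - p))\<^sup>2 * depth x)"
    using n pos by (intro tendsto_intros a(1)) auto
  moreover have "((norm (x - p))\<^sup>2 * depth y) / ((norm (y - p))\<^sup>2 * depth x) = poisson p y / poisson p x"
    by (simp add: poisson_def)
  ultimately show ?thesis by simp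
qed

locale parabolic_kleinian_group = kleinian_group +
  fixes p :: "real ^ 'n"
  assumes limit_set_singleton: "limit_set \<Gamma> = {p}"
begin

lemma norm_p: "norm p = 1"
  using norm_limit_set limit_set_singleton by blast

lemma ne_p: "norm x < 1 \<Longrightarrow> x \<noteq> p"
  using norm_p by auto

lemma poisson_pos: "norm x < 1 \<Longrightarrow> 0 < poisson p x"
  using ne_p by (simp add: poisson_def)

lemma poisson_0: "poisson p 0 = 1"
  by (simp add: poisson_def depth_def norm_p)

text \<open>Otherwise a limit point would lie outside \<open>ball p e\<close>.\<close>

lemma orbit_near_p:
  assumes e: "0 < e"
  obtains \<eta> where "0 < \<eta>" "\<And>g. g \<in> \<Gamma> \<Longrightarrow> depth (g 0) < \<eta> \<Longrightarrow> norm (g 0 - p) < e"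
proof -
  have "\<exists>\<eta>>0. \<forall>g\<in>\<Gamma>. depth (g 0) < \<eta> \<longrightarrow> norm (g 0 - p) < e"
  proof (rule ccontr)
    assume "\<not> ?thesis"
    then have "\<exists>g\<in>\<Gamma>. g 0 \<in> - ball p e \<and> depth (g 0) < \<eta>" if "0 < \<eta>" for \<eta>
      using that by (fastforce simp: dist_norm norm_minus_commute)
    then obtain \<zeta> where "\<zeta> \<in> limit_set \<Gamma>" "\<zeta> \<in> - ball p e"
      using limit_set_meets_closed[of "- ball p e"] by (metis closed_Compl open_ball)
    then show False using limit_set_singleton e by auto
  qed
  then show ?thesis using that by blast
qed

text \<open>The ratio limit is transported by \<open>g\<close>. This needs the preimages
  \<open>b n\<close> of a sequence of orbit points tending to \<open>p\<close> to tend to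
  \<open>p\<close> as well: they are orbit points whose depth tends to 0, and \<open>p\<close> is
  the only limit point.\<close>

lemma poisson_image:
  assumes g: "g \<in> \<Gamma>" and x: "norm x < 1"
  shows "poisson p (g x) = poisson p x * poisson p (g 0)"
proof -
  have "\<exists>u\<in>\<Gamma>. norm (u 0 - p) < 1 / real (Suc n)" for n
    using limit_set_singleton limit_set_iff[of p] by auto
  then obtain u where u: "\<And>n. u n \<in> \<Gamma>" "\<And>n. norm (u n 0 - p) < 1 / real (Suc n)" by metis
  define a where "a n = u n 0" for n
  have na: "norm (a n) < 1" for n using u(1) by (simp add: a_def)
  have lim0: "(\<lambda>n. 1 / real (Suc n)) \<longlonglongrightarrow> 0" using LIMSEQ_inverse_real_of_nat by (simp add: inverse_eq_divide)
  have a: "a \<longlonglongrightarrow> p"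
    unfolding LIM_zero_iff[symmetric, of a p]
    by (rule Lim_null_comparison[OF _ lim0]) (use u(2) in \<open>auto simp: a_def intro!: always_eventually less_imp_le\<close>)
  obtain k where k: "k \<in> \<Gamma>" "\<And>x. norm x < 1 \<Longrightarrow> g (k x) = x"
    using exists_inverse[OF g] by metis
  define b where "b n = k (a n)" for n
  have nb: "norm (b n) < 1" for n using norm_image_less_1[OF k(1) na] by (simp add: b_def)
  have gb: "g (b n) = a n" for n using k(2)[OF na] by (simp add: b_def)
  have b_orbit: "\<exists>h\<in>\<Gamma>. b n = h 0" for n
    using exists_comp[OF k(1) u(1)[of n]] by (metis a_def b_def norm_zero zero_less_one)
  have "b \<longlonglongrightarrow> p"
  proof (rule LIMSEQ_I)
    fix e :: real assume "0 < e"
    then obtain \<eta> where eta: "0 < \<eta>" "\<And>g. g \<in> \<Gamma> \<Longrightarrow> depth (g 0) < \<eta> \<Longrightarrow> norm (g 0 - p) < e"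
      by (rule orbit_near_p) blast
    have "(\<lambda>n. depth (a n)) \<longlonglongrightarrow> depth p" unfolding depth_def by (intro tendsto_intros a)
    then have "(\<lambda>n. 16 * depth (a n) / depth (k 0)) \<longlonglongrightarrow> 16 * depth p / depth (k 0)"
      using depth_image_pos[OF k(1), of 0] by (intro tendsto_intros) auto
    then have "(\<lambda>n. 16 * depth (a n) / depth (k 0)) \<longlonglongrightarrow> 0" by (simp add: depth_def norm_p)
    then have ev1: "eventually (\<lambda>n. 16 * depth (a n) / depth (k 0) < \<eta>) sequentially"
      using eta(1) by (rule order_tendstoD(2))
    have "(\<lambda>n. norm (a n)) \<longlonglongrightarrow> norm p" by (intro tendsto_intros a)
    then have ev2: "eventually (\<lambda>n. 1/2 < norm (a n)) sequentially"
      by (rule order_tendstoD(1)) (simp add: norm_p)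
    have "eventually (\<lambda>n. norm (b n - p) < e) sequentially"
      using ev1 ev2
    proof eventually_elim
      case (elim n)
      have "depth (b n) \<le> 16 * depth (a n) / depth (k 0)"
        using depth_image_le[OF k(1) na, of n] elim(2) by (simp add: b_def)
      then have "depth (b n) < \<eta>" using elim(1) by simp
      then show ?case using eta(2) b_orbit[of n] by auto
    qed
    then show "\<exists>no. \<forall>n\<ge>no. norm (b n - p) < e" by (simp add: eventually_sequentially)
  qed
  from tendsto_hyp_quot_ratio[OF norm_p x _ this nb, of 0]
  have l1: "(\<lambda>n. hyp_quot x (b n) / hyp_quot 0 (b n)) \<longlonglongrightarrow> 1 / poisson p x"
    by (simp add: poisson_0)
  have gx: "norm (g x) < 1" "norm (g 0) < 1" using norm_image_less_1[OF g] x by auto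
  have l2: "(\<lambda>n. hyp_quot (g x) (a n) / hyp_quot (g 0) (a n)) \<longlonglongrightarrow> poisson p (g 0) / poisson p (g x)"
    by (rule tendsto_hyp_quot_ratio[OF norm_p gx a na])
  have "hyp_quot (g x) (a n) / hyp_quot (g 0) (a n) = hyp_quot x (b n) / hyp_quot 0 (b n)" for n
    using hyp_quot_image[OF g x nb] hyp_quot_image[OF g _ nb, of 0] by (simp add: gb)
  then have "poisson p (g 0) / poisson p (g x) = 1 / poisson p x"
    using LIMSEQ_unique[OF l1] l2 by simp
  then show ?thesis
    using poisson_pos[OF x] poisson_pos[OF gx(1)] by (simp add: field_simps)
qed

text \<open>If \<open>g\<close> moved horospheres, then in half space coordinates it would be a contracting similarity,
  and the forward orbit of \<open>0\<close> would stay away from \<open>p\<close> while approaching the sphere.\<close>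

lemma poisson_orbit_not_less_1:
  assumes g: "g \<in> \<Gamma>"
  shows "\<not> poisson p (g 0) < 1"
proof
  define \<mu> where "\<mu> = poisson p (g 0)"
  assume "poisson p (g 0) < 1"
  then have chi: "0 < \<mu>" "\<mu> < 1" using poisson_pos[of "g 0"] g by (auto simp: \<mu>_def)
  define z where "z k = (g ^^ k) 0" for k
  have nz: "norm (z k) < 1" for k
    by (induction k) (use norm_image_less_1[OF g] in \<open>auto simp: z_def\<close>)
  have orbit: "\<exists>u\<in>\<Gamma>. u 0 = z k" for k
  proof (induction k)
    case 0
    show ?case using exists_identity by (metis funpow_0 norm_zero z_def zero_less_one)
  next
    case (Suc k)
    then obtain u where u: "u \<in> \<Gamma>" "u 0 = z k" by blast
    obtain v where "v \<in> \<Gamma>" "\<And>x. norm x < 1 \<Longrightarrow> v x = g (u x)" using exists_comp[OF g u(1)] by metis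
    then show ?case using u(2) by (intro bexI[of _ v]) (auto simp: z_def)
  qed
  have pz: "poisson p (z k) = \<mu> ^ k" for k
  proof (induction k)
    case (Suc k)
    have "z (Suc k) = g (z k)" by (simp add: z_def)
    then show ?case using poisson_image[OF g nz[of k]] Suc by (simp add: \<mu>_def)
  qed (simp add: z_def poisson_0)
  define q where "q = hyp_quot (z 1) (z 0)"
  have q0: "0 \<le> q" unfolding q_def by (rule hyp_quot_nonneg[OF nz nz])
  have qz: "hyp_quot (z (Suc k)) (z k) = q" for k
  proof (induction k)
    case (Suc k)
    have "z (Suc j) = g (z j)" for j by (simp add: z_def)
    then show ?case using hyp_quot_image[OF g nz[of "Suc k"] nz[of k]] Suc by metis
  qed (simp add: q_def)
  have step: "norm (horo p (z (Suc k)) - horo p (z k)) \<le> sqrt q * \<mu> ^ k" for k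
  proof -
    have "(norm (horo p (z (Suc k)) - horo p (z k)))\<^sup>2 = q * (\<mu> ^ Suc k * \<mu> ^ k)"
      using hyp_quot_poisson[OF nz nz norm_p, of "Suc k" k] by (simp only: qz pz mult.assoc)
    also have "\<dots> \<le> q * (\<mu> ^ k * \<mu> ^ k)"
      using q0 chi by (intro mult_left_mono mult_right_mono power_decreasing) auto
    also have "\<dots> = (sqrt q * \<mu> ^ k)\<^sup>2" using q0 by (simp add: power2_eq_square)
    finally show ?thesis using q0 chi by (simp add: power2_le_iff_abs_le)
  qed
  have bound: "norm (horo p (z k)) \<le> 1 + sqrt q / (1 - \<mu>)" for k
  proof -
    have "norm (horo p (z k)) \<le> 1 + sqrt q * (1 - \<mu> ^ k) / (1 - \<mu>)"
    proof (induction k)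
      case 0
      show ?case by (simp add: z_def norm_horo norm_p)
    next
      case (Suc k)
      have "norm (horo p (z (Suc k))) \<le> norm (horo p (z (Suc k)) - horo p (z k)) + norm (horo p (z k))"
        using norm_triangle_ineq[of "horo p (z (Suc k)) - horo p (z k)" "horo p (z k)"] by simp
      also have "\<dots> \<le> sqrt q * \<mu> ^ k + (1 + sqrt q * (1 - \<mu> ^ k) / (1 - \<mu>))"
        using step Suc by (intro add_mono)
      also have "\<dots> = 1 + sqrt q * (1 - \<mu> ^ Suc k) / (1 - \<mu>)"
        using chi by (simp add: field_simps)
      finally show ?case .
    qed
    also have "\<dots> \<le> 1 + sqrt q * 1 / (1 - \<mu>)"
      using chi q0 by (intro add_left_mono divide_right_mono mult_left_mono) auto
    finally show ?thesis by simp
  qed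
  define B where "B = 1 + sqrt q / (1 - \<mu>)"
  have B: "0 < B" using chi q0 by (simp add: B_def add_pos_nonneg)
  have far: "1 / B \<le> norm (z k - p)" for k
  proof -
    have "0 < norm (z k - p)" using ne_p[OF nz] by simp
    moreover have "1 / norm (z k - p) \<le> B" using bound[of k] by (simp add: norm_horo B_def)
    ultimately show ?thesis using B by (simp add: field_simps)
  qed
  obtain \<eta> where eta: "0 < \<eta>" "\<And>g. g \<in> \<Gamma> \<Longrightarrow> depth (g 0) < \<eta> \<Longrightarrow> norm (g 0 - p) < 1 / B"
    using orbit_near_p[of "1 / B"] B by (metis zero_less_divide_1_iff)
  obtain k where k: "\<mu> ^ k < \<eta> / 4" using real_arch_pow_inv[of "\<eta> / 4" \<mu>] eta(1) chi by auto
  have "depth (z k) = \<mu> ^ k * (norm (z k - p))\<^sup>2"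
    using pz[of k] ne_p[OF nz[of k]] by (simp add: poisson_def field_simps)
  also have "\<dots> \<le> \<mu> ^ k * 2\<^sup>2"
    using norm_triangle_ineq4[of "z k" p] nz[of k] norm_p chi by (intro mult_left_mono power_mono) auto
  also have "\<dots> < \<eta>" using k by simp
  finally have "norm (z k - p) < 1 / B" using eta(2) orbit[of k] by metis
  then show False using far[of k] by simp
qed

text \<open>The factors of \<open>g\<close> and of its inverse are reciprocal, and neither is less
  than 1.\<close>

lemma poisson_orbit:
  assumes g: "g \<in> \<Gamma>"
  shows "poisson p (g 0) = 1"
proof -
  obtain k where k: "k \<in> \<Gamma>" "\<And>x. norm x < 1 \<Longrightarrow> g (k x) = x" using exists_inverse[OF g] by metis
  have "poisson p (k 0) * poisson p (g 0) = 1"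
    using poisson_image[OF g, of "k 0"] k by (simp add: poisson_0)
  moreover have "1 \<le> poisson p (k 0)" "1 \<le> poisson p (g 0)"
    using poisson_orbit_not_less_1 g k(1) by (auto simp: not_less)
  ultimately show ?thesis
    using mult_mono[of 1 "poisson p (k 0)" "poisson p (g 0)" "poisson p (g 0)"] by simp
qed

lemma poisson_invariant: "g \<in> \<Gamma> \<Longrightarrow> norm x < 1 \<Longrightarrow> poisson p (g x) = poisson p x"
  using poisson_image poisson_orbit by simp

lemma horo_image_dist:
  assumes "g \<in> \<Gamma>" "norm x < 1" "norm y < 1"
  shows "norm (horo p (g x) - horo p (g y)) = norm (horo p x - horo p y)"
proof -
  have "(norm (horo p (g x) - horo p (g y)))\<^sup>2 = (norm (horo p x - horo p y))\<^sup>2"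
    using assms norm_image_less_1
    by (simp add: hyp_quot_poisson[OF _ _ norm_p] hyp_quot_image poisson_invariant)
  then show ?thesis by simp
qed

text \<open>The orbit lies on the horosphere where \<open>poisson p\<close> is 1, so depth is the
  square of the distance to \<open>p\<close>. This is why the exponent \<open>s\<close> of the
  series turns into \<open>2 * s\<close> for norms in half space coordinates.\<close>

lemma norm_horo_orbit:
  assumes g: "g \<in> \<Gamma>"
  shows "(norm (horo p (g 0)))\<^sup>2 = 1 / depth (g 0)"
proof -
  have "depth (g 0) / (norm (g 0 - p))\<^sup>2 = 1" using poisson_orbit[OF g] unfolding poisson_def .
  then have "depth (g 0) = (norm (g 0 - p))\<^sup>2"
    by (simp only: divide_eq_1_iff)
  then show ?thesis by (simp add: norm_horo power_divide)
qed

section \<open>Conjugation to a discrete group of Euclidean isometries\<close>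

definition half_space :: "(real ^ 'n) set" where
  "half_space = {y. p \<bullet> y < - 1/2}"

lemma open_half_space: "open half_space" "half_space \<noteq> {}"
proof -
  show "open half_space" unfolding half_space_def by (rule open_halfspace_lt)
  have "p \<bullet> (- p) = - 1" using norm_p by (simp add: dot_square_norm)
  then have "- p \<in> half_space" by (simp add: half_space_def)
  then show "half_space \<noteq> {}" by blast
qed

lemma half_space_cases:
  assumes "y \<in> half_space"
  obtains x where "norm x < 1" "y = horo p x"
proof (rule that[of "horo_inv p y"])
  show "norm (horo_inv p y) < 1" using assms norm_horo_inv[OF norm_p] by (simp add: half_space_def)
  have "y \<noteq> 0" using assms by (auto simp: half_space_def)
  then show "y = horo p (horo_inv p y)" by (simp add: horo_horo_inv)
qed

definition extends :: "(real ^ 'n \<Rightarrow> real ^ 'n) \<Rightarrow> (real ^ 'n \<Rightarrow> real ^ 'n) \<Rightarrow> bool" where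
  "extends \<phi> g \<longleftrightarrow> (\<forall>x y. dist (\<phi> x) (\<phi> y) = dist x y) \<and> (\<forall>x. norm x < 1 \<longrightarrow> \<phi> (horo p x) = horo p (g x))"

lemma exists_extends:
  assumes g: "g \<in> \<Gamma>"
  shows "\<exists>\<phi>. extends \<phi> g"
proof -
  define f where "f y = horo p (g (horo_inv p y))" for y
  have fh: "f (horo p x) = horo p (g x)" if "norm x < 1" for x
    using horo_inv_horo[OF ne_p[OF that]] by (simp add: f_def)
  have d: "dist (f y) (f y') = dist y y'" if y: "y \<in> half_space" "y' \<in> half_space" for y y'
  proof -
    obtain x x' where "norm x < 1" "y = horo p x" "norm x' < 1" "y' = horo p x'"
      using half_space_cases y by metis
    then show ?thesis using horo_image_dist[OF g] fh by (simp add: dist_norm)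
  qed
  obtain \<phi> where phi: "\<And>x y. dist (\<phi> x) (\<phi> y) = dist x y" "\<And>y. y \<in> half_space \<Longrightarrow> \<phi> y = f y"
    using isometry_extension[OF open_half_space d] by blast
  have "\<phi> (horo p x) = horo p (g x)" if "norm x < 1" for x
    using phi(2)[of "horo p x"] horo_in_half_space[OF norm_p that] fh[OF that] by (simp add: half_space_def)
  then show ?thesis using phi(1) by (auto simp: extends_def)
qed

lemma extends_unique:
  assumes "extends \<phi> g" "extends \<psi> g"
  shows "\<phi> = \<psi>"
proof (rule isometry_unique[OF _ _ open_half_space])
  show "dist (\<phi> x) (\<phi> y) = dist x y" "dist (\<psi> x) (\<psi> y) = dist x y" for x y
    using assms by (auto simp: extends_def)
  show "\<phi> y = \<psi> y" if "y \<in> half_space" for y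
    using half_space_cases[OF that] assms by (metis extends_def)
qed

definition horo_group :: "(real ^ 'n \<Rightarrow> real ^ 'n) set" where
  "horo_group = {\<phi>. \<exists>g\<in>\<Gamma>. extends \<phi> g}"

text \<open>The origin lies outside the half space, so \<phi> 0 says nothing directly about the
  orbit. It is compared with the image of \<open>horo p 0\<close>, a point of norm 1, which costs
  the summand 1 in \<open>X + 1\<close>.\<close>

lemma card_horo_group:
  assumes X: "0 \<le> X"
  shows "finite {\<phi> \<in> horo_group. norm (\<phi> 0) \<le> X}"
    "card {\<phi> \<in> horo_group. norm (\<phi> 0) \<le> X} \<le> card {g \<in> \<Gamma>. 1 / (X + 1)\<^sup>2 \<le> depth (g 0)}"
proof -
  have "\<exists>\<gamma>. \<forall>\<phi>\<in>horo_group. \<gamma> \<phi> \<in> \<Gamma> \<and> extends \<phi> (\<gamma> \<phi>)"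
    by (rule bchoice) (auto simp: horo_group_def)
  then obtain \<gamma> where gam: "\<And>\<phi>. \<phi> \<in> horo_group \<Longrightarrow> \<gamma> \<phi> \<in> \<Gamma>" "\<And>\<phi>. \<phi> \<in> horo_group \<Longrightarrow> extends \<phi> (\<gamma> \<phi>)"
    by blast
  define S where "S = {\<phi> \<in> horo_group. norm (\<phi> 0) \<le> X}"
  define A where "A = {g \<in> \<Gamma>. 1 / (X + 1)\<^sup>2 \<le> depth (g 0)}"
  have A: "finite A" unfolding A_def using X by (intro finite_depth_ge) auto
  have inj: "inj_on \<gamma> S"
    by (rule inj_onI) (metis (no_types, lifting) S_def extends_unique gam(2) mem_Collect_eq)
  have "\<gamma> \<phi> \<in> A" if phi: "\<phi> \<in> horo_group" "norm (\<phi> 0) \<le> X" for \<phi>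
  proof -
    have ex: "extends \<phi> (\<gamma> \<phi>)" "\<gamma> \<phi> \<in> \<Gamma>" using gam phi(1) by auto
    have "norm (\<phi> (horo p 0) - \<phi> 0) = norm (horo p 0)"
      using ex(1) unfolding extends_def by (metis dist_norm diff_zero)
    also have "\<dots> = 1" by (simp add: norm_horo norm_p)
    finally have "norm (\<phi> (horo p 0)) \<le> X + 1"
      using norm_triangle_ineq2[of "\<phi> (horo p 0)" "\<phi> 0"] phi(2) by simp
    then have "norm (horo p (\<gamma> \<phi> 0)) \<le> X + 1" using ex(1) by (simp add: extends_def)
    then have "(norm (horo p (\<gamma> \<phi> 0)))\<^sup>2 \<le> (X + 1)\<^sup>2" by (intro power_mono) auto
    then have "1 / depth (\<gamma> \<phi> 0) \<le> (X + 1)\<^sup>2" using norm_horo_orbit[OF ex(2)] by simp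
    then show ?thesis
      using ex(2) X depth_image_pos[OF ex(2), of 0] by (simp add: A_def field_simps)
  qed
  then have img: "\<gamma> ` S \<subseteq> A" by (auto simp: S_def)
  show "finite {\<phi> \<in> horo_group. norm (\<phi> 0) \<le> X}"
    using inj_on_finite[OF inj img A] by (simp add: S_def)
  show "card {\<phi> \<in> horo_group. norm (\<phi> 0) \<le> X} \<le> card {g \<in> \<Gamma>. 1 / (X + 1)\<^sup>2 \<le> depth (g 0)}"
    using card_inj_on_le[OF inj img A] by (simp add: S_def A_def)
qed

lemma id_if_extends:
  assumes "extends \<phi> g" "\<And>x. norm x < 1 \<Longrightarrow> g x = x"
  shows "\<phi> = id"
proof (rule isometry_unique[OF _ _ open_half_space])
  show "\<phi> y = id y" if "y \<in> half_space" for y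
    using half_space_cases[OF that] assms by (metis extends_def id_apply)
qed (use assms in \<open>auto simp: extends_def\<close>)

lemma extends_comp:
  assumes "extends \<phi> g" "extends \<psi> h" "h \<in> \<Gamma>" "\<And>x. norm x < 1 \<Longrightarrow> k x = g (h x)"
  shows "extends (\<phi> \<circ> \<psi>) k"
  using assms norm_image_less_1 by (auto simp: extends_def)

lemma discrete_horo_group: "discrete_isometry_group horo_group"
proof
  fix f g assume f: "f \<in> horo_group"
  show "dist (f x) (f y) = dist x y" for x y using f by (auto simp: horo_group_def extends_def)
  obtain u where u: "u \<in> \<Gamma>" "extends f u" using f by (auto simp: horo_group_def)
  { assume "g \<in> horo_group"
    then obtain v where v: "v \<in> \<Gamma>" "extends g v" by (auto simp: horo_group_def)
    obtain w where w: "w \<in> \<Gamma>" "\<And>x. norm x < 1 \<Longrightarrow> w x = u (v x)" using exists_comp[OF u(1) v(1)] by metis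
    then show "f \<circ> g \<in> horo_group" using extends_comp[OF u(2) v(2,1)] by (auto simp: horo_group_def)
  }
  obtain k where k: "k \<in> \<Gamma>" "\<And>x. norm x < 1 \<Longrightarrow> k (u x) = x" "\<And>x. norm x < 1 \<Longrightarrow> u (k x) = x"
    using exists_inverse[OF u(1)] by metis
  obtain \<psi> where psi: "extends \<psi> k" using exists_extends[OF k(1)] by blast
  have "\<psi> \<circ> f = id"
    using id_if_extends[OF extends_comp[OF psi u(2,1), of "\<lambda>x. x"]] k(2) by auto
  moreover have "f \<circ> \<psi> = id"
    using id_if_extends[OF extends_comp[OF u(2) psi k(1), of "\<lambda>x. x"]] k(3) by auto
  ultimately show "\<exists>g\<in>horo_group. g \<circ> f = id \<and> f \<circ> g = id"
    using psi k(1) by (auto simp: horo_group_def)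
next
  obtain e where "e \<in> \<Gamma>" "\<And>x. norm x < 1 \<Longrightarrow> e x = x" using exists_identity by metis
  then show "id \<in> horo_group" by (auto simp: horo_group_def extends_def intro!: bexI[of _ e])
next
  fix R :: real
  have "{\<phi> \<in> horo_group. norm (\<phi> 0) \<le> R} \<subseteq> {\<phi> \<in> horo_group. norm (\<phi> 0) \<le> max R 0}" by auto
  then show "finite {\<phi> \<in> horo_group. norm (\<phi> 0) \<le> R}"
    using card_horo_group(1)[of "max R 0"] finite_subset by auto
qed

text \<open>Depth is split dyadically below \<rho>. Passing to half space coordinates enlarges
  distances by the product of the norms, so deeper shells reach farther but are much better
  separated, and the two-scale bound of \<open>card_separated_orbit\<close> decays geometrically
  from shell to shell.\<close>

lemma card_separated_tail:
  assumes s: "0 < s"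
    and B: "\<And>F. finite F \<Longrightarrow> F \<subseteq> \<Gamma> \<Longrightarrow> (\<Sum>g\<in>F. exp (- s * hyp_dist 0 (g 0))) \<le> B"
  obtains D N where "0 < D"
    "\<And>\<rho> Z. 0 < \<rho> \<Longrightarrow> \<rho> \<le> 1 \<Longrightarrow> finite Z \<Longrightarrow> Z \<subseteq> {z. \<exists>g\<in>\<Gamma>. z = g 0 \<and> depth z < \<rho>} \<Longrightarrow>
      (\<And>z z'. z \<in> Z \<Longrightarrow> z' \<in> Z \<Longrightarrow> z \<noteq> z' \<Longrightarrow> D * \<rho> \<le> norm (z - z')) \<Longrightarrow> real (card Z) \<le> N * \<rho> powr (- s)"
proof -
  interpret E: discrete_isometry_group horo_group by (rule discrete_horo_group)
  have count: "real (card {\<phi> \<in> horo_group. norm (\<phi> 0) \<le> X}) \<le> (B * 16 powr s) * X powr (2 * s)"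
    if X: "1 \<le> X" for X
  proof -
    define A where "A = {g \<in> \<Gamma>. 1 / (X + 1)\<^sup>2 \<le> depth (g 0)}"
    have A: "finite A" unfolding A_def using X by (intro finite_depth_ge) auto
    \<comment> \<open>One factor 4 comes from \<open>X + 1 \<le> 2 * X\<close>, the other from
      comparing \<open>depth\<close> with the exponential.\<close>
    have "(1 / (16 * X\<^sup>2)) powr s \<le> exp (- s * hyp_dist 0 (g 0))" if g: "g \<in> A" for g
    proof -
      have "(X + 1)\<^sup>2 \<le> (2 * X)\<^sup>2" using X by (intro power_mono) auto
      then have "1 / (16 * X\<^sup>2) \<le> 1 / (4 * (X + 1)\<^sup>2)"
        using X by (intro divide_left_mono) (auto simp: power_mult_distrib)
      also have "\<dots> \<le> depth (g 0) / 4" using g by (simp add: A_def)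
      finally have "(1 / (16 * X\<^sup>2)) powr s \<le> (depth (g 0) / 4) powr s"
        using s by (intro powr_mono2) auto
      also have "\<dots> \<le> exp (- s * hyp_dist 0 (g 0))" using exp_hyp_dist_bounds(2)[of g s] g s by (simp add: A_def)
      finally show ?thesis .
    qed
    then have "(\<Sum>g\<in>A. (1 / (16 * X\<^sup>2)) powr s) \<le> (\<Sum>g\<in>A. exp (- s * hyp_dist 0 (g 0)))" by (rule sum_mono)
    also have "\<dots> \<le> B" using B[OF A] by (auto simp: A_def)
    finally have "real (card A) * (1 / (16 * X\<^sup>2)) powr s \<le> B" by simp
    moreover have "(1 / (16 * X\<^sup>2)) powr s = 1 / (16 powr s * X powr (2 * s))"
    proof -
      have "(16 * X\<^sup>2) powr s = 16 powr s * (X powr 2) powr s"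
        using X by (simp add: powr_mult powr_numeral)
      then show ?thesis by (simp add: powr_powr powr_divide)
    qed
    ultimately have "real (card A) \<le> (B * 16 powr s) * X powr (2 * s)"
      using X by (simp add: divide_le_eq mult.assoc)
    then show ?thesis using card_horo_group(2)[of X] X by (simp add: A_def)
  qed
  obtain D where D: "1 \<le> D"
    "\<And>R r T. D \<le> r \<Longrightarrow> r \<le> R \<Longrightarrow> finite T \<Longrightarrow> T \<subseteq> (\<lambda>f. f (horo p 0)) ` horo_group \<Longrightarrow>
      (\<And>y. y \<in> T \<Longrightarrow> norm y \<le> R) \<Longrightarrow>
      (\<And>y y'. y \<in> T \<Longrightarrow> y' \<in> T \<Longrightarrow> y \<noteq> y' \<Longrightarrow> r \<le> norm (y - y')) \<Longrightarrow>
      real (card T) \<le> D * (R / r) powr (2 * s)"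
    by (rule E.card_separated_orbit[OF _ count, of "horo p 0"]) (use s in auto)
  define q where "q = 4 powr (- s)"
  have q: "0 < q" "q < 1" using s by (auto simp: q_def powr_less_one)
  define N where "N = 1 + D * 4 powr s / (1 - q)"
  show ?thesis
  proof (rule that[of D N])
    show "0 < D" using D(1) by simp
    fix \<rho> Z
    assume rho: "0 < \<rho>" "\<rho> \<le> 1" and Z: "finite Z" "Z \<subseteq> {z. \<exists>g\<in>\<Gamma>. z = g 0 \<and> depth z < \<rho>}"
      and sep: "\<And>z z'. z \<in> Z \<Longrightarrow> z' \<in> Z \<Longrightarrow> z \<noteq> z' \<Longrightarrow> D * \<rho> \<le> norm (z - z')"
    have Dr: "0 < D * \<rho>" using D(1) rho by simp
    have zG: "\<exists>g\<in>\<Gamma>. z = g 0" and zd: "depth z < \<rho>" "0 < depth z" "norm z < 1" if "z \<in> Z" for z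
      using that Z(2) by auto
    \<comment> \<open>Points of \<open>Z1\<close> are closer to each other than the separation
      permits, so there is at most one. For the others the distance to \<open>p\<close> guarantees
      \<open>r \<le> R\<close> below, a hypothesis of the two-scale bound.\<close>
    define Z1 where "Z1 = {z \<in> Z. norm (z - p) < D * \<rho> / 2}"
    define Z2 where "Z2 = {z \<in> Z. D * \<rho> / 2 \<le> norm (z - p)}"
    have fin: "finite Z1" "finite Z2" using Z(1) by (auto simp: Z1_def Z2_def)
    have "card Z1 \<le> 1"
    proof (rule card_le_Suc0_iff_eq[OF fin(1), THEN iffD2, unfolded One_nat_def[symmetric], OF ballI[OF ballI]])
      fix z z' assume z: "z \<in> Z1" "z' \<in> Z1"
      have "norm (z - z') \<le> norm (z - p) + norm (z' - p)"
        using norm_triangle_ineq4[of "z - p" "z' - p"] by simp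
      also have "\<dots> < D * \<rho>" using z by (simp add: Z1_def)
      finally show "z = z'" using sep z by (force simp: Z1_def)
    qed
    define \<sigma> where "\<sigma> = sqrt \<rho>"
    have sg: "0 < \<sigma>" "\<sigma> * \<sigma> = \<rho>" using rho by (auto simp: \<sigma>_def)
    \<comment> \<open>Normalised so that \<open>norm (horo p z)\<close> is
      \<open>1 / (t z * \<sigma>)\<close>: the dyadic shell of \<open>t z\<close> fixes this norm up
      to a factor 2.\<close>
    define t where "t z = sqrt (depth z / \<rho>)" for z :: "real ^ 'n"
    have t: "0 < t z" "t z \<le> 1" if "z \<in> Z" for z
      using zd[OF that] rho by (auto simp: t_def)
    have ny: "norm (horo p z) = 1 / (t z * \<sigma>)" if zZ: "z \<in> Z" for z
    proof -
      obtain g where g: "g \<in> \<Gamma>" "z = g 0" using zG[OF zZ] by blast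
      have "(t z * \<sigma>)\<^sup>2 = depth z" using rho real_sqrt_pow2[OF divide_nonneg_pos[OF less_imp_le[OF zd(2)[OF zZ]] rho(1)]]
        by (simp add: t_def \<sigma>_def power_mult_distrib)
      then have "(norm (horo p z))\<^sup>2 = (1 / (t z * \<sigma>))\<^sup>2"
        using norm_horo_orbit[OF g(1)] g(2) by (simp add: power_divide)
      then show ?thesis using t[OF zZ] sg by (simp add: power2_eq_iff_nonneg)
    qed
    have "\<exists>k. (1/2) ^ Suc k < t z \<and> t z \<le> (1/2) ^ k" if "z \<in> Z" for z
      using exists_dyadic_shell t[OF that] by blast
    then obtain f where f: "\<And>z. z \<in> Z \<Longrightarrow> (1/2) ^ Suc (f z) < t z \<and> t z \<le> (1/2) ^ f z" by metis
    have "(\<Sum>z\<in>Z2. 1) \<le> (D * 4 powr s * \<rho> powr (- s)) / (1 - q)"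
    proof (rule sum_le_geometric[OF fin(2) _ _ q(2), where f = f])
      show "0 \<le> D * 4 powr s * \<rho> powr (- s)" "0 \<le> q" using D(1) q by auto
      fix k
      define Zk where "Zk = {z \<in> Z2. f z = k}"
      show "(\<Sum>z\<in>{z \<in> Z2. f z = k}. 1) \<le> D * 4 powr s * \<rho> powr (- s) * q ^ k"
      proof (cases "Zk = {}")
        case True
        then show ?thesis using D(1) q by (simp add: Zk_def[symmetric])
      next
        case False
        define T where "T = horo p ` Zk"
        \<comment> \<open>The separation \<open>D * \<rho>\<close> is multiplied by two norms of at
          least \<open>2 ^ k / \<sigma>\<close>, and
          \<open>\<sigma> * \<sigma> = \<rho>\<close>.\<close>
        define r where "r = D * 4 ^ k"
        define R where "R = 2 ^ Suc k / \<sigma>"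
        have ZkZ: "z \<in> Z" "f z = k" "D * \<rho> / 2 \<le> norm (z - p)" if "z \<in> Zk" for z
          using that by (auto simp: Zk_def Z2_def)
        have lower: "2 ^ k / \<sigma> \<le> norm (horo p z)" and upper: "norm (horo p z) \<le> R" if z: "z \<in> Zk" for z
        proof -
          have h: "(1/2) ^ Suc k < t z" "t z \<le> (1/2) ^ k" using f ZkZ[OF z] by auto
          have "2 ^ k / \<sigma> = 1 / ((1/2) ^ k * \<sigma>)" by (simp add: power_one_over field_simps)
          also have "\<dots> \<le> 1 / (t z * \<sigma>)"
            using h t[OF ZkZ(1)[OF z]] sg by (intro divide_left_mono mult_right_mono) auto
          finally show "2 ^ k / \<sigma> \<le> norm (horo p z)" using ny[OF ZkZ(1)[OF z]] by simp
          have "1 / (t z * \<sigma>) \<le> 1 / ((1/2) ^ Suc k * \<sigma>)"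
            using h(1) t[OF ZkZ(1)[OF z]] sg by (intro divide_left_mono mult_right_mono) auto
          also have "\<dots> = R" by (simp add: R_def power_one_over field_simps)
          finally show "norm (horo p z) \<le> R" using ny[OF ZkZ(1)[OF z]] by simp
        qed
        have np: "z \<noteq> p" if "z \<in> Zk" for z using ne_p zd(3) ZkZ(1)[OF that] by blast
        have inj: "inj_on (horo p) Zk"
          by (rule inj_onI) (metis horo_inv_horo np)
        have "real (card T) \<le> D * (R / r) powr (2 * s)"
        proof (rule D(2))
          have "(1::real) \<le> 4 ^ k" by simp
          then show "D \<le> r" unfolding r_def using D(1) mult_left_mono[of 1 "4 ^ k" D] by simp
          obtain z where z: "z \<in> Zk" using False by blast
          have "2 ^ k / \<sigma> \<le> 1 / norm (z - p)" using lower[OF z] by (simp add: norm_horo)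
          also have "\<dots> \<le> 1 / (D * \<rho> / 2)"
            using ZkZ(3)[OF z] Dr np[OF z] by (intro divide_left_mono) (auto intro!: mult_pos_pos)
          finally have "2 ^ k / \<sigma> \<le> 2 / (D * (\<sigma> * \<sigma>))" by (simp add: sg(2))
          then have "2 ^ k * D \<le> 2 / \<sigma>" using sg(1) D(1) by (simp add: field_simps)
          then have "2 ^ k * (2 ^ k * D) \<le> 2 ^ k * (2 / \<sigma>)" by (intro mult_left_mono) auto
          then show "r \<le> R"
            unfolding r_def R_def by (simp add: power_mult_distrib[symmetric] mult_ac)
          show "finite T" using fin(2) by (simp add: T_def Zk_def)
          show "T \<subseteq> (\<lambda>f. f (horo p 0)) ` horo_group"
          proof
            fix y assume "y \<in> T"
            then obtain z where z: "z \<in> Zk" "y = horo p z" by (auto simp: T_def)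
            obtain g where g: "g \<in> \<Gamma>" "z = g 0" using zG ZkZ(1)[OF z(1)] by blast
            obtain \<phi> where phi: "extends \<phi> g" using exists_extends[OF g(1)] by blast
            then have "\<phi> (horo p 0) = y" using z(2) g(2) by (simp add: extends_def)
            then show "y \<in> (\<lambda>f. f (horo p 0)) ` horo_group" using phi g(1) by (auto simp: horo_group_def)
          qed
          show "norm y \<le> R" if "y \<in> T" for y using that upper by (auto simp: T_def)
          show "r \<le> norm (y - y')" if y: "y \<in> T" "y' \<in> T" "y \<noteq> y'" for y y'
          proof -
            obtain z z' where z: "z \<in> Zk" "y = horo p z" "z' \<in> Zk" "y' = horo p z'" using y by (auto simp: T_def)
            have "r = D * \<rho> * ((2 ^ k / \<sigma>) * (2 ^ k / \<sigma>))"
              using sg rho by (simp add: r_def power_mult_distrib[symmetric])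
            also have "\<dots> \<le> norm (z - z') * (norm (horo p z) * norm (horo p z'))"
            proof (rule mult_mono)
              show "D * \<rho> \<le> norm (z - z')" using sep z y(3) ZkZ(1) by blast
              show "2 ^ k / \<sigma> * (2 ^ k / \<sigma>) \<le> norm (horo p z) * norm (horo p z')"
                using lower[OF z(1)] lower[OF z(3)] sg by (intro mult_mono) auto
            qed (use sg in auto)
            also have "\<dots> = norm (y - y')"
              using norm_horo_diff[OF np[OF z(1)] np[OF z(3)]] z by (simp add: norm_horo)
            finally show ?thesis .
          qed
        qed
        also have "R / r = 2 / (D * \<sigma> * 2 ^ k)"
        proof -
          have "(4::real) ^ k = 2 ^ k * 2 ^ k" by (simp add: power_mult_distrib[symmetric])
          then show ?thesis using sg D(1) by (simp add: R_def r_def)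
        qed
        also have "D * (2 / (D * \<sigma> * 2 ^ k)) powr (2 * s) \<le> D * (2 / (\<sigma> * 2 ^ k)) powr (2 * s)"
        proof (intro mult_left_mono powr_mono2)
          have "\<sigma> * 2 ^ k * 1 \<le> \<sigma> * 2 ^ k * D" using sg D(1) by (intro mult_left_mono) auto
          then show "2 / (D * \<sigma> * 2 ^ k) \<le> 2 / (\<sigma> * 2 ^ k)"
            using sg D(1) by (intro divide_left_mono) (auto simp: mult_ac)
        qed (use s sg D(1) in auto)
        also have "(2 / (\<sigma> * 2 ^ k)) powr (2 * s) = 4 powr s * \<rho> powr (- s) * q ^ k"
        proof -
          have "(2 / (\<sigma> * 2 ^ k)) powr (2 * s) = ((2 / (\<sigma> * 2 ^ k)) powr 2) powr s"
            by (simp add: powr_powr)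
          also have "(2 / (\<sigma> * 2 ^ k)) powr 2 = (2 / (\<sigma> * 2 ^ k))\<^sup>2"
            using sg by (intro powr_numeral) auto
          also have "\<dots> = 4 / (\<rho> * 4 ^ k)"
            using sg by (simp add: power2_eq_square power_mult_distrib[symmetric] mult_ac)
          also have "\<dots> powr s = 4 powr s / (\<rho> powr s * (4 ^ k) powr s)"
            using rho by (simp add: powr_divide powr_mult)
          also have "\<dots> = 4 powr s * \<rho> powr (- s) * (4 powr (- s)) ^ k"
            by (simp add: powr_minus powr_realpow[symmetric] powr_powr field_simps power_inverse)
          finally show ?thesis by (simp add: q_def)
        qed
        finally show ?thesis
          using card_image[OF inj] by (simp add: T_def Zk_def mult.assoc)
      qed
    qed
    then have c2: "real (card Z2) \<le> D * 4 powr s / (1 - q) * \<rho> powr (- s)" by simp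
    have "Z = Z1 \<union> Z2" by (auto simp: Z1_def Z2_def)
    then have "card Z \<le> card Z1 + card Z2" using card_Un_le by metis
    then have "real (card Z) \<le> 1 + D * 4 powr s / (1 - q) * \<rho> powr (- s)"
      using \<open>card Z1 \<le> 1\<close> c2 by linarith
    also have "\<dots> \<le> 1 * \<rho> powr (- s) + D * 4 powr s / (1 - q) * \<rho> powr (- s)"
    proof -
      have "\<rho> powr s \<le> 1" using rho s by (intro powr_le1) auto
      then have "1 \<le> \<rho> powr (- s)" using rho by (simp add: powr_minus one_le_inverse)
      then show ?thesis by simp
    qed
    finally show "real (card Z) \<le> N * \<rho> powr (- s)" by (simp add: N_def algebra_simps)
  qed
qed

end

section \<open>The dimension of orbital sets\<close>

lemma scale_cover_mono:
  "scale_cover \<delta> E \<U> \<Longrightarrow> E' \<subseteq> E \<Longrightarrow> \<delta> \<le> \<delta>' \<Longrightarrow> scale_cover \<delta>' E' \<U>"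
  unfolding scale_cover_def by fastforce

lemma scale_cover_Un:
  "scale_cover \<delta> E \<U> \<Longrightarrow> scale_cover \<delta> F \<V> \<Longrightarrow> scale_cover \<delta> (E \<union> F) (\<U> \<union> \<V>)"
  unfolding scale_cover_def by auto

lemma scale_cover_UN:
  assumes "finite A" "\<And>a. a \<in> A \<Longrightarrow> scale_cover \<delta> (E a) (\<U> a)"
  shows "scale_cover \<delta> (\<Union>a\<in>A. E a) (\<Union>a\<in>A. \<U> a)"
  using assms unfolding scale_cover_def by fastforce

lemma scale_cover_thicken:
  fixes W :: "'a::real_normed_vector set"
  assumes U: "scale_cover \<delta> E \<U>" and d: "0 \<le> \<delta>" "0 \<le> a"
    and near: "\<And>w. w \<in> W \<Longrightarrow> \<exists>e\<in>E. norm (w - e) \<le> a"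
  obtains \<V> where "scale_cover (\<delta> + 2 * a) W \<V>" "card \<V> \<le> card \<U>"
proof
  define \<V> where "\<V> = (\<lambda>U. {w. \<exists>u\<in>U. norm (w - u) \<le> a}) ` \<U>"
  have fin: "finite \<U>" using U by (simp add: scale_cover_def)
  show "card \<V> \<le> card \<U>" unfolding \<V>_def by (rule card_image_le[OF fin])
  have "bounded V \<and> diameter V \<le> \<delta> + 2 * a" if VV: "V \<in> \<V>" for V
  proof -
    obtain X where X: "X \<in> \<U>" "V = {w. \<exists>u\<in>X. norm (w - u) \<le> a}" using VV by (auto simp: \<V>_def)
    have "dist v w \<le> \<delta> + 2 * a" if vw: "v \<in> V" "w \<in> V" for v w
    proof -
      obtain u u' where u: "u \<in> X" "norm (v - u) \<le> a" "u' \<in> X" "norm (w - u') \<le> a" using vw X(2) by auto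
      have "dist u u' \<le> \<delta>" using scale_coverD[OF U X(1) u(1,3)] .
      moreover have "dist v w \<le> dist v u + dist u u' + dist w u'"
        using dist_triangle[of v w u] dist_triangle[of u w u'] by (simp add: dist_commute)
      ultimately show ?thesis using u by (simp add: dist_norm)
    qed
    then show ?thesis using diameter_le_of_dist[of V "\<delta> + 2 * a"] d by simp
  qed
  moreover have "W \<subseteq> \<Union>\<V>"
  proof
    fix w assume "w \<in> W"
    then obtain e where e: "e \<in> E" "norm (w - e) \<le> a" using near by blast
    then obtain X where "X \<in> \<U>" "e \<in> X" using U by (auto simp: scale_cover_def)
    then show "w \<in> \<Union>\<V>" using e(2) by (auto simp: \<V>_def)
  qed
  ultimately show "scale_cover (\<delta> + 2 * a) W \<V>"
    using fin by (simp add: scale_cover_def \<V>_def)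
qed

lemma scale_cover_lipschitz_image:
  fixes f :: "'a::real_normed_vector \<Rightarrow> 'b::real_normed_vector"
  assumes U: "scale_cover \<delta> C \<U>" and L: "0 \<le> L" "0 \<le> \<delta>"
    and lip: "\<And>x y. x \<in> C \<Longrightarrow> y \<in> C \<Longrightarrow> norm (f x - f y) \<le> L * norm (x - y)"
  obtains \<V> where "scale_cover (L * \<delta>) (f ` C) \<V>" "card \<V> \<le> card \<U>"
proof
  define \<V> where "\<V> = (\<lambda>U. f ` (U \<inter> C)) ` \<U>"
  have fin: "finite \<U>" using U by (simp add: scale_cover_def)
  show "card \<V> \<le> card \<U>" unfolding \<V>_def by (rule card_image_le[OF fin])
  have "bounded V \<and> diameter V \<le> L * \<delta>" if VV: "V \<in> \<V>" for V
  proof -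
    obtain X where X: "X \<in> \<U>" "V = f ` (X \<inter> C)" using VV by (auto simp: \<V>_def)
    have "dist v w \<le> L * \<delta>" if vw: "v \<in> V" "w \<in> V" for v w
    proof -
      obtain x y where xy: "x \<in> X" "x \<in> C" "y \<in> X" "y \<in> C" "v = f x" "w = f y" using vw X(2) by auto
      have "norm (f x - f y) \<le> L * norm (x - y)" using lip xy by blast
      also have "\<dots> \<le> L * \<delta>"
        using scale_coverD[OF U X(1) xy(1,3)] L by (intro mult_left_mono) (auto simp: dist_norm)
      finally show ?thesis using xy by (simp add: dist_norm)
    qed
    then show ?thesis using diameter_le_of_dist[of V "L * \<delta>"] L by simp
  qed
  moreover have "f ` C \<subseteq> \<Union>\<V>"
  proof clarify
    fix x assume x: "x \<in> C"
    then obtain X where "X \<in> \<U>" "x \<in> X" using U by (auto simp: scale_cover_def)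
    then show "f x \<in> \<Union>\<V>" using x by (auto simp: \<V>_def)
  qed
  ultimately show "scale_cover (L * \<delta>) (f ` C) \<V>"
    using fin by (simp add: scale_cover_def \<V>_def)
qed

context kleinian_group
begin

text \<open>Orbit points of depth below the scale: they are absent if the limit set is empty, close to
  the limit set if it has two points, and otherwise \<open>\<Gamma>\<close> is parabolic and they are counted
  by the Poincare series.\<close>

lemma orbit_tail_cover:
  assumes s: "0 < s" and dimL: "upper_box_dim (limit_set \<Gamma>) < ereal s"
    and B: "\<And>F. finite F \<Longrightarrow> F \<subseteq> \<Gamma> \<Longrightarrow> (\<Sum>g\<in>F. exp (- s * hyp_dist 0 (g 0))) \<le> B"
  obtains K N r0 where "0 < K" "0 < r0" "r0 \<le> 1"
    "\<And>\<rho>. 0 < \<rho> \<Longrightarrow> \<rho> < r0 \<Longrightarrow> \<exists>\<U>. scale_cover (K * \<rho>) {z. \<exists>g\<in>\<Gamma>. z = g 0 \<and> depth z < \<rho>} \<U> \<and>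
      real (card \<U>) \<le> N * \<rho> powr (- s)"
proof -
  consider "limit_set \<Gamma> = {}" | p where "limit_set \<Gamma> = {p}"
    | \<xi> \<eta> where "\<xi> \<in> limit_set \<Gamma>" "\<eta> \<in> limit_set \<Gamma>" "\<xi> \<noteq> \<eta>"
    by blast
  then show ?thesis
  proof cases
    case 1
    have "\<not> (\<forall>e>0. \<exists>g\<in>\<Gamma>. g 0 \<in> UNIV \<and> depth (g 0) < e)"
      using limit_set_meets_closed[of UNIV] 1 by (metis closed_UNIV empty_iff)
    then obtain e where e: "0 < e" "\<And>g. g \<in> \<Gamma> \<Longrightarrow> \<not> depth (g 0) < e" by blast
    show ?thesis
    proof (rule that[of 1 "min e 1" 0])
      fix \<rho> :: real assume "0 < \<rho>" "\<rho> < min e 1"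
      then have "{z. \<exists>g\<in>\<Gamma>. z = g 0 \<and> depth z < \<rho>} = {}" using e(2) by force
      then show "\<exists>\<U>. scale_cover (1 * \<rho>) {z. \<exists>g\<in>\<Gamma>. z = g 0 \<and> depth z < \<rho>} \<U> \<and>
          real (card \<U>) \<le> 0 * \<rho> powr (- s)"
        by (intro exI[of _ "{}"]) (simp add: scale_cover_def)
    qed (use e in auto)
  next
    case (2 p)
    interpret P: parabolic_kleinian_group \<Gamma> p
      by unfold_locales (rule 2)
    obtain D N where DN: "0 < D"
      "\<And>\<rho> Z. 0 < \<rho> \<Longrightarrow> \<rho> \<le> 1 \<Longrightarrow> finite Z \<Longrightarrow> Z \<subseteq> {z. \<exists>g\<in>\<Gamma>. z = g 0 \<and> depth z < \<rho>} \<Longrightarrow>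
      (\<And>z z'. z \<in> Z \<Longrightarrow> z' \<in> Z \<Longrightarrow> z \<noteq> z' \<Longrightarrow> D * \<rho> \<le> norm (z - z')) \<Longrightarrow> real (card Z) \<le> N * \<rho> powr (- s)"
      using P.card_separated_tail[OF s B] by blast
    show ?thesis
    \<comment> \<open>A maximal set with separation \<open>D * \<rho>\<close> gives covering balls
      of diameter at most twice that.\<close>
    proof (rule that[of "2 * D" 1 N])
      fix \<rho> :: real assume r: "0 < \<rho>" "\<rho> < 1"
      have "0 < D * \<rho>" using DN(1) r by simp
      from exists_maximal_separated_cover[OF this, of "{z. \<exists>g\<in>\<Gamma>. z = g 0 \<and> depth z < \<rho>}" "N * \<rho> powr (- s)"]
      show "\<exists>\<U>. scale_cover (2 * D * \<rho>) {z. \<exists>g\<in>\<Gamma>. z = g 0 \<and> depth z < \<rho>} \<U> \<and>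
          real (card \<U>) \<le> N * \<rho> powr (- s)"
        using DN(2)[of \<rho>] r by (simp add: mult.assoc)
    qed (use DN in auto)
  next
    case (3 \<xi> \<eta>)
    obtain K where K: "0 < K" "\<And>g. g \<in> \<Gamma> \<Longrightarrow> \<exists>\<zeta>\<in>limit_set \<Gamma>. norm (g 0 - \<zeta>) \<le> K * depth (g 0)"
      using orbit_near_limit_set[OF 3] by blast
    have bnd: "bounded (limit_set \<Gamma>)"
      unfolding bounded_iff using norm_limit_set by (intro exI[of _ 1]) simp
    obtain N where N: "0 < N" "\<And>\<rho>. 0 < \<rho> \<Longrightarrow> \<rho> \<le> 1 \<Longrightarrow> real (covering_number \<rho> (limit_set \<Gamma>)) \<le> N * \<rho> powr (- s)"
      using covering_number_bound[OF bnd less_imp_le[OF s] dimL, of 1] by blast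
    show ?thesis
    proof (rule that[of "1 + 2 * K" 1 N])
      fix \<rho> :: real assume r: "0 < \<rho>" "\<rho> < 1"
      obtain \<U> where U: "scale_cover \<rho> (limit_set \<Gamma>) \<U>" "card \<U> = covering_number \<rho> (limit_set \<Gamma>)"
        by (rule covering_number_witness[OF bnd r(1)])
      have near: "\<exists>e\<in>limit_set \<Gamma>. norm (w - e) \<le> K * \<rho>" if w: "w \<in> {z. \<exists>g\<in>\<Gamma>. z = g 0 \<and> depth z < \<rho>}" for w
      proof -
        obtain g where g: "g \<in> \<Gamma>" "w = g 0" "depth w < \<rho>" using w by blast
        obtain \<zeta> where z: "\<zeta> \<in> limit_set \<Gamma>" "norm (g 0 - \<zeta>) \<le> K * depth (g 0)" using K(2)[OF g(1)] by blast
        have "K * depth (g 0) \<le> K * \<rho>" using g K(1) by simp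
        then show ?thesis using z g(2) by (intro bexI[of _ \<zeta>]) auto
      qed
      obtain \<V> where V: "scale_cover (\<rho> + 2 * (K * \<rho>)) {z. \<exists>g\<in>\<Gamma>. z = g 0 \<and> depth z < \<rho>} \<V>" "card \<V> \<le> card \<U>"
      proof (rule scale_cover_thicken[OF U(1), of "K * \<rho>" "{z. \<exists>g\<in>\<Gamma>. z = g 0 \<and> depth z < \<rho>}"])
        show "0 \<le> \<rho>" "0 \<le> K * \<rho>" using r K(1) by auto
      qed (rule near, assumption, rule that)
      have "real (card \<V>) \<le> N * \<rho> powr (- s)" using N(2)[of \<rho>] r V(2) U(2) by linarith
      moreover have "\<rho> + 2 * (K * \<rho>) = (1 + 2 * K) * \<rho>" by (simp add: algebra_simps)
      then have "scale_cover ((1 + 2 * K) * \<rho>) {z. \<exists>g\<in>\<Gamma>. z = g 0 \<and> depth z < \<rho>} \<V>"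
        using V(1) by (simp only:)
      ultimately show "\<exists>\<U>. scale_cover ((1 + 2 * K) * \<rho>) {z. \<exists>g\<in>\<Gamma>. z = g 0 \<and> depth z < \<rho>} \<U> \<and>
          real (card \<U>) \<le> N * \<rho> powr (- s)"
        by (intro exI[of _ \<V>] conjI)
    qed (use K in auto)
  qed
qed

lemma upper_box_dim_orbit_le:
  assumes r: "r < 1" and Cr: "\<And>x. x \<in> C \<Longrightarrow> norm x \<le> r"
    and s: "0 < s" and dimL: "upper_box_dim (limit_set \<Gamma>) < ereal s"
    and dimC: "upper_box_dim C < ereal s"
    and P: "poincare_series \<Gamma> s < \<infinity>"
  shows "upper_box_dim (orbit_set \<Gamma> C) \<le> ereal s"
proof -
  have C1: "C \<subseteq> Disc" using Cr r by force
  obtain B where B: "\<And>F. finite F \<Longrightarrow> F \<subseteq> \<Gamma> \<Longrightarrow> (\<Sum>g\<in>F. exp (- s * hyp_dist 0 (g 0))) \<le> B"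
    using P unfolding poincare_series_finite_iff by blast
  obtain K' N r0 where tail: "0 < K'" "0 < r0" "r0 \<le> 1"
    "\<And>\<rho>. 0 < \<rho> \<Longrightarrow> \<rho> < r0 \<Longrightarrow> \<exists>\<U>. scale_cover (K' * \<rho>) {z. \<exists>g\<in>\<Gamma>. z = g 0 \<and> depth z < \<rho>} \<U> \<and>
      real (card \<U>) \<le> N * \<rho> powr (- s)"
    by (rule orbit_tail_cover[OF s dimL B], assumption, assumption) (rule that)
  obtain K where K: "1 \<le> K"
    "\<And>g x. g \<in> \<Gamma> \<Longrightarrow> norm x \<le> r \<Longrightarrow> norm (g x - g 0) \<le> K * depth (g 0)"
    "\<And>g x y. g \<in> \<Gamma> \<Longrightarrow> norm x \<le> r \<Longrightarrow> norm y \<le> r \<Longrightarrow> norm (g x - g y) \<le> K * depth (g 0) * norm (x - y)"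
    by (rule comparison[OF r]) (rule that)
  have bndC: "bounded C" using C1 bounded_subset by blast
  obtain M where M: "0 < M" "\<And>\<rho>. 0 < \<rho> \<Longrightarrow> \<rho> \<le> 1 \<Longrightarrow> real (covering_number \<rho> C) \<le> M * \<rho> powr (- s)"
    using covering_number_bound[OF bndC less_imp_le[OF s] dimC, of 1] by blast
  \<comment> \<open>The tail cover at scale \<open>K' * \<rho>\<close> is thickened by
    \<open>K * \<rho>\<close> on both sides. In \<open>A\<close> the factor \<open>4 * K\<close>
    arises from writing \<open>K * depth (g 0)\<close> as \<open>4 * K\<close> times
    \<open>depth (g 0) / 4\<close>, which the exponential dominates.\<close>
  define c where "c = K' + 2 * K"
  define A where "A = M * (4 * K) powr s * B + N"
  have c: "1 \<le> c" "0 < c" using K(1) tail(1) by (auto simp: c_def)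
  show ?thesis
  proof (rule upper_box_dim_leI[OF bounded_orbit_set[OF C1] less_imp_le[OF s] c(2) tail(2), of A])
    fix \<rho> :: real assume rho: "0 < \<rho>" "\<rho> < r0"
    define H where "H = {g \<in> \<Gamma>. \<rho> \<le> depth (g 0)}"
    have H: "finite H" unfolding H_def by (rule finite_depth_ge[OF rho(1)])
    have "\<exists>\<V>. scale_cover \<rho> (g ` C) \<V> \<and> real (card \<V>) \<le> M * (4 * K) powr s * \<rho> powr (- s) * exp (- s * hyp_dist 0 (g 0))"
      if g: "g \<in> H" for g
    proof -
      have gG: "g \<in> \<Gamma>" and gd: "\<rho> \<le> depth (g 0)" using g by (auto simp: H_def)
      define L where "L = K * depth (g 0)"
      have L: "0 < L" "\<rho> \<le> L"
      proof -
        have d: "0 < depth (g 0)" using gG by simp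
        then show "0 < L" using K(1) by (simp add: L_def)
        have "1 * depth (g 0) \<le> L" unfolding L_def using K(1) d by (intro mult_right_mono) auto
        then show "\<rho> \<le> L" using gd by simp
      qed
      have rL: "0 < \<rho> / L" "\<rho> / L \<le> 1" using rho L by auto
      \<comment> \<open>\<open>C\<close> is covered at scale \<open>\<rho> / L\<close> because
        \<open>g\<close> is \<open>L\<close>-Lipschitz on it. The number of sets is then a multiple
        of \<open>\<rho> powr (- s) * L powr s\<close>, and \<open>L powr s\<close> is comparable to
        the term of \<open>g\<close> in the Poincare series.\<close>
      obtain \<U> where U: "scale_cover (\<rho> / L) C \<U>" "card \<U> = covering_number (\<rho> / L) C"
        by (rule covering_number_witness[OF bndC rL(1)])
      obtain \<V> where V: "scale_cover (L * (\<rho> / L)) (g ` C) \<V>" "card \<V> \<le> card \<U>"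
        by (rule scale_cover_lipschitz_image[OF U(1), of L g]) (use L rL K(3)[OF gG] Cr in \<open>auto simp: L_def\<close>)
      have "real (card \<V>) \<le> M * (\<rho> / L) powr (- s)" using M(2)[OF rL] U(2) V(2) by linarith
      also have "(\<rho> / L) powr (- s) = \<rho> powr (- s) * L powr s"
        using rho L by (simp add: powr_divide powr_minus field_simps)
      also have "L powr s = (4 * K) powr s * (depth (g 0) / 4) powr s"
      proof -
        have "L = (4 * K) * (depth (g 0) / 4)" by (simp add: L_def)
        then show ?thesis by (metis powr_mult)
      qed
      also have "M * (\<rho> powr (- s) * ((4 * K) powr s * (depth (g 0) / 4) powr s))
          \<le> M * (\<rho> powr (- s) * ((4 * K) powr s * exp (- s * hyp_dist 0 (g 0))))"
        using exp_hyp_dist_bounds(2)[OF gG] s M(1) by (intro mult_left_mono) auto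
      finally show ?thesis using V(1) L by (intro exI[of _ \<V>]) (simp add: mult_ac)
    qed
    then obtain \<V> where V: "\<And>g. g \<in> H \<Longrightarrow> scale_cover \<rho> (g ` C) (\<V> g)"
      "\<And>g. g \<in> H \<Longrightarrow> real (card (\<V> g)) \<le> M * (4 * K) powr s * \<rho> powr (- s) * exp (- s * hyp_dist 0 (g 0))"
      by metis
    define \<V>H where "\<V>H = (\<Union>g\<in>H. \<V> g)"
    have coverH: "scale_cover \<rho> (\<Union>g\<in>H. g ` C) \<V>H"
      unfolding \<V>H_def by (rule scale_cover_UN[OF H V(1)])
    have "card \<V>H \<le> (\<Sum>g\<in>H. card (\<V> g))" unfolding \<V>H_def by (rule card_UN_le[OF H])
    then have "real (card \<V>H) \<le> (\<Sum>g\<in>H. real (card (\<V> g)))" by (metis of_nat_le_iff of_nat_sum)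
    also have "\<dots> \<le> (\<Sum>g\<in>H. M * (4 * K) powr s * \<rho> powr (- s) * exp (- s * hyp_dist 0 (g 0)))"
      by (rule sum_mono[OF V(2)])
    also have "\<dots> = M * (4 * K) powr s * \<rho> powr (- s) * (\<Sum>g\<in>H. exp (- s * hyp_dist 0 (g 0)))"
      by (simp add: sum_distrib_left)
    also have "\<dots> \<le> M * (4 * K) powr s * \<rho> powr (- s) * B"
      using B[OF H] M(1) by (intro mult_left_mono) (auto simp: H_def)
    finally have cardH: "real (card \<V>H) \<le> M * (4 * K) powr s * B * \<rho> powr (- s)" by (simp add: mult_ac)
    obtain \<T> where T: "scale_cover (K' * \<rho>) {z. \<exists>g\<in>\<Gamma>. z = g 0 \<and> depth z < \<rho>} \<T>"
      "real (card \<T>) \<le> N * \<rho> powr (- s)"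
      using tail(4)[OF rho] by blast
    define W where "W = (\<Union>g\<in>{g \<in> \<Gamma>. depth (g 0) < \<rho>}. g ` C)"
    have near: "\<exists>e\<in>{z. \<exists>g\<in>\<Gamma>. z = g 0 \<and> depth z < \<rho>}. norm (w - e) \<le> K * \<rho>" if "w \<in> W" for w
    proof -
      obtain g x where g: "g \<in> \<Gamma>" "depth (g 0) < \<rho>" "x \<in> C" "w = g x" using \<open>w \<in> W\<close> by (auto simp: W_def)
      have "norm (g x - g 0) \<le> K * depth (g 0)" using K(2) g Cr by blast
      also have "\<dots> \<le> K * \<rho>" using g K(1) by simp
      finally show ?thesis using g by (intro bexI[of _ "g 0"]) auto
    qed
    obtain \<W> where W: "scale_cover (K' * \<rho> + 2 * (K * \<rho>)) W \<W>" "card \<W> \<le> card \<T>"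
    proof (rule scale_cover_thicken[OF T(1), of "K * \<rho>" W])
      show "0 \<le> K' * \<rho>" "0 \<le> K * \<rho>" using rho tail(1) K(1) by auto
    qed (rule near, assumption, rule that)
    have "\<rho> \<le> c * \<rho>" using c(1) rho by simp
    then have "scale_cover (c * \<rho>) (\<Union>g\<in>H. g ` C) \<V>H" using scale_cover_mono[OF coverH order_refl] by blast
    moreover have "scale_cover (c * \<rho>) W \<W>" using W(1) by (simp add: c_def algebra_simps)
    ultimately have "scale_cover (c * \<rho>) ((\<Union>g\<in>H. g ` C) \<union> W) (\<V>H \<union> \<W>)" by (rule scale_cover_Un)
    moreover have "orbit_set \<Gamma> C \<subseteq> (\<Union>g\<in>H. g ` C) \<union> W"
    proof -
      have "\<Gamma> = H \<union> {g \<in> \<Gamma>. depth (g 0) < \<rho>}" by (auto simp: H_def)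
      then show ?thesis unfolding orbit_set_def W_def by blast
    qed
    ultimately have cover: "scale_cover (c * \<rho>) (orbit_set \<Gamma> C) (\<V>H \<union> \<W>)" by (rule scale_cover_mono) simp
    have "card (\<V>H \<union> \<W>) \<le> card \<V>H + card \<W>" by (rule card_Un_le)
    then have "real (card (\<V>H \<union> \<W>)) \<le> M * (4 * K) powr s * B * \<rho> powr (- s) + N * \<rho> powr (- s)"
      using cardH W(2) T(2) by linarith
    then show "\<exists>\<U>. scale_cover (c * \<rho>) (orbit_set \<Gamma> C) \<U> \<and> real (card \<U>) \<le> A * \<rho> powr (- s)"
      using cover by (intro exI[of _ "\<V>H \<union> \<W>"]) (simp add: A_def algebra_simps)
  qed
qed

lemma poincare_series_finite_mono:
  assumes "poincare_series \<Gamma> t < \<infinity>" "t \<le> s"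
  shows "poincare_series \<Gamma> s < \<infinity>"
proof -
  obtain B where B: "\<And>F. finite F \<Longrightarrow> F \<subseteq> \<Gamma> \<Longrightarrow> (\<Sum>g\<in>F. exp (- t * hyp_dist 0 (g 0))) \<le> B"
    using assms(1) unfolding poincare_series_finite_iff by blast
  have "(\<Sum>g\<in>F. exp (- s * hyp_dist 0 (g 0))) \<le> B" if F: "finite F" "F \<subseteq> \<Gamma>" for F
  proof -
    have "(\<Sum>g\<in>F. exp (- s * hyp_dist 0 (g 0))) \<le> (\<Sum>g\<in>F. exp (- t * hyp_dist 0 (g 0)))"
    proof (rule sum_mono)
      fix g assume "g \<in> F"
      then have "t * hyp_dist 0 (g 0) \<le> s * hyp_dist 0 (g 0)"
        using F(2) assms(2) hyp_dist_orbit_nonneg by (intro mult_right_mono) auto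
      then show "exp (- s * hyp_dist 0 (g 0)) \<le> exp (- t * hyp_dist 0 (g 0))" by simp
    qed
    then show ?thesis using B[OF F] by simp
  qed
  then show ?thesis unfolding poincare_series_finite_iff by blast
qed

lemma upper_box_dim_orbit_set:
  assumes "C \<noteq> {}" "C \<subseteq> Disc" "hyp_bounded C"
  shows "upper_box_dim (orbit_set \<Gamma> C) =
    Max {upper_box_dim (limit_set \<Gamma>), upper_box_dim C, poincare_exponent \<Gamma>}"
proof (rule antisym)
  let ?m = "Max {upper_box_dim (limit_set \<Gamma>), upper_box_dim C, poincare_exponent \<Gamma>}"
  obtain c where c: "c \<in> C" using assms(1) by blast
  have c1: "norm c < 1" using c assms(2) by auto
  have bnd: "bounded (orbit_set \<Gamma> C)" using bounded_orbit_set[OF assms(2)] .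
  have "upper_box_dim (limit_set \<Gamma>) \<le> upper_box_dim (closure (orbit_set \<Gamma> C))"
    using bnd limit_set_subset_closure[OF c c1] by (intro upper_box_dim_mono) auto
  also have "\<dots> \<le> upper_box_dim (orbit_set \<Gamma> C)" by (rule upper_box_dim_closure[OF bnd])
  finally have "upper_box_dim (limit_set \<Gamma>) \<le> upper_box_dim (orbit_set \<Gamma> C)" .
  moreover have "upper_box_dim C \<le> upper_box_dim (orbit_set \<Gamma> C)"
  proof (rule upper_box_dim_mono[OF bnd])
    obtain e where e: "e \<in> \<Gamma>" "\<And>x. norm x < 1 \<Longrightarrow> e x = x" using exists_identity by metis
    show "C \<subseteq> orbit_set \<Gamma> C"
    proof
      fix x assume x: "x \<in> C"
      then have "e x = x" using e(2) assms(2) by auto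
      then show "x \<in> orbit_set \<Gamma> C" using x e(1) unfolding orbit_set_def by (metis UN_I imageI)
    qed
  qed
  moreover have "poincare_exponent \<Gamma> \<le> upper_box_dim (orbit_set \<Gamma> C)"
    by (rule poincare_exponent_le_upper_box_dim[OF c assms(2)])
  ultimately show "?m \<le> upper_box_dim (orbit_set \<Gamma> C)" by simp
  show "upper_box_dim (orbit_set \<Gamma> C) \<le> ?m"
  proof (rule dense_ge)
    \<comment> \<open>Above the maximum all three inequalities are strict, which is what the power
      bounds for covering numbers and the convergence of the series require.\<close>
    fix z assume z: "?m < z"
    then have lt: "upper_box_dim (limit_set \<Gamma>) < z" "upper_box_dim C < z" "poincare_exponent \<Gamma> < z" by auto
    have "0 \<le> upper_box_dim C" using upper_box_dim_nonneg assms(2) bounded_subset bounded_ball by blast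
    then have z0: "0 < z" using lt(2) by simp
    show "upper_box_dim (orbit_set \<Gamma> C) \<le> z"
    proof (cases z)
      case (real s)
      have s: "0 < s" using z0 real by simp
      obtain t where t: "poincare_series \<Gamma> t < \<infinity>" "ereal t < ereal s"
        using lt(3) unfolding poincare_exponent_def real Inf_less_iff by blast
      have "poincare_series \<Gamma> s < \<infinity>" using poincare_series_finite_mono[OF t(1), of s] t(2) by simp
      moreover obtain r where "r < 1" "\<And>x. x \<in> C \<Longrightarrow> norm x \<le> r"
        using hyp_bounded_imp_norm_le[OF assms(3,2)] by metis
      ultimately show ?thesis
        using upper_box_dim_orbit_le[of r C s] s lt real by simp
    qed (use z0 in auto)
  qed
qed

end

theorem theorem2p1:
  fixes \<Gamma> :: "(real ^ 'n \<Rightarrow> real ^ 'n) set" and C :: "(real ^ 'n) set"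
  assumes "CARD('n) \<ge> 2"
    and "kleinian \<Gamma>"
    and "C \<noteq> {}" and "C \<subseteq> Disc" and "hyp_bounded C"
  shows "upper_box_dim (orbit_set \<Gamma> C) =
    Max {upper_box_dim (limit_set \<Gamma>), upper_box_dim C, poincare_exponent \<Gamma>}"
proof -
  interpret kleinian_group \<Gamma> by unfold_locales (rule assms(2))
  show ?thesis by (rule upper_box_dim_orbit_set[OF assms(3-5)])
qed

end
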